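(* Let $X_{/\mathbb{R}}$ be an orthosymmetric smooth real algebraic curve of genus $g\ge2$ with its Fuchsian Schottky uniformization by $\Gamma$. For $p\le0$ consider the map $$U:gr^w_{2p}H^1(\tilde X^* )^{N=0}\longrightarrow gr^\Gamma_{2p}{\mathcal V}$$ given, for $k=1,\dots,g$ and with $n=-p+1$, by $$U\big((2\pi\sqrt{-1})^{p-1}\varphi_k\big)=(2\pi\sqrt{-1})^p\,\hat\Pi_{|p|}\frac{\chi_{{\mathcal S}^+(w_{n,k})}-\chi_{{\mathcal S}^+(w_{n,k+g})}}{2},$$ $$U\big((2\pi\sqrt{-1})^{p-1}\varphi_{k+g}\big)=(2\pi\sqrt{-1})^p\,\hat\Pi_{|p|}\frac{\chi_{{\mathcal S}^+(w_{n,k})}+\chi_{{\mathcal S}^+(w_{n,k+g})}}{2}.$$ Consider also the map $\bar U:gr^w_{2p}H^1(\tilde X^* )^{N=0}\to gr^\Gamma_{2p}\bar{\mathcal V}$ given by $$\bar U\big((2\pi\sqrt{-1})^{p-1}\varphi_k\big)=(2\pi\sqrt{-1})^p\,\frac{\chi_{-p+1,k}-\chi_{-p+1,k+g}}{2},\qquad\bar U\big((2\pi\sqrt{-1})^{p-1}\varphi_{k+g}\big)=(2\pi\sqrt{-1})^p\,\frac{\chi_{-p+1,k}+\chi_{-p+1,k+g}}{2}.$$ Then $U$ is an isomorphism of $H^1(\tilde X^* )^{N=0}$ and ${\mathcal V}\subset{\mathcal P}$. It is equivariant with respect to the action of the real Frobenius $\bar F_\infty$. The Tate twist that gives the grading of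 $H^1(\tilde X^* )^{N=0}$ corresponds to the action of $(2\pi\sqrt{-1})^{-D}$ on ${\mathcal V}$. The map $\bar U$ is an isomorphism of $H^1(\tilde X^* )^{N=0}$ and $\bar{\mathcal V}$ as graded vector spaces, which is equivariant with respect to the action of the real Frobenius $\bar F_\infty$.
   Context: **Uniformization.** $X_{/\mathbb{R}}$ is a compact Riemann surface with antiholomorphic involution $\iota$ whose fixed point set $X_\iota$ is nonempty with complement having two components. $\Gamma\subset\mathrm{PSL}(2,\mathbb{R})$ is a Fuchsian Schottky group of rank $g$ with $X_{/\mathbb{R}}=\Gamma\backslash\Omega_\Gamma$, $\Omega_\Gamma=\mathbb{P}^1(\mathbb{C})\setminus\Lambda_\Gamma$ symmetric under reflection in $\mathbb{P}^1(\mathbb{R})$, the reflection inducing $\iota$ and $\mathbb{P}^1(\mathbb{R})\cap\Omega_\Gamma$ mapping to $X_\iota$. $\Lambda_\Gamma$ is the limit set. $g_1,\dots,g_g$ are free generators, $g_{i+g}=g_i^{-1}$. **Sequences.** ${\mathcal S}^+$ is the Cantor set of right-infinite reduced sequences $a_0a_1\ldots$, $a_i\in\{g_j\}_{j=1}^{2g}$, $a_{i+1}\ne a_i^{-1}$, with shift $T(a_0a_1a_2\ldots)=a_1a_2\ldots$; it is homeomorphic to $\Lambda_\Gamma$ via $a_0a_1\ldots\mapsto\lim_\ell(a_0\cdots a_\ell)x_0$. ${\mathcal S}^+(w)$ is the set of sequences beginning with the word $w$, $\chi_{{\mathcal S}^+(w)}$ its characteristic function, and $w_{n,k}=g_kg_k\cdots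 g_k$ ($n$ times). ${\mathcal P}_n$ is the real vector space of functions on ${\mathcal S}^+\cong\Lambda_\Gamma$ depending only on $a_0,\dots,a_n$, ${\mathcal P}=\bigcup_n{\mathcal P}_n$, $\delta f=f-f\circ T$. ${\mathcal L}=L^2(\Lambda_\Gamma,\mu)$, $\mu$ the Patterson--Sullivan measure; $\Pi_n$ is the orthogonal projection onto ${\mathcal P}_n$, $\hat\Pi_n=\Pi_n-\Pi_{n-1}$ ($\Pi_{-1}=0$), $D=\sum_nn\hat\Pi_n$. **Dynamical cohomology.** ${\mathcal S}_T$ is the mapping torus of the two-sided shift; $H^1({\mathcal S}_T,\mathbb{R})=\varinjlim F_n$ with $F_0={\mathcal P}_0$, $F_n={\mathcal P}_n/\delta{\mathcal P}_{n-1}$. $\mathrm{Gr}_0=F_0$, $\mathrm{Gr}_n=F_n/F_{n-1}$, $H^1_{dyn}=\bigoplus_{p\le0}gr^\Gamma_{2p}H^1_{dyn}$ with $gr^\Gamma_{2p}H^1_{dyn}=\mathrm{Gr}_{-p}\otimes\mathbb{R}(p)$, $\mathbb{R}(p)=(2\pi\sqrt{-1})^p\mathbb{R}$. $\chi_{n,k}\in\mathrm{Gr}_{n-1}$ is the class of $\chi_{{\mathcal S}^+(w_{n,k})}$. **The subspaces.** ${\mathcal V}=\bigoplus_{p\le0}gr^\Gamma_{2p}{\mathcal V}$ with $gr^\Gamma_{2p}{\mathcal V}$ spanned by the $\hat\Pi_{|p|}\chi_{{\mathcal S}^+(w_{-p+1,k})}$, $k=1,\dots,2g$ (with twist $(2\pi\sqrt{-1})^p$).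 $\bar{\mathcal V}=\bigoplus_{p\le0}gr^\Gamma_{2p}\bar{\mathcal V}$ with $gr^\Gamma_{2p}\bar{\mathcal V}\subset gr^\Gamma_{2p}H^1_{dyn}$ spanned by $(2\pi\sqrt{-1})^p\chi_{-p+1,k}$, $k=1,\dots,2g$. The real Frobenius $\bar F_\infty$ is the composition of the involution induced by reversing the orientation of geodesics, which exchanges the words $w_{n,k}$ and $w_{n,k+g}$ (indices mod $2g$), with the sign $(-1)^D$, resp. $(-1)^p$ on $\mathbb{R}(p)$; thus $\bar F_\infty((2\pi\sqrt{-1})^p\hat\Pi_{|p|}\chi_{{\mathcal S}^+(w_{n,k})})=(-1)^p(2\pi\sqrt{-1})^p\hat\Pi_{|p|}\chi_{{\mathcal S}^+(w_{n,k+g})}$ on ${\mathcal V}$, and $\bar F_\infty((2\pi\sqrt{-1})^p\chi_{-p+1,k})=(-1)^p(2\pi\sqrt{-1})^p\chi_{-p+1,k+g}$ on $\bar{\mathcal V}$. **Archimedean cohomology.** $H^1(\tilde X^* )^{N=0}=\bigoplus_{p\le0}gr^w_{2p}H^1(\tilde X^* )^{N=0}$ with $gr^w_{2p}H^1(\tilde X^* )^{N=0}=H^1(X_{/\mathbb{R}},\mathbb{R}(p))$; $\bar F_\infty$ acts as $\iota^*$ composed with $(-1)^p$ on $\mathbb{R}(p)$. For $k=1,\dots,g$, $\omega_k=\sum_{h\in C(\cdot|g_k)}d_z\log\langle hz^+(g_k),hz^-(g_k),z,z_0\rangle$ ($\langle\cdot,\cdot,\cdot,\cdot\rangle$ the cross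 ratio, $C(\cdot|g_k)$ representatives of $\Gamma/\langle g_k\rangle$, $z^\pm(h)$ the attracting/repelling fixed points, $z_0\in\Omega_\Gamma$ a base point), a basis of holomorphic differentials with $\int_{a_j}\omega_k=2\pi\sqrt{-1}\,\delta_{jk}$ for the standard basis $a_j$ of the kernel of $H_1(X_{/\mathbb{R}},\mathbb{Z})\to H_1(\Gamma\backslash\mathbb{H}^3,\mathbb{Z})$. Set $\varphi_k=(\omega_k+\bar\omega_k)/2$, $\varphi_{g+k}=-\sqrt{-1}(\omega_k-\bar\omega_k)/2$. In the convention of the paper these form a basis of $H^1_{DR}(X_{/\mathbb{R}},\mathbb{R}(1))$ (the twist being due to the normalization of $\omega_k$), so that $(2\pi\sqrt{-1})^{p-1}\varphi_k$, $k=1,\dots,2g$, is a basis of $H^1(X_{/\mathbb{R}},\mathbb{R}(p))$, with $\bar F_\infty((2\pi\sqrt{-1})^{p-1}\varphi_k)=(-1)^{p-1}(2\pi\sqrt{-1})^{p-1}\varphi_k$ and $\bar F_\infty((2\pi\sqrt{-1})^{p-1}\varphi_{g+k})=-(-1)^{p-1}(2\pi\sqrt{-1})^{p-1}\varphi_{g+k}$ for $k\le g$.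
   Formalization: For g = 2 the four classes χ_{2,k} are linearly dependent in Gr_1, so Ū is not injective at p = −1; the isomorphism claim for Ū is made for g ≥ 3, and for g = 2 only in degrees p ≠ −1 (surjectivity and equivariance are kept for all g ≥ 2). *)

theory Defs
  imports "HOL-Analysis.Analysis" "HOL-Library.Function_Algebras"
begin

section \<open>Linear algebra\<close>

text \<open>Functions into a real vector space form a real vector space (pointwise operations).\<close>

instantiation "fun" :: (type, real_vector) real_vector
begin
definition scaleR_fun_def: "scaleR r f = (\<lambda>x. r *\<^sub>R f x)"
instance
  by standard (simp_all add: scaleR_fun_def plus_fun_def fun_eq_iff algebra_simps)
end

text \<open>Real vector spaces with an explicit carrier; these are needed because quotient spaces
  depend on parameters and so cannot be types.\<close>

record 'a rspace =
  carr :: "'a set"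
  radd :: "'a \<Rightarrow> 'a \<Rightarrow> 'a"
  rscl :: "real \<Rightarrow> 'a \<Rightarrow> 'a"
  rzero :: 'a

definition rsub :: "'a::real_vector set \<Rightarrow> 'a rspace" where
  "rsub V = \<lparr>carr = V, radd = (+), rscl = (*\<^sub>R), rzero = 0\<rparr>"

definition rcls :: "'a rspace \<Rightarrow> 'a set \<Rightarrow> 'a \<Rightarrow> 'a set" where
  "rcls A W x = {radd A x w | w. w \<in> W}"

definition rquot :: "'a rspace \<Rightarrow> 'a set \<Rightarrow> 'a set rspace" where
  "rquot A W =
     \<lparr>carr = rcls A W ` carr A,
      radd = (\<lambda>Y Z. {radd A y z | y z. y \<in> Y \<and> z \<in> Z}),
      rscl = (\<lambda>r Y. {radd A (rscl A r y) w | y w. y \<in> Y \<and> w \<in> W}),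
      rzero = rcls A W (rzero A)\<rparr>"

definition rdsum :: "'i set \<Rightarrow> ('i \<Rightarrow> 'a rspace) \<Rightarrow> ('i \<Rightarrow> 'a) rspace" where
  "rdsum I A =
     \<lparr>carr = {x \<in> Pi\<^sub>E I (\<lambda>i. carr (A i)). finite {i \<in> I. x i \<noteq> rzero (A i)}},
      radd = (\<lambda>x y. \<lambda>i\<in>I. radd (A i) (x i) (y i)),
      rscl = (\<lambda>r x. \<lambda>i\<in>I. rscl (A i) r (x i)),
      rzero = (\<lambda>i\<in>I. rzero (A i))\<rparr>"

definition rspan :: "'a rspace \<Rightarrow> 'a set \<Rightarrow> 'a set" where
  "rspan A S = \<Inter>{W. W \<subseteq> carr A \<and> S \<subseteq> W \<and> rzero A \<in> W \<and>
                     (\<forall>x\<in>W. \<forall>y\<in>W. radd A x y \<in> W) \<and> (\<forall>r. \<forall>x\<in>W. rscl A r x \<in> W)}"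

definition rbasis :: "'a rspace \<Rightarrow> 'i set \<Rightarrow> ('i \<Rightarrow> 'a) \<Rightarrow> bool" where
  "rbasis A I b \<longleftrightarrow> b ` I \<subseteq> carr A \<and> rspan A (b ` I) = carr A \<and>
     (\<forall>i\<in>I. b i \<notin> rspan A (b ` (I - {i})))"

definition rlinear :: "'a rspace \<Rightarrow> 'b rspace \<Rightarrow> ('a \<Rightarrow> 'b) \<Rightarrow> bool" where
  "rlinear A B f \<longleftrightarrow> f ` carr A \<subseteq> carr B \<and>
     (\<forall>x\<in>carr A. \<forall>y\<in>carr A. f (radd A x y) = radd B (f x) (f y)) \<and>
     (\<forall>r. \<forall>x\<in>carr A. f (rscl A r x) = rscl B r (f x))"

definition riso :: "'a rspace \<Rightarrow> 'b rspace \<Rightarrow> ('a \<Rightarrow> 'b) \<Rightarrow> bool" where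
  "riso A B f \<longleftrightarrow> rlinear A B f \<and> bij_betw f (carr A) (carr B)"

text \<open>Maps out of a direct sum over the degrees \<open>p \<le> 0\<close>, given by their components: the map into
  another direct sum, and the map into a fixed space obtained by adding up.\<close>

definition graded_map :: "(int \<Rightarrow> 'a \<Rightarrow> 'b) \<Rightarrow> (int \<Rightarrow> 'a) \<Rightarrow> int \<Rightarrow> 'b" where
  "graded_map f x = (\<lambda>p\<in>{..0}. f p (x p))"

definition sum_map :: "(int \<Rightarrow> 'a \<Rightarrow> 'b::comm_monoid_add) \<Rightarrow> (int \<Rightarrow> 'a) \<Rightarrow> 'b" where
  "sum_map f x = (\<Sum>p | p \<le> 0 \<and> f p (x p) \<noteq> 0. f p (x p))"

definition cscale :: "complex \<Rightarrow> ('a \<Rightarrow> complex) \<Rightarrow> 'a \<Rightarrow> complex" where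
  "cscale c f = (\<lambda>x. c * f x)"

text \<open>The generator of the Tate twist and its real line \<open>\<real>(p) = (2\<pi>\<i>)^p \<real>\<close>.\<close>

definition twopii :: complex where
  "twopii = 2 * of_real pi * \<i>"

definition tate :: "int \<Rightarrow> complex set" where
  "tate p = {twopii powi p * of_real r | r. True}"


section \<open>The Riemann sphere\<close>

datatype csphere = Fin complex | Infty

text \<open>Stereographic projection; the metric is the chordal one.\<close>

primrec stereo :: "csphere \<Rightarrow> complex \<times> real" where
  "stereo (Fin z) = ((2 / (1 + (cmod z)\<^sup>2)) *\<^sub>R z, 1 - 2 / (1 + (cmod z)\<^sup>2))"
| "stereo Infty = (0, 1)"

lemma stereo_inj: "stereo x = stereo y \<Longrightarrow> x = y"
proof -
  have pos: "2 / (1 + (cmod z)\<^sup>2) \<noteq> 0" for z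
    using zero_le_power2[of "cmod z"] by (simp add: add_nonneg_eq_0_iff)
  assume eq: "stereo x = stereo y"
  show "x = y"
  proof (cases x; cases y)
    fix z w assume xy: "x = Fin z" "y = Fin w"
    then have "2 / (1 + (cmod z)\<^sup>2) = 2 / (1 + (cmod w)\<^sup>2)"
      using eq by simp
    moreover have "(2 / (1 + (cmod z)\<^sup>2)) *\<^sub>R z = (2 / (1 + (cmod w)\<^sup>2)) *\<^sub>R w"
      using eq xy by (simp only: stereo.simps prod.inject)
    ultimately show ?thesis
      using pos xy by (metis scaleR_left_imp_eq)
  qed (use eq pos in auto)
qed

instantiation csphere :: metric_space
begin
definition dist_csphere :: "csphere \<Rightarrow> csphere \<Rightarrow> real" where
  "dist_csphere x y = dist (stereo x) (stereo y)"
definition uniformity_csphere :: "(csphere \<times> csphere) filter" where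
  "uniformity_csphere = (INF e\<in>{0<..}. principal {(x, y). dist x y < e})"
definition open_csphere :: "csphere set \<Rightarrow> bool" where
  "open_csphere U \<longleftrightarrow> (\<forall>x\<in>U. eventually (\<lambda>(x', y). x' = x \<longrightarrow> y \<in> U) uniformity)"
instance
proof
  fix x y z :: csphere
  show "dist x y = 0 \<longleftrightarrow> x = y"
    using stereo_inj by (auto simp: dist_csphere_def)
  show "dist x y \<le> dist x z + dist y z"
    unfolding dist_csphere_def by (rule dist_triangle2)
qed (auto simp: uniformity_csphere_def open_csphere_def)
end

text \<open>The affine coordinate at infinity.\<close>

definition inf_chart :: "complex \<Rightarrow> csphere" where
  "inf_chart w = (if w = 0 then Infty else Fin (1 / w))"

primrec hom :: "csphere \<Rightarrow> complex \<times> complex" where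
  "hom (Fin z) = (z, 1)"
| "hom Infty = (1, 0)"

text \<open>An element of \<open>PSL(2,\<real>)\<close> is given by a matrix of determinant 1 up to sign.\<close>

type_synonym mat2 = "real^2^2"

primrec mob :: "mat2 \<Rightarrow> csphere \<Rightarrow> csphere" where
  "mob A (Fin z) =
     (if of_real (A$2$1) * z + of_real (A$2$2) = 0 then Infty
      else Fin ((of_real (A$1$1) * z + of_real (A$1$2)) / (of_real (A$2$1) * z + of_real (A$2$2))))"
| "mob A Infty = (if A$2$1 = 0 then Infty else Fin (of_real (A$1$1) / of_real (A$2$1)))"

text \<open>The conformal factor of \<open>mob A\<close> for the spherical metric: \<open>|v|^2 / |A v|^2\<close>, where \<open>v\<close> are
  homogeneous coordinates of the point and \<open>det A = 1\<close>.\<close>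

definition conf_factor :: "mat2 \<Rightarrow> csphere \<Rightarrow> real" where
  "conf_factor A x = (case hom x of (u, v) \<Rightarrow>
     ((cmod u)\<^sup>2 + (cmod v)\<^sup>2) /
     ((cmod (of_real (A$1$1) * u + of_real (A$1$2) * v))\<^sup>2
      + (cmod (of_real (A$2$1) * u + of_real (A$2$2) * v))\<^sup>2))"

definition zplus :: "mat2 \<Rightarrow> csphere" where
  "zplus A = (THE x. mob A x = x \<and> conf_factor A x < 1)"

definition zminus :: "mat2 \<Rightarrow> csphere" where
  "zminus A = (THE x. mob A x = x \<and> conf_factor A x > 1)"

definition hdet :: "csphere \<Rightarrow> csphere \<Rightarrow> complex" where
  "hdet x y = fst (hom x) * snd (hom y) - fst (hom y) * snd (hom x)"

text \<open>The cross ratio \<open>(a - c)(b - d) / ((a - d)(b - c))\<close>, as a function of \<open>c\<close> with its zero at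
  \<open>a\<close>, its pole at \<open>b\<close> and value 1 at \<open>d\<close>.\<close>

definition cross_ratio :: "csphere \<Rightarrow> csphere \<Rightarrow> csphere \<Rightarrow> csphere \<Rightarrow> complex" where
  "cross_ratio a b c d = (hdet a c * hdet b d) / (hdet a d * hdet b c)"


section \<open>Fuchsian Schottky groups\<close>

text \<open>\<open>gen X 1, \<dots>, gen X (2 g)\<close> are lifts to \<open>SL(2,\<real>)\<close> of the free generators and their
  inverses (a free subgroup of \<open>PSL(2,\<real>)\<close> lifts isomorphically, and \<open>Gam X\<close> is the lift generated
  by the chosen matrices). \<open>codept X\<close> and \<open>basept X\<close> are the points \<open>x\<^sub>0\<close> and \<open>z\<^sub>0\<close>, \<open>reps X k\<close>
  represents the cosets of the \<open>k\<close>-th cyclic subgroup, and \<open>psm X\<close> is the Patterson--Sullivan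
  measure.\<close>

record schottky =
  genus :: nat
  gen :: "nat \<Rightarrow> mat2"
  codept :: csphere
  basept :: csphere
  reps :: "nat \<Rightarrow> mat2 set"
  psm :: "csphere measure"

definition letters :: "schottky \<Rightarrow> nat set" where
  "letters X = {1..2 * genus X}"

definition linv :: "schottky \<Rightarrow> nat \<Rightarrow> nat" where
  "linv X k = (if k \<le> genus X then k + genus X else k - genus X)"

definition reduced :: "schottky \<Rightarrow> nat list \<Rightarrow> bool" where
  "reduced X w \<longleftrightarrow> set w \<subseteq> letters X \<and> (\<forall>i. Suc i < length w \<longrightarrow> w ! Suc i \<noteq> linv X (w ! i))"

primrec word_mat :: "schottky \<Rightarrow> nat list \<Rightarrow> mat2" where
  "word_mat X [] = mat 1"
| "word_mat X (k # w) = gen X k ** word_mat X w"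

definition Gam :: "schottky \<Rightarrow> mat2 set" where
  "Gam X = word_mat X ` lists (letters X)"

definition limit_set :: "schottky \<Rightarrow> csphere set" where
  "limit_set X = {x. \<exists>z A. (\<forall>n::nat. A n \<in> Gam X) \<and>
                     (\<forall>m n. m \<noteq> n \<longrightarrow> A m \<noteq> A n \<and> A m \<noteq> - A n) \<and>
                     (\<lambda>n. mob (A n) z) \<longlonglongrightarrow> x}"

definition Omega :: "schottky \<Rightarrow> csphere set" where
  "Omega X = - limit_set X"

text \<open>\<open>X = Gam X \<bslash> Omega X\<close>. Since the matrices are real, \<open>z \<mapsto> cnj z\<close> descends to the
  antiholomorphic involution \<open>\<iota>\<close>, and the upper and lower half planes give the two components of the
  complement of its fixed set. The Schottky condition is: discrete, purely hyperbolic and free.\<close>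

definition fuchsian_schottky :: "schottky \<Rightarrow> bool" where
  "fuchsian_schottky X \<longleftrightarrow>
     (\<forall>k\<in>letters X. det (gen X k) = 1) \<and>
     (\<forall>k\<in>{1..genus X}. gen X (k + genus X) = matrix_inv (gen X k)) \<and>
     (\<forall>w. reduced X w \<and> w \<noteq> [] \<longrightarrow> word_mat X w \<noteq> mat 1 \<and> word_mat X w \<noteq> - mat 1) \<and>
     (\<forall>A\<in>Gam X. A \<noteq> mat 1 \<longrightarrow> \<bar>trace A\<bar> > 2) \<and>
     (\<forall>A. \<not> A islimpt Gam X)"


section \<open>Sequences and the limit set\<close>

type_synonym seqn = "nat \<Rightarrow> nat"

definition splus :: "schottky \<Rightarrow> seqn set" where
  "splus X = {a. (\<forall>i. a i \<in> letters X) \<and> (\<forall>i. a (Suc i) \<noteq> linv X (a i))}"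

definition shift :: "seqn \<Rightarrow> seqn" where
  "shift a = (\<lambda>i. a (Suc i))"

definition coding :: "schottky \<Rightarrow> seqn \<Rightarrow> csphere" where
  "coding X a = lim (\<lambda>l. mob (word_mat X (map a [0..<Suc l])) (codept X))"

text \<open>The standing identification of the limit set with the space of right-infinite reduced
  sequences (topologized as a subspace of the product of discrete spaces).\<close>

definition coding_homeo :: "schottky \<Rightarrow> bool" where
  "coding_homeo X \<longleftrightarrow> codept X \<in> Omega X \<and>
     (\<forall>a\<in>splus X. convergent (\<lambda>l. mob (word_mat X (map a [0..<Suc l])) (codept X))) \<and>
     (\<exists>h. homeomorphism (splus X) (limit_set X) (coding X) h)"

text \<open>Functions on \<open>splus X\<close> are represented by functions vanishing outside \<open>splus X\<close>.
  \<open>PC X n\<close> is the complexification of the space of functions depending only on \<open>a\<^sub>0, \<dots>, a\<^sub>n\<close>, and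
  \<open>Pn X n p\<close> consists of its \<open>\<real>(p)\<close>-valued functions, so that \<open>Pn X n 0\<close> is the real space and
  \<open>Pn X n p\<close> its twist by \<open>\<real>(p)\<close>.\<close>

definition PC :: "schottky \<Rightarrow> nat \<Rightarrow> (seqn \<Rightarrow> complex) set" where
  "PC X n = {f. (\<forall>a. a \<notin> splus X \<longrightarrow> f a = 0) \<and>
                (\<forall>a\<in>splus X. \<forall>b\<in>splus X. (\<forall>i\<le>n. a i = b i) \<longrightarrow> f a = f b)}"

definition Pn :: "schottky \<Rightarrow> nat \<Rightarrow> int \<Rightarrow> (seqn \<Rightarrow> complex) set" where
  "Pn X n p = {f \<in> PC X n. \<forall>a. f a \<in> tate p}"

definition delta :: "schottky \<Rightarrow> (seqn \<Rightarrow> complex) \<Rightarrow> seqn \<Rightarrow> complex" where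
  "delta X f = (\<lambda>a. if a \<in> splus X then f a - f (shift a) else 0)"

definition chi :: "schottky \<Rightarrow> nat list \<Rightarrow> seqn \<Rightarrow> complex" where
  "chi X w = indicator {a \<in> splus X. \<forall>i<length w. a i = w ! i}"

definition wnk :: "nat \<Rightarrow> nat \<Rightarrow> nat list" where
  "wnk n k = replicate n k"


section \<open>The Patterson--Sullivan measure and the grading operator\<close>

text \<open>\<open>cosh (d(\<i>, A \<i>)) = \<parallel>A\<parallel>\<^sup>2 / 2\<close> for the hyperbolic distance of the upper half plane.\<close>

definition critical_exponent :: "schottky \<Rightarrow> real" where
  "critical_exponent X = Inf {s. s > 0 \<and>
     (\<lambda>A. exp (- s * arcosh (((A$1$1)\<^sup>2 + (A$1$2)\<^sup>2 + (A$2$1)\<^sup>2 + (A$2$2)\<^sup>2) / 2)))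
       summable_on Gam X}"

text \<open>The conformal probability measure on the limit set, normalized at the point \<open>\<i>\<close>.\<close>

definition patterson_sullivan :: "schottky \<Rightarrow> csphere measure \<Rightarrow> bool" where
  "patterson_sullivan X \<mu> \<longleftrightarrow> sets \<mu> = sets borel \<and> emeasure \<mu> (space \<mu>) = 1 \<and>
     (AE x in \<mu>. x \<in> limit_set X) \<and>
     (\<forall>A\<in>Gam X. \<forall>E\<in>sets borel.
        emeasure \<mu> (mob A ` E)
          = (\<integral>\<^sup>+x\<in>E. ennreal (conf_factor A x powr critical_exponent X) \<partial>\<mu>))"

definition ip :: "schottky \<Rightarrow> (seqn \<Rightarrow> complex) \<Rightarrow> (seqn \<Rightarrow> complex) \<Rightarrow> complex" where
  "ip X f q = (LINT x:limit_set X|psm X.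
     f (the_inv_into (splus X) (coding X) x) * cnj (q (the_inv_into (splus X) (coding X) x)))"

definition Pi_proj :: "schottky \<Rightarrow> nat \<Rightarrow> (seqn \<Rightarrow> complex) \<Rightarrow> seqn \<Rightarrow> complex" where
  "Pi_proj X n f = (THE h. h \<in> PC X n \<and> (\<forall>q\<in>PC X n. ip X (f - h) q = 0))"

definition Pi_hat :: "schottky \<Rightarrow> nat \<Rightarrow> (seqn \<Rightarrow> complex) \<Rightarrow> seqn \<Rightarrow> complex" where
  "Pi_hat X n f = (if n = 0 then Pi_proj X 0 f else Pi_proj X n f - Pi_proj X (n - 1) f)"

text \<open>Functional calculus of \<open>D = (\<Sum>n. n * Pi_hat n)\<close>: the operator \<open>c(D) = (\<Sum>n. c n * Pi_hat n)\<close>.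
  On the union of the \<open>PC X n\<close> only finitely many terms are nonzero.\<close>

definition fun_of_D :: "schottky \<Rightarrow> (nat \<Rightarrow> complex) \<Rightarrow> (seqn \<Rightarrow> complex) \<Rightarrow> seqn \<Rightarrow> complex" where
  "fun_of_D X c f = (\<Sum>n | Pi_hat X n f \<noteq> 0. cscale (c n) (Pi_hat X n f))"

definition twist_D :: "schottky \<Rightarrow> (seqn \<Rightarrow> complex) \<Rightarrow> seqn \<Rightarrow> complex" where
  "twist_D X = fun_of_D X (\<lambda>n. twopii powi (- int n))"

definition sign_D :: "schottky \<Rightarrow> (seqn \<Rightarrow> complex) \<Rightarrow> seqn \<Rightarrow> complex" where
  "sign_D X = fun_of_D X (\<lambda>n. (- 1) ^ n)"


section \<open>The space V\<close>

definition v_untw :: "schottky \<Rightarrow> int \<Rightarrow> nat \<Rightarrow> seqn \<Rightarrow> complex" where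
  "v_untw X p k = Pi_hat X (nat (- p)) (chi X (wnk (nat (- p + 1)) k))"

definition v_gen :: "schottky \<Rightarrow> int \<Rightarrow> nat \<Rightarrow> seqn \<Rightarrow> complex" where
  "v_gen X p k = cscale (twopii powi p) (v_untw X p k)"

definition grV_untw :: "schottky \<Rightarrow> int \<Rightarrow> (seqn \<Rightarrow> complex) rspace" where
  "grV_untw X p = rsub (span (v_untw X p ` letters X))"

definition grV :: "schottky \<Rightarrow> int \<Rightarrow> (seqn \<Rightarrow> complex) rspace" where
  "grV X p = rsub (span (v_gen X p ` letters X))"

text \<open>The total spaces, as subspaces of the space of (complex) functions on \<open>splus X\<close>.\<close>

definition V_untw :: "schottky \<Rightarrow> (seqn \<Rightarrow> complex) rspace" where
  "V_untw X = rsub (span (\<Union>p\<in>{..0}. v_untw X p ` letters X))"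

definition Vtot :: "schottky \<Rightarrow> (seqn \<Rightarrow> complex) rspace" where
  "Vtot X = rsub (span (\<Union>p\<in>{..0}. v_gen X p ` letters X))"

text \<open>On \<open>V\<close>, reversal of the orientation of geodesics is the linear map exchanging the words
  \<open>w\<^sub>n\<^sub>,\<^sub>k\<close> and \<open>w\<^sub>n\<^sub>,\<^sub>k\<^sub>+\<^sub>g\<close>.\<close>

definition reversal_V :: "schottky \<Rightarrow> (seqn \<Rightarrow> complex) \<Rightarrow> seqn \<Rightarrow> complex" where
  "reversal_V X = (SOME J. rlinear (Vtot X) (Vtot X) J \<and>
     (\<forall>p\<le>0. \<forall>k\<in>letters X. J (v_gen X p k) = v_gen X p (linv X k)))"

definition frob_V :: "schottky \<Rightarrow> (seqn \<Rightarrow> complex) \<Rightarrow> seqn \<Rightarrow> complex" where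
  "frob_V X f = reversal_V X (sign_D X f)"


section \<open>Dynamical cohomology\<close>

text \<open>\<open>Fn X n p\<close> is \<open>F\<^sub>n \<otimes> \<real>(p)\<close>. For \<open>n = 0\<close> it is the quotient of \<open>P\<^sub>0 \<otimes> \<real>(p)\<close> by the zero space,
  and similarly for \<open>Gr\<close>.\<close>

primrec dP :: "schottky \<Rightarrow> nat \<Rightarrow> int \<Rightarrow> (seqn \<Rightarrow> complex) set" where
  "dP X 0 p = {0}"
| "dP X (Suc n) p = delta X ` Pn X n p"

definition Fn :: "schottky \<Rightarrow> nat \<Rightarrow> int \<Rightarrow> (seqn \<Rightarrow> complex) set rspace" where
  "Fn X n p = rquot (rsub (Pn X n p)) (dP X n p)"

text \<open>\<open>F_prev X n p\<close> is the image in \<open>Fn X n p\<close> of the preceding term of the direct system, under the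
  map induced by the inclusion of function spaces.\<close>

primrec F_prev :: "schottky \<Rightarrow> nat \<Rightarrow> int \<Rightarrow> (seqn \<Rightarrow> complex) set set" where
  "F_prev X 0 p = {rzero (Fn X 0 p)}"
| "F_prev X (Suc n) p = rcls (rsub (Pn X (Suc n) p)) (dP X (Suc n) p) ` Pn X n p"

definition Gr :: "schottky \<Rightarrow> nat \<Rightarrow> int \<Rightarrow> (seqn \<Rightarrow> complex) set set rspace" where
  "Gr X n p = rquot (Fn X n p) (F_prev X n p)"

definition gr_class :: "schottky \<Rightarrow> nat \<Rightarrow> int \<Rightarrow> (seqn \<Rightarrow> complex) \<Rightarrow> (seqn \<Rightarrow> complex) set set" where
  "gr_class X n p f = rcls (Fn X n p) (F_prev X n p) (rcls (rsub (Pn X n p)) (dP X n p) f)"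

definition grHdyn :: "schottky \<Rightarrow> int \<Rightarrow> (seqn \<Rightarrow> complex) set set rspace" where
  "grHdyn X p = Gr X (nat (- p)) p"

text \<open>\<open>chi_class X p k\<close> is \<open>(2\<pi>\<i>)^p\<close> times the class \<open>\<chi>\<^sub>n\<^sub>,\<^sub>k\<close>, \<open>n = -p + 1\<close>.\<close>

definition chi_class :: "schottky \<Rightarrow> int \<Rightarrow> nat \<Rightarrow> (seqn \<Rightarrow> complex) set set" where
  "chi_class X p k =
     gr_class X (nat (- p)) p (cscale (twopii powi p) (chi X (wnk (nat (- p + 1)) k)))"

definition grVbar :: "schottky \<Rightarrow> int \<Rightarrow> (seqn \<Rightarrow> complex) set set rspace" where
  "grVbar X p = (grHdyn X p)\<lparr>carr := rspan (grHdyn X p) (chi_class X p ` letters X)\<rparr>"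

definition Vbar :: "schottky \<Rightarrow> (int \<Rightarrow> (seqn \<Rightarrow> complex) set set) rspace" where
  "Vbar X = rdsum {..0} (grVbar X)"

text \<open>Reversing the orientation of geodesics replaces a word \<open>a\<^sub>0 \<dots> a\<^sub>n\<close> by \<open>a\<^sub>n\<inverse> \<dots> a\<^sub>0\<inverse>\<close>. This
  operation on functions of \<open>a\<^sub>0, \<dots>, a\<^sub>n\<close> maps \<open>dP\<close> to itself, and the functions of
  \<open>a\<^sub>0, \<dots>, a\<^sub>n\<^sub>-\<^sub>1\<close> to themselves modulo \<open>dP\<close>, hence maps the classes in \<open>Gr\<close>, which are sets of
  sets of functions, to such classes.\<close>

definition reversal :: "schottky \<Rightarrow> nat \<Rightarrow> (seqn \<Rightarrow> complex) \<Rightarrow> seqn \<Rightarrow> complex" where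
  "reversal X n f = (\<lambda>a. if a \<in> splus X
     then f (SOME b. b \<in> splus X \<and> (\<forall>i\<le>n. b i = linv X (a (n - i)))) else 0)"

definition frob_Hdyn :: "schottky \<Rightarrow> int \<Rightarrow> (seqn \<Rightarrow> complex) set set \<Rightarrow> (seqn \<Rightarrow> complex) set set" where
  "frob_Hdyn X p Y = (\<lambda>Z. (\<lambda>f. cscale ((- 1) powi p) (reversal X (nat (- p)) f)) ` Z) ` Y"

text \<open>In genus 2 the four classes \<open>\<chi>\<^sub>2\<^sub>,\<^sub>k\<close> are linearly dependent in \<open>Gr\<^sub>1\<close>, since a nontrivial
  combination of the characteristic functions lies in \<open>P\<^sub>0 + \<delta> P\<^sub>0\<close>. There \<open>gr\<^sub>-\<^sub>2\<close> of \<open>Vbar\<close> is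
  therefore not isomorphic to the four-dimensional de Rham cohomology.\<close>

lemma genus_2_relation:
  assumes "genus X = 2"
  shows "\<exists>f\<in>Pn X 0 0. \<exists>h\<in>Pn X 0 0.
    chi X (wnk 2 1) + chi X (wnk 2 3) - chi X (wnk 2 2) - chi X (wnk 2 4) = f + delta X h"
proof -
  let ?f = "\<lambda>a. if a \<in> splus X then (if a 0 = 1 \<or> a 0 = 3 then 1 else - 1) else 0 :: complex"
  let ?h = "\<lambda>a. if a \<in> splus X then (if a 0 = 1 \<or> a 0 = 3 then - 1 else 0) else 0 :: complex"
  have t: "r \<in> \<real> \<Longrightarrow> r \<in> tate 0" for r :: complex
    by (auto simp: tate_def Reals_def)
  have f: "?f \<in> Pn X 0 0" and h: "?h \<in> Pn X 0 0"
    by (auto simp: Pn_def PC_def intro!: t)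
  have "chi X (wnk 2 1) + chi X (wnk 2 3) - chi X (wnk 2 2) - chi X (wnk 2 4) = ?f + delta X ?h"
  proof
    fix a :: seqn
    show "(chi X (wnk 2 1) + chi X (wnk 2 3) - chi X (wnk 2 2) - chi X (wnk 2 4)) a
            = (?f + delta X ?h) a"
    proof (cases "a \<in> splus X")
      case False
      then show ?thesis by (simp add: chi_def delta_def)
    next
      case True
      have s: "shift a \<in> splus X" using True by (auto simp: splus_def shift_def)
      have l: "a i = 1 \<or> a i = 2 \<or> a i = 3 \<or> a i = 4" for i
      proof -
        have "a i \<in> {1..4}" using True assms by (simp add: splus_def letters_def)
        then show ?thesis unfolding atLeastAtMost_iff by presburger
      qed
      have "a 1 \<noteq> linv X (a 0)" using True by (auto simp: splus_def)
      then have r: "\<not> (a 0 = 1 \<and> a 1 = 3)" "\<not> (a 0 = 2 \<and> a 1 = 4)"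
          "\<not> (a 0 = 3 \<and> a 1 = 1)" "\<not> (a 0 = 4 \<and> a 1 = 2)"
        using assms by (auto simp: linv_def)
      have c: "chi X (wnk 2 k) a = (if a 0 = k \<and> a 1 = k then 1 else 0)" for k
        using True by (auto simp: chi_def wnk_def indicator_def less_2_cases_iff)
      have d: "delta X ?h a = ?h a - (if a 1 = 1 \<or> a 1 = 3 then - 1 else 0)"
        using True s by (simp add: delta_def shift_def)
      have "(if a 0 = 1 \<and> a 1 = 1 then 1 else 0) + (if a 0 = 3 \<and> a 1 = 3 then 1 else 0)
          - (if a 0 = 2 \<and> a 1 = 2 then 1 else 0) - (if a 0 = 4 \<and> a 1 = 4 then 1 else 0)
        = (if a 0 = 1 \<or> a 0 = 3 then 1 else - 1) + ((if a 0 = 1 \<or> a 0 = 3 then - 1 else 0)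
          - (if a 1 = 1 \<or> a 1 = 3 then - 1 else 0 :: complex))"
        using l[of 0] l[of 1] r by (elim disjE) (simp_all del: One_nat_def)
      then show ?thesis
        using True by (simp only: plus_fun_def minus_apply c d if_True)
    qed
  qed
  with f h show ?thesis by blast
qed


section \<open>De Rham and archimedean cohomology\<close>

text \<open>\<open>C^n\<close> and \<open>C^\<infinity>\<close> functions (in the real sense) on an open subset of the plane.\<close>

primrec cn_on :: "nat \<Rightarrow> complex set \<Rightarrow> (complex \<Rightarrow> complex) \<Rightarrow> bool" where
  "cn_on 0 S f \<longleftrightarrow> continuous_on S f"
| "cn_on (Suc n) S f \<longleftrightarrow> (\<exists>fx fy. cn_on n S fx \<and> cn_on n S fy \<and>
     (\<forall>z\<in>S. (f has_derivative (\<lambda>v. Re v *\<^sub>R fx z + Im v *\<^sub>R fy z)) (at z)))"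

definition cinf_on :: "complex set \<Rightarrow> (complex \<Rightarrow> complex) \<Rightarrow> bool" where
  "cinf_on S f \<longleftrightarrow> (\<forall>n. cn_on n S f)"

definition fdom :: "schottky \<Rightarrow> complex set" where
  "fdom X = {z. Fin z \<in> Omega X}"

text \<open>A complex-valued 1-form \<open>\<eta>\<close> on \<open>X\<close> is a \<open>Gam X\<close>-invariant one on \<open>Omega X\<close>. It is given by its
  values \<open>\<eta> z v\<close> at finite points \<open>z\<close> and tangent vectors \<open>v\<close>, and has to extend smoothly to infinity
  in the coordinate \<open>w = 1 / z\<close> if \<open>Infty \<in> Omega X\<close>. Values outside \<open>fdom X\<close> are irrelevant.\<close>

type_synonym form = "complex \<Rightarrow> complex \<Rightarrow> complex"

definition closed_forms :: "schottky \<Rightarrow> form set" where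
  "closed_forms X = {\<eta>.
     (\<forall>z\<in>fdom X. linear (\<eta> z)) \<and>
     (\<forall>v. cinf_on (fdom X) (\<lambda>z. \<eta> z v)) \<and>
     (Infty \<in> Omega X \<longrightarrow> (\<exists>S a b. open S \<and> 0 \<in> S \<and> cinf_on S a \<and> cinf_on S b \<and>
        (\<forall>w\<in>S - {0}. \<forall>v. \<eta> (1 / w) (- v / w\<^sup>2) = Re v *\<^sub>R a w + Im v *\<^sub>R b w))) \<and>
     (\<forall>A\<in>Gam X. \<forall>z\<in>fdom X. \<forall>z' v. mob A (Fin z) = Fin z' \<longrightarrow>
        \<eta> z' (v / (of_real (A$2$1) * z + of_real (A$2$2))\<^sup>2) = \<eta> z v) \<and>
     (\<forall>z\<in>fdom X. \<forall>u v. frechet_derivative (\<lambda>z. \<eta> z v) (at z) u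
                      = frechet_derivative (\<lambda>z. \<eta> z u) (at z) v)}"

definition exact_forms :: "schottky \<Rightarrow> form set" where
  "exact_forms X = {\<eta>. \<exists>f :: csphere \<Rightarrow> complex.
     cinf_on (fdom X) (\<lambda>z. f (Fin z)) \<and>
     cinf_on {w. inf_chart w \<in> Omega X} (\<lambda>w. f (inf_chart w)) \<and>
     (\<forall>A\<in>Gam X. \<forall>x\<in>Omega X. f (mob A x) = f x) \<and>
     (\<forall>z\<in>fdom X. ((\<lambda>z. f (Fin z)) has_derivative \<eta> z) (at z))}"

text \<open>\<open>H\<^sup>1(X,\<real>(p))\<close> is \<open>(2\<pi>\<i>)^(p-1)\<close> times \<open>H\<^sup>1\<^sub>D\<^sub>R(X,\<real>(1))\<close>, where in the convention adopted here
  the twist in \<open>H\<^sup>1\<^sub>D\<^sub>R(X,\<real>(1))\<close> is absorbed in the normalization of the differentials: its elements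
  are the classes of the real-valued closed forms.\<close>

definition Zforms :: "schottky \<Rightarrow> int \<Rightarrow> form set" where
  "Zforms X p = {\<eta> \<in> closed_forms X. \<forall>z\<in>fdom X. \<forall>v. \<eta> z v \<in> tate (p - 1)}"

definition Bforms :: "schottky \<Rightarrow> int \<Rightarrow> form set" where
  "Bforms X p = Zforms X p \<inter> exact_forms X"

definition H1 :: "schottky \<Rightarrow> int \<Rightarrow> form set rspace" where
  "H1 X p = rquot (rsub (Zforms X p)) (Bforms X p)"

definition H1_class :: "schottky \<Rightarrow> int \<Rightarrow> form \<Rightarrow> form set" where
  "H1_class X p = rcls (rsub (Zforms X p)) (Bforms X p)"

definition fscale :: "complex \<Rightarrow> form \<Rightarrow> form" where
  "fscale c \<eta> = (\<lambda>z v. c * \<eta> z v)"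

definition H_arch :: "schottky \<Rightarrow> (int \<Rightarrow> form set) rspace" where
  "H_arch X = rdsum {..0} (H1 X)"

text \<open>The Tate twist \<open>H\<^sup>1\<^sub>D\<^sub>R(X,\<real>(1)) \<rightarrow> H\<^sup>1(X,\<real>(p))\<close>.\<close>

definition twist_H :: "int \<Rightarrow> form set \<Rightarrow> form set" where
  "twist_H p Y = fscale (twopii powi (p - 1)) ` Y"

definition iota_pullback :: "form \<Rightarrow> form" where
  "iota_pullback \<eta> = (\<lambda>z v. \<eta> (cnj z) (cnj v))"

text \<open>The real Frobenius: the pullback by \<open>\<iota>\<close> composed with the sign of the twist, which in the
  above convention is \<open>(-1)^(p-1)\<close>.\<close>

definition frob_H :: "schottky \<Rightarrow> int \<Rightarrow> form set \<Rightarrow> form set" where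
  "frob_H X p Y = (\<lambda>\<eta>. fscale ((- 1) powi (p - 1)) (iota_pullback \<eta>)) ` Y"

definition coset_reps :: "schottky \<Rightarrow> bool" where
  "coset_reps X \<longleftrightarrow> (\<forall>k\<in>{1..genus X}. reps X k \<subseteq> Gam X \<and>
     (\<forall>A\<in>Gam X. \<exists>!B. B \<in> reps X k \<and>
        (\<exists>n. A = B ** word_mat X (replicate n k) \<or>
             A = B ** word_mat X (replicate n (linv X k)))))"

definition dlog :: "(complex \<Rightarrow> complex) \<Rightarrow> complex \<Rightarrow> complex" where
  "dlog f z = deriv f z / f z"

definition omega :: "schottky \<Rightarrow> nat \<Rightarrow> form" where
  "omega X k = (\<lambda>z v. (\<Sum>\<^sub>\<infinity>h\<in>reps X k.
     dlog (\<lambda>z. cross_ratio (mob h (zplus (gen X k))) (mob h (zminus (gen X k))) (Fin z) (basept X)) z)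
     * v)"

definition phi :: "schottky \<Rightarrow> nat \<Rightarrow> form" where
  "phi X k = (if k \<le> genus X
     then (\<lambda>z v. (omega X k z v + cnj (omega X k z v)) / 2)
     else (\<lambda>z v. - \<i> * (omega X (k - genus X) z v - cnj (omega X (k - genus X) z v)) / 2))"

end

(* The conformality of the Patterson-Sullivan measure and the equivariance of the coding map give
   every cylinder positive mass. The projections are therefore conditional expectations with
   respect to the finite partitions into cylinders, and Pi_hat n of the characteristic function of
   the cylinder of k^(n+1) equals that function minus c times the characteristic function of the
   cylinder of k^n, with c < 1. Its value at the constant sequence j, j, ... is nonzero exactly
   for j = k, so these vectors are independent and U maps a basis to a basis.

   In Gr_N a combination of the classes vanishes iff it has the form u - v o T with u and v
   depending on a_0, ..., a_(N-1). For fixed a_1, ..., a_(N-1) this is a function of a_0 plus a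
   function of a_N, so its alternating sum over the words k m k, k m j, i m k, i m j with
   m = k^(N-1) vanishes, while only the first word sees the coefficient of k. For N = 1 the four words
   must be reduced with i different from j, which requires a third generator.

   For the Frobenius, the endpoints of the axes are real since the group is, so omega_k is
   conjugated by the involution and its real and imaginary parts are eigenvectors. *)
theory Submission
  imports Defs
begin

section \<open>Presentations of real vector spaces\<close>

text \<open>Half differences and half sums appear because reversal of geodesics exchanges the words
  of k and of its inverse: they are its eigenvectors for -1 and 1, and with the sign (-1)^p they
  match the eigenvalues (-1)^(p-1) and (-1)^p on the real and imaginary parts of the differentials.
  Passing to them is an invertible change of the spanning family, so only the independence of the
  original generators is at stake. Different degrees do not interfere in V, since the pieces lie in
  eigenspaces of D for different eigenvalues. Two points are less visible. \<open>reversal_V\<close>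
  is chosen by \<open>SOME\<close>, so it has its properties only once a linear map with the
  prescribed values is constructed; for this the generators of all degrees together have to be
  independent. On \<open>Gr\<close> the Frobenius acts elementwise on sets of sets of functions, and
  reversal at level n preserves the functions of fewer letters only up to coboundaries; it has to be
  shown that whole classes go to whole classes nevertheless.\<close>

text \<open>All spaces with an explicit carrier that occur are images \<open>\<pi> ` V\<close> of a subspace of a genuine
  real vector space; linear algebra in them is done in \<open>V\<close>.\<close>

locale presentation =
  fixes A :: "'a rspace" and V :: "'b::real_vector set" and \<pi> :: "'b \<Rightarrow> 'a"
  assumes subspace: "subspace V"
    and carr: "carr A = \<pi> ` V"
    and radd: "x \<in> V \<Longrightarrow> y \<in> V \<Longrightarrow> radd A (\<pi> x) (\<pi> y) = \<pi> (x + y)"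
    and rscl: "x \<in> V \<Longrightarrow> rscl A r (\<pi> x) = \<pi> (r *\<^sub>R x)"
    and rzero: "rzero A = \<pi> 0"
begin

lemma radd_closed: "x \<in> carr A \<Longrightarrow> y \<in> carr A \<Longrightarrow> radd A x y \<in> carr A"
  using subspace by (auto simp: carr radd intro: subspace_add)

lemma rscl_closed: "x \<in> carr A \<Longrightarrow> rscl A r x \<in> carr A"
  using subspace by (auto simp: carr rscl intro: subspace_scale)

lemma rzero_closed: "rzero A \<in> carr A"
  using subspace by (auto simp: carr rzero intro: subspace_0)

lemma radd_rzero: "radd A (rzero A) (rzero A) = rzero A"
  using radd[of 0 0] subspace by (simp add: rzero subspace_0)

lemma rscl_rzero: "rscl A r (rzero A) = rzero A"
  using rscl[of 0 r] subspace by (simp add: rzero subspace_0)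

lemma rspan_image:
  assumes "S \<subseteq> V"
  shows "rspan A (\<pi> ` S) = \<pi> ` span S"
proof
  have sV: "span S \<subseteq> V" using assms subspace by (rule span_minimal)
  show "rspan A (\<pi> ` S) \<subseteq> \<pi> ` span S"
    unfolding rspan_def
  proof (rule Inter_lower, simp only: mem_Collect_eq, intro conjI ballI allI)
    show "\<pi> ` span S \<subseteq> carr A" using sV by (auto simp: carr)
    show "\<pi> ` S \<subseteq> \<pi> ` span S" by (auto intro: span_base)
    show "rzero A \<in> \<pi> ` span S" by (auto simp: rzero intro: span_zero)
    show "radd A x y \<in> \<pi> ` span S" if "x \<in> \<pi> ` span S" "y \<in> \<pi> ` span S" for x y
      using that sV by (auto simp: radd subset_iff intro: span_add)
    show "rscl A r x \<in> \<pi> ` span S" if "x \<in> \<pi> ` span S" for r x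
      using that sV by (auto simp: rscl subset_iff intro: span_scale)
  qed
  show "\<pi> ` span S \<subseteq> rspan A (\<pi> ` S)"
    unfolding rspan_def
  proof (intro Inter_greatest image_subsetI)
    fix W x
    assume W: "W \<in> {W. W \<subseteq> carr A \<and> \<pi> ` S \<subseteq> W \<and> rzero A \<in> W \<and>
        (\<forall>x\<in>W. \<forall>y\<in>W. radd A x y \<in> W) \<and> (\<forall>r. \<forall>x\<in>W. rscl A r x \<in> W)}"
      and x: "x \<in> span S"
    \<comment> \<open>Membership in \<open>V\<close> is carried through the induction, since
      \<open>radd\<close> and \<open>rscl\<close> are related to the operations of \<open>V\<close>
      only there.\<close>
    have "x \<in> V \<and> \<pi> x \<in> W"
      using x
    proof (induction rule: span_induct_alt)
      case base
      then show ?case using W subspace by (auto simp: rzero subspace_0)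
    next
      case (step c y z)
      have y: "y \<in> V" "\<pi> y \<in> W" using step W assms by auto
      have "\<pi> (c *\<^sub>R y + z) = radd A (rscl A c (\<pi> y)) (\<pi> z)"
        using y step subspace by (simp add: radd rscl subspace_scale)
      then show ?case using y step W subspace by (auto intro: subspace_add subspace_scale)
    qed
    then show "\<pi> x \<in> W" ..
  qed
qed

lemma presentation_rspan:
  assumes "S \<subseteq> V"
  shows "presentation (A\<lparr>carr := rspan A (\<pi> ` S)\<rparr>) (span S) \<pi>"
proof -
  have sV: "span S \<subseteq> V" using assms subspace by (rule span_minimal)
  show ?thesis
    by unfold_locales
      (use sV in \<open>auto simp: rspan_image[OF assms] rzero radd rscl subset_iff\<close>)
qed

section \<open>Cosets and quotients of a presented space\<close>

lemma rcls_image: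
  assumes "W \<subseteq> V" "x \<in> V"
  shows "rcls A (\<pi> ` W) (\<pi> x) = (\<lambda>w. \<pi> (x + w)) ` W"
proof -
  have "rcls A (\<pi> ` W) (\<pi> x) = (\<lambda>w. radd A (\<pi> x) (\<pi> w)) ` W" by (auto simp: rcls_def)
  also have "\<dots> = (\<lambda>w. \<pi> (x + w)) ` W"
    using assms by (intro image_cong refl) (auto simp: radd)
  finally show ?thesis .
qed

text \<open>The right side compares images under \<open>\<pi>\<close> and not the vectors
  themselves, because \<open>\<pi>\<close> may have a kernel that \<open>W\<close> does not contain.
  This happens for \<open>Gr\<close>, where \<open>\<pi>\<close> is already a class map.\<close>

lemma rcls_eq_iff:
  assumes "subspace W" "W \<subseteq> V" "x \<in> V" "y \<in> V"
  shows "rcls A (\<pi> ` W) (\<pi> x) = rcls A (\<pi> ` W) (\<pi> y) \<longleftrightarrow> (\<exists>w\<in>W. \<pi> x = \<pi> (y + w))"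
proof
  assume "rcls A (\<pi> ` W) (\<pi> x) = rcls A (\<pi> ` W) (\<pi> y)"
  moreover have "\<pi> (x + 0) \<in> rcls A (\<pi> ` W) (\<pi> x)"
    using assms unfolding rcls_image[OF assms(2,3)] by (metis imageI subspace_0)
  ultimately show "\<exists>w\<in>W. \<pi> x = \<pi> (y + w)"
    using assms by (auto simp: rcls_image)
next
  assume "\<exists>w\<in>W. \<pi> x = \<pi> (y + w)"
  then obtain w where w: "w \<in> W" "\<pi> x = \<pi> (y + w)" by blast
  have xv: "\<pi> (x + v) = \<pi> (y + (w + v))" if "v \<in> W" for v
  proof -
    have "\<pi> (x + v) = radd A (\<pi> x) (\<pi> v)" using that assms by (simp add: radd subset_iff)
    also have "\<dots> = \<pi> (y + w + v)" using that assms w subspace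
      by (auto simp: radd subset_iff subspace_add)
    finally show ?thesis by (simp add: add.assoc)
  qed
  show "rcls A (\<pi> ` W) (\<pi> x) = rcls A (\<pi> ` W) (\<pi> y)"
    unfolding rcls_image[OF assms(2,3)] rcls_image[OF assms(2,4)]
  proof safe
    fix v assume v: "v \<in> W"
    then show "\<pi> (x + v) \<in> (\<lambda>w. \<pi> (y + w)) ` W"
      using w assms xv[OF v] by (auto intro!: image_eqI[where x = "w + v"] subspace_add)
    have "v - w \<in> W" using v w assms by (simp add: subspace_diff)
    from xv[OF this] show "\<pi> (y + v) \<in> (\<lambda>w. \<pi> (x + w)) ` W"
      using \<open>v - w \<in> W\<close> by (intro image_eqI[where x = "v - w"]) simp_all
  qed
qed

text \<open>Only the map changes, the representing space \<open>V\<close> stays the same. Applied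
  twice, this presents \<open>Gr X n p\<close>, a quotient of a quotient, directly by functions in
  \<open>Pn X n p\<close>.\<close>

lemma presentation_rquot:
  assumes "subspace W" "W \<subseteq> V"
  shows "presentation (rquot A (\<pi> ` W)) V (\<lambda>x. rcls A (\<pi> ` W) (\<pi> x))"
proof
  show "subspace V" by (rule subspace)
  show "carr (rquot A (\<pi> ` W)) = (\<lambda>x. rcls A (\<pi> ` W) (\<pi> x)) ` V"
    by (simp add: rquot_def carr image_image)
  show "rzero (rquot A (\<pi> ` W)) = rcls A (\<pi> ` W) (\<pi> 0)"
    by (simp add: rquot_def rzero)
  have sub: "w \<in> V" if "w \<in> W" for w using that assms by blast
  show "radd (rquot A (\<pi> ` W)) (rcls A (\<pi> ` W) (\<pi> x)) (rcls A (\<pi> ` W) (\<pi> y)) =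
        rcls A (\<pi> ` W) (\<pi> (x + y))" if xy: "x \<in> V" "y \<in> V" for x y
  proof -
    have xyV: "x + y \<in> V" using xy subspace by (simp add: subspace_add)
    have eq: "radd A (\<pi> (x + v)) (\<pi> (y + w)) = \<pi> (x + y + (v + w))" if "v \<in> W" "w \<in> W" for v w
      using that xy sub subspace by (simp add: radd subspace_add algebra_simps)
    show ?thesis
      unfolding rquot_def rspace.simps rcls_image[OF assms(2) xy(1)] rcls_image[OF assms(2) xy(2)]
        rcls_image[OF assms(2) xyV]
    proof safe
      fix v w assume "v \<in> W" "w \<in> W"
      then show "radd A (\<pi> (x + v)) (\<pi> (y + w)) \<in> (\<lambda>w. \<pi> (x + y + w)) ` W"
        using assms by (auto simp: eq intro!: imageI subspace_add)
    next
      fix w assume w: "w \<in> W"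
      show "\<exists>y' z'. \<pi> (x + y + w) = radd A y' z' \<and> y' \<in> (\<lambda>w. \<pi> (x + w)) ` W
              \<and> z' \<in> (\<lambda>w. \<pi> (y + w)) ` W"
        using eq[of 0 w] w assms(1) by (metis (no_types, lifting) add_0 imageI subspace_0)
    qed
  qed
  show "rscl (rquot A (\<pi> ` W)) r (rcls A (\<pi> ` W) (\<pi> x)) = rcls A (\<pi> ` W) (\<pi> (r *\<^sub>R x))"
    if x: "x \<in> V" for r x
  proof -
    have rx: "r *\<^sub>R x \<in> V" using x subspace by (simp add: subspace_scale)
    have eq: "radd A (rscl A r (\<pi> (x + v))) (\<pi> w) = \<pi> (r *\<^sub>R x + (r *\<^sub>R v + w))"
      if "v \<in> W" "w \<in> W" for v w
      using that x sub subspace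
      by (simp add: radd rscl subspace_add subspace_scale algebra_simps)
    show ?thesis
      unfolding rquot_def rspace.simps rcls_image[OF assms(2) x] rcls_image[OF assms(2) rx]
    proof safe
      fix v w assume "v \<in> W" "w \<in> W"
      then show "radd A (rscl A r (\<pi> (x + v))) (\<pi> w) \<in> (\<lambda>w. \<pi> (r *\<^sub>R x + w)) ` W"
        using assms by (auto simp: eq intro!: imageI subspace_add subspace_scale)
    next
      fix w assume w: "w \<in> W"
      have "\<pi> (r *\<^sub>R x + w) = radd A (rscl A r (\<pi> (x + 0))) (\<pi> w)"
        using eq[of 0 w] w assms(1) by (simp add: subspace_0)
      then show "\<exists>y' w'. \<pi> (r *\<^sub>R x + w) = radd A (rscl A r y') w' \<and> y' \<in> (\<lambda>w. \<pi> (x + w)) ` W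
              \<and> w' \<in> \<pi> ` W"
        using w assms(1) subspace_0 by blast
    qed
  qed
qed

end

lemma presentation_rsub: "subspace V \<Longrightarrow> presentation (rsub V) V (\<lambda>x. x)"
  by unfold_locales (auto simp: rsub_def)

section \<open>Linear maps given on a spanning family\<close>

lemma rlinear_sum:
  assumes A: "presentation A V \<pi>" and B: "presentation B W \<sigma>" and f: "rlinear A B f"
    and vw: "\<And>i. i \<in> I \<Longrightarrow> v i \<in> V" "\<And>i. i \<in> I \<Longrightarrow> w i \<in> W"
      "\<And>i. i \<in> I \<Longrightarrow> f (\<pi> (v i)) = \<sigma> (w i)"
    and I: "finite I"
  shows "f (\<pi> (\<Sum>i\<in>I. c i *\<^sub>R v i)) = \<sigma> (\<Sum>i\<in>I. c i *\<^sub>R w i)"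
proof -
  interpret A: presentation A V \<pi> by fact
  interpret B: presentation B W \<sigma> by fact
  have add: "f (\<pi> (x + y)) = radd B (f (\<pi> x)) (f (\<pi> y))" if "x \<in> V" "y \<in> V" for x y
    using f that unfolding rlinear_def A.carr by (metis A.radd imageI)
  have scl: "f (\<pi> (r *\<^sub>R x)) = rscl B r (f (\<pi> x))" if "x \<in> V" for x r
    using f that unfolding rlinear_def A.carr by (metis A.rscl imageI)
  \<comment> \<open>\<open>rlinear\<close> says nothing about zero; scaling by 0 forces it, once the
    value is known to be some \<open>\<sigma> y\<close>.\<close>
  have zero: "f (\<pi> 0) = \<sigma> 0"
  proof -
    have "f (\<pi> 0) \<in> \<sigma> ` W"
      using f A.rzero_closed unfolding rlinear_def A.rzero B.carr by blast
    then obtain y where y: "y \<in> W" "f (\<pi> 0) = \<sigma> y" by blast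
    show ?thesis
      using scl[of 0 0] A.subspace B.rscl[OF y(1), of 0] y(2) by (simp add: subspace_0)
  qed
  from I vw show ?thesis
  proof (induction I)
    case empty
    then show ?case by (simp add: zero)
  next
    case (insert i I)
    have V: "(\<Sum>i\<in>I. c i *\<^sub>R v i) \<in> V" "c i *\<^sub>R v i \<in> V"
      using insert A.subspace by (auto intro!: subspace_sum subspace_scale)
    have W: "(\<Sum>i\<in>I. c i *\<^sub>R w i) \<in> W" "c i *\<^sub>R w i \<in> W"
      using insert B.subspace by (auto intro!: subspace_sum subspace_scale)
    show ?case
      using insert V W by (simp add: add scl B.radd B.rscl)
  qed
qed

lemma rlinear_zero:
  assumes "presentation A V \<pi>" "presentation B W \<sigma>" "rlinear A B f"
  shows "f (rzero A) = rzero B"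
  using rlinear_sum[OF assms, of "{}"] assms
  by (simp add: presentation.rzero)

lemma span_image_sum:
  assumes "finite I" "x \<in> span (v ` I)"
  shows "\<exists>c. x = (\<Sum>i\<in>I. c i *\<^sub>R v i)"
  using assms(2)
proof (induction rule: span_induct_alt)
  case base
  show ?case by (rule exI[of _ "\<lambda>_. 0"]) simp
next
  case (step r y z)
  then obtain c j where *: "z = (\<Sum>i\<in>I. c i *\<^sub>R v i)" "j \<in> I" "y = v j" by blast
  have "r *\<^sub>R y + z = (\<Sum>i\<in>I. (c i + (if i = j then r else 0)) *\<^sub>R v i)"
    using * assms(1)
    by (simp add: scaleR_add_left sum.distrib if_distrib[of "\<lambda>x. x *\<^sub>R _"] cong: if_cong)
  then show ?case by (rule exI[of _ "\<lambda>i. c i + (if i = j then r else 0)"])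
qed

text \<open>Kept apart from injectivity: for \<open>Ubar\<close> in genus 2 and degree
  \<open>p = - 1\<close> the images of the basis are dependent, and surjectivity is what
  survives.\<close>

lemma rlinear_image:
  assumes A: "presentation A V \<pi>" and B: "presentation B W \<sigma>" and f: "rlinear A B f"
    and vw: "\<And>i. i \<in> I \<Longrightarrow> v i \<in> V" "\<And>i. i \<in> I \<Longrightarrow> w i \<in> W"
      "\<And>i. i \<in> I \<Longrightarrow> f (\<pi> (v i)) = \<sigma> (w i)"
    and I: "finite I"
    and span: "carr A = \<pi> ` span (v ` I)" "carr B = \<sigma> ` span (w ` I)"
  shows "f ` carr A = carr B"
proof
  show "f ` carr A \<subseteq> carr B" using f by (simp add: rlinear_def)
  show "carr B \<subseteq> f ` carr A"
  proof
    fix y assume "y \<in> carr B"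
    then obtain c where "y = \<sigma> (\<Sum>i\<in>I. c i *\<^sub>R w i)"
      using span(2) span_image_sum[OF I] by blast
    also have "\<dots> = f (\<pi> (\<Sum>i\<in>I. c i *\<^sub>R v i))"
      by (rule rlinear_sum[OF A B f vw I, symmetric])
    finally show "y \<in> f ` carr A"
      unfolding span(1) by (rule image_eqI[OF _ imageI]) (auto intro!: span_sum intro: span_scale span_base)
  qed
qed

text \<open>As the images of the spanning vectors are independent, the value under \<open>f\<close>
  determines the coefficients of an element of \<open>carr A\<close>. Independence is expressed
  through \<open>\<sigma>\<close>, so that it can mean independence of classes in a
  quotient.\<close>

lemma riso_basis:
  assumes A: "presentation A V \<pi>" and B: "presentation B W \<sigma>" and f: "rlinear A B f"
    and vw: "\<And>i. i \<in> I \<Longrightarrow> v i \<in> V" "\<And>i. i \<in> I \<Longrightarrow> w i \<in> W"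
      "\<And>i. i \<in> I \<Longrightarrow> f (\<pi> (v i)) = \<sigma> (w i)"
    and I: "finite I"
    and span: "carr A = \<pi> ` span (v ` I)" "carr B = \<sigma> ` span (w ` I)"
    and indep: "\<And>c i. \<sigma> (\<Sum>i\<in>I. c i *\<^sub>R w i) = \<sigma> 0 \<Longrightarrow> i \<in> I \<Longrightarrow> c i = 0"
  shows "riso A B f"
proof -
  interpret A: presentation A V \<pi> by fact
  interpret B: presentation B W \<sigma> by fact
  have sum: "f (\<pi> (\<Sum>i\<in>I. c i *\<^sub>R v i)) = \<sigma> (\<Sum>i\<in>I. c i *\<^sub>R w i)" for c
    by (rule rlinear_sum[OF A B f vw I])
  have "inj_on f (carr A)"
  proof
    fix x y assume "x \<in> carr A" "y \<in> carr A" and eq: "f x = f y"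
    then obtain x' y' where "x = \<pi> x'" "x' \<in> span (v ` I)" "y = \<pi> y'" "y' \<in> span (v ` I)"
      using span(1) by auto
    moreover from this(2) obtain c where "x' = (\<Sum>i\<in>I. c i *\<^sub>R v i)"
      using span_image_sum[OF I, of x' v] by auto
    moreover from \<open>y' \<in> _\<close> obtain d where "y' = (\<Sum>i\<in>I. d i *\<^sub>R v i)"
      using span_image_sum[OF I, of y' v] by auto
    ultimately have c: "x = \<pi> (\<Sum>i\<in>I. c i *\<^sub>R v i)" and d: "y = \<pi> (\<Sum>i\<in>I. d i *\<^sub>R v i)"
      by simp_all
    have W: "(\<Sum>i\<in>I. c i *\<^sub>R w i) \<in> W" "(\<Sum>i\<in>I. d i *\<^sub>R w i) \<in> W" for c d
      using vw B.subspace by (auto intro!: subspace_sum subspace_scale)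
    have "\<sigma> (\<Sum>i\<in>I. c i *\<^sub>R w i) = \<sigma> (\<Sum>i\<in>I. d i *\<^sub>R w i)"
      using eq unfolding c d sum .
    \<comment> \<open>A space with explicit carrier has no subtraction; the difference is formed
      with \<open>radd\<close> and \<open>rscl\<close> by \<open>- 1\<close>.\<close>
    then have "radd B (\<sigma> (\<Sum>i\<in>I. c i *\<^sub>R w i)) (rscl B (- 1) (\<sigma> (\<Sum>i\<in>I. d i *\<^sub>R w i)))
        = radd B (\<sigma> (\<Sum>i\<in>I. d i *\<^sub>R w i)) (rscl B (- 1) (\<sigma> (\<Sum>i\<in>I. d i *\<^sub>R w i)))"
      by simp
    then have "\<sigma> ((\<Sum>i\<in>I. c i *\<^sub>R w i) - (\<Sum>i\<in>I. d i *\<^sub>R w i)) = \<sigma> 0"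
      using W B.subspace by (simp add: B.radd B.rscl subspace_neg)
    then have "\<sigma> (\<Sum>i\<in>I. (c i - d i) *\<^sub>R w i) = \<sigma> 0"
      by (simp add: sum_subtractf scaleR_diff_left)
    then have "c i = d i" if "i \<in> I" for i using indep[OF _ that] by fastforce
    then show "x = y" unfolding c d by simp
  qed
  then show ?thesis
    using f rlinear_image[OF A B f vw I span] by (auto simp: riso_def bij_betw_def)
qed

text \<open>\<open>twist_H\<close>, \<open>frob_H\<close> and \<open>frob_Hdyn\<close> apply a map
  to all elements of a coset of functions or forms. The image is a full coset again because
  \<open>F\<close> maps \<open>W\<close> onto \<open>W'\<close>; an inclusion would not
  suffice.\<close>

lemma image_rcls_rsub:
  assumes "\<And>w. w \<in> W \<Longrightarrow> F (x + w) = F x + F w" "F ` W = W'"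
  shows "F ` rcls (rsub V) W x = rcls (rsub V') W' (F x)"
proof -
  have "F ` rcls (rsub V) W x = (\<lambda>w. F (x + w)) ` W" by (auto simp: rcls_def rsub_def)
  also have "\<dots> = (\<lambda>w. F x + F w) ` W" using assms by (intro image_cong refl) auto
  also have "\<dots> = rcls (rsub V') (F ` W) (F x)" by (auto simp: rcls_def rsub_def)
  finally show ?thesis using assms by simp
qed

subsection \<open>Direct sums\<close>

text \<open>The condition on zeros keeps the image in the direct sum: the support of
  \<open>graded_map f x\<close> is contained in that of \<open>x\<close>.\<close>

lemma graded_map_rlinear:
  assumes "\<And>p. p \<le> 0 \<Longrightarrow> rlinear (A p) (B p) (f p)" "\<And>p. p \<le> 0 \<Longrightarrow> f p (rzero (A p)) = rzero (B p)"
  shows "rlinear (rdsum {..0} A) (rdsum {..0} B) (graded_map f)"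
proof -
  have "finite {p \<in> {..0}. graded_map f x p \<noteq> rzero (B p)}"
    if "finite {p \<in> {..0}. x p \<noteq> rzero (A p)}" for x
    by (rule finite_subset[OF _ that]) (auto simp: graded_map_def assms)
  then show ?thesis
    using assms(1) unfolding rlinear_def rdsum_def
    by (auto simp: graded_map_def PiE_iff fun_eq_iff image_subset_iff)
qed

lemma graded_map_riso:
  assumes f: "\<And>p. p \<le> 0 \<Longrightarrow> riso (A p) (B p) (f p)"
    and 0: "\<And>p. p \<le> 0 \<Longrightarrow> f p (rzero (A p)) = rzero (B p)" "\<And>p. p \<le> 0 \<Longrightarrow> rzero (A p) \<in> carr (A p)"
  shows "riso (rdsum {..0} A) (rdsum {..0} B) (graded_map f)"
proof -
  have lin: "rlinear (rdsum {..0} A) (rdsum {..0} B) (graded_map f)"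
    using f 0(1) by (intro graded_map_rlinear) (auto simp: riso_def)
  have inj: "inj_on (f p) (carr (A p))" if "p \<le> 0" for p
    using f[OF that] by (auto simp: riso_def bij_betw_def)
  have "inj_on (graded_map f) (carr (rdsum {..0} A))"
  proof
    fix x y assume x: "x \<in> carr (rdsum {..0} A)" and y: "y \<in> carr (rdsum {..0} A)"
      and eq: "graded_map f x = graded_map f y"
    show "x = y"
    proof
      fix p
      show "x p = y p"
      proof (cases "p \<le> 0")
        case True
        then have "f p (x p) = f p (y p)" using fun_cong[OF eq, of p] by (simp add: graded_map_def)
        with inj[OF True] x y True show ?thesis
          by (auto simp: rdsum_def PiE_iff inj_on_def)
      next
        case False
        with x y show ?thesis by (auto simp: rdsum_def PiE_iff extensional_def)
      qed
    qed
  qed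
  moreover have "y \<in> graded_map f ` carr (rdsum {..0} A)" if y: "y \<in> carr (rdsum {..0} B)" for y
  proof -
    define x where "x = (\<lambda>p\<in>{..0}. inv_into (carr (A p)) (f p) (y p))"
    have yp: "y p \<in> f p ` carr (A p)" if "p \<le> 0" for p
      using y f[OF that] that by (auto simp: rdsum_def PiE_iff riso_def bij_betw_def)
    \<comment> \<open>By injectivity the chosen preimage of zero is zero, so the preimage inherits
      the finite support of \<open>y\<close>.\<close>
    have "x p = rzero (A p)" if "p \<le> 0" "y p = rzero (B p)" for p
      using that inj[of p] 0[of p] by (metis (no_types, lifting) x_def atMost_iff inv_into_f_f restrict_apply')
    then have "{p \<in> {..0}. x p \<noteq> rzero (A p)} \<subseteq> {p \<in> {..0}. y p \<noteq> rzero (B p)}" by auto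
    moreover have "finite {p \<in> {..0}. y p \<noteq> rzero (B p)}" using y by (simp add: rdsum_def)
    ultimately have "finite {p \<in> {..0}. x p \<noteq> rzero (A p)}" by (rule finite_subset)
    moreover have "x p \<in> carr (A p)" if "p \<le> 0" for p
      using yp[OF that] that by (simp add: x_def inv_into_into)
    ultimately have "x \<in> carr (rdsum {..0} A)" by (auto simp: rdsum_def x_def)
    moreover have "graded_map f x = y"
      using y yp by (auto simp: graded_map_def x_def fun_eq_iff f_inv_into_f rdsum_def PiE_iff
          extensional_def)
    ultimately show ?thesis by blast
  qed
  ultimately show ?thesis
    using lin unfolding riso_def bij_betw_def rlinear_def by blast
qed

section \<open>Moebius transformations of the sphere\<close>

definition sqn :: "complex \<times> complex \<Rightarrow> real" where
  "sqn h = (cmod (fst h))\<^sup>2 + (cmod (snd h))\<^sup>2"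

text \<open>The linear action on homogeneous coordinates, of which \<open>mob A\<close> is the
  projective form (\<open>act_hom\<close>). Working there avoids a separate treatment of
  \<open>Infty\<close> and of the pole.\<close>

definition act :: "mat2 \<Rightarrow> complex \<times> complex \<Rightarrow> complex \<times> complex" where
  "act A h = (of_real (A$1$1) * fst h + of_real (A$1$2) * snd h,
              of_real (A$2$1) * fst h + of_real (A$2$2) * snd h)"

definition smult2 :: "complex \<Rightarrow> complex \<times> complex \<Rightarrow> complex \<times> complex" where
  "smult2 c h = (c * fst h, c * snd h)"

definition sconj :: "csphere \<Rightarrow> csphere" where
  "sconj x = (case x of Fin z \<Rightarrow> Fin (cnj z) | Infty \<Rightarrow> Infty)"

lemma sconj_simps [simp]: "sconj (Fin z) = Fin (cnj z)" "sconj Infty = Infty"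
  by (simp_all add: sconj_def)

lemma sconj_sconj [simp]: "sconj (sconj x) = x"
  by (cases x) simp_all

lemma hdet_sconj: "hdet (sconj x) (sconj y) = cnj (hdet x y)"
  by (cases x; cases y) (simp_all add: hdet_def)

lemma mob_sconj: "mob A (sconj x) = sconj (mob A x)"
proof (cases x)
  case (Fin z)
  have "of_real (A$2$1) * cnj z + of_real (A$2$2) = cnj (of_real (A$2$1) * z + of_real (A$2$2))"
    by simp
  then show ?thesis unfolding Fin sconj_simps mob.simps
    by (simp only: complex_cnj_zero_iff) simp
qed simp

lemma conf_factor_eq: "conf_factor A x = sqn (hom x) / sqn (act A (hom x))"
  by (simp add: conf_factor_def sqn_def act_def split: prod.split)

lemma conf_factor_sconj: "conf_factor A (sconj x) = conf_factor A x"
proof -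
  have "cmod (of_real p * cnj z + of_real q) = cmod (of_real p * z + of_real q)" for p q z
    using complex_mod_cnj[of "of_real p * z + of_real q"] by simp
  then show ?thesis by (cases x) (simp_all add: conf_factor_def)
qed

section \<open>Homogeneous coordinates and the chordal metric\<close>

lemma sqn_hom_pos: "sqn (hom x) > 0"
  by (cases x) (simp_all add: sqn_def add_nonneg_pos)

lemma sqn_smult2: "sqn (smult2 c h) = (cmod c)\<^sup>2 * sqn h"
  by (simp add: sqn_def smult2_def norm_mult power_mult_distrib algebra_simps)

lemma hdet_eq_0_iff: "hdet x y = 0 \<longleftrightarrow> x = y"
  by (cases x; cases y) (simp_all add: hdet_def)

lemma hom_proportional: "hom x = smult2 c (hom y) \<Longrightarrow> x = y"
  by (cases x; cases y) (auto simp: smult2_def)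

lemma act_smult2: "act A (smult2 c h) = smult2 c (act A h)"
  by (simp add: act_def smult2_def algebra_simps)

lemma smult2_smult2: "smult2 c (smult2 d h) = smult2 (c * d) h"
  by (simp add: smult2_def algebra_simps)

lemma act_mult: "act (A ** B) h = act A (act B h)"
  by (simp add: act_def matrix_matrix_mult_def sum_2 algebra_simps)

text \<open>With this expression the behaviour of the chordal distance under a matrix reduces to two
  facts: \<open>hdet\<close> is invariant for determinant 1, and \<open>sqn\<close> changes by the
  factor recorded in \<open>conf_factor\<close>.\<close>

lemma dist_csphere_hdet:
  "(dist x y)\<^sup>2 = 4 * (cmod (hdet x y))\<^sup>2 / (sqn (hom x) * sqn (hom y))"
proof -
  have Fin: "(dist (Fin z) (Fin w))\<^sup>2 = 4 * (cmod (z - w))\<^sup>2 / ((1 + (cmod z)\<^sup>2) * (1 + (cmod w)\<^sup>2))"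
    for z w
  proof -
    define P Q where "P = 1 + (cmod z)\<^sup>2" and "Q = 1 + (cmod w)\<^sup>2"
    have pos: "P > 0" "Q > 0" by (auto simp: P_def Q_def add_pos_nonneg)
    have z: "(cmod z)\<^sup>2 = P - 1" and w: "(cmod w)\<^sup>2 = Q - 1" by (simp_all add: P_def Q_def)
    have "(dist (Fin z) (Fin w))\<^sup>2 = (norm ((2/P) *\<^sub>R z - (2/Q) *\<^sub>R w))\<^sup>2 + (2/P - 2/Q)\<^sup>2"
      by (simp add: dist_csphere_def dist_norm norm_Pair P_def[symmetric] Q_def[symmetric]
          power2_commute[of "2 / Q"])
    also have "(norm ((2/P) *\<^sub>R z - (2/Q) *\<^sub>R w))\<^sup>2
        = (2/P)\<^sup>2 * (cmod z)\<^sup>2 + (2/Q)\<^sup>2 * (cmod w)\<^sup>2 - 2 * (2/P) * (2/Q) * inner z w"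
      by (simp only: power2_norm_eq_inner)
        (simp add: inner_diff_left inner_diff_right inner_commute power2_eq_square field_simps)
    also have "\<dots> + (2/P - 2/Q)\<^sup>2 = 4 * ((P - 1) + (Q - 1) - 2 * inner z w) / (P * Q)"
      using pos unfolding z w by (simp add: field_simps power2_eq_square)
    also have "(P - 1) + (Q - 1) - 2 * inner z w = (cmod (z - w))\<^sup>2"
      unfolding z[symmetric] w[symmetric]
      by (simp only: power2_norm_eq_inner)
        (simp add: inner_diff_left inner_diff_right inner_commute)
    finally show ?thesis unfolding P_def Q_def .
  qed
  have Inf: "(dist (Fin z) Infty)\<^sup>2 = 4 / (1 + (cmod z)\<^sup>2)" for z
  proof -
    define P where "P = 1 + (cmod z)\<^sup>2"
    have pos: "P > 0" by (auto simp: P_def add_pos_nonneg)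
    have z: "(cmod z)\<^sup>2 = P - 1" by (simp add: P_def)
    have "(dist (Fin z) Infty)\<^sup>2 = (2/P)\<^sup>2 * (cmod z)\<^sup>2 + (2/P)\<^sup>2"
      by (simp add: dist_csphere_def dist_norm norm_Pair P_def[symmetric] power_mult_distrib
          power_divide)
    also have "\<dots> = 4 / P"
      using pos unfolding z by (simp add: field_simps power2_eq_square)
    finally show ?thesis unfolding P_def .
  qed
  show ?thesis
    by (cases x; cases y)
      (simp_all add: Fin Inf dist_commute[of Infty] hdet_def sqn_def add.commute)
qed

lemma dist_sconj: "dist (sconj x) (sconj y) = dist x y"
proof -
  have "sqn (hom (sconj x)) = sqn (hom x)" for x by (cases x) (simp_all add: sqn_def)
  then have "(dist (sconj x) (sconj y))\<^sup>2 = (dist x y)\<^sup>2"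
    unfolding dist_csphere_hdet by (simp add: hdet_sconj)
  then show ?thesis by (simp add: power2_eq_iff_nonneg)
qed

text \<open>A crude bound for |A v|^2 / |v|^2, the factor 2 coming from (x + y)^2 \<le> 2 (x^2 +
  y^2). The summand 1 makes it at least 1. The inverse of a matrix of determinant 1 has the same
  entries up to sign and order, hence the same bound.\<close>

definition mat_bound :: "mat2 \<Rightarrow> real" where
  "mat_bound A = 2 * ((A$1$1)\<^sup>2 + (A$1$2)\<^sup>2 + (A$2$1)\<^sup>2 + (A$2$2)\<^sup>2) + 1"

lemma mat_bound_ge_1: "mat_bound A \<ge> 1"
  by (simp add: mat_bound_def)

lemma sqn_lincomb_le:
  "sqn (of_real p * u + of_real q * v, of_real r * u + of_real s * v)
     \<le> (2 * (p\<^sup>2 + q\<^sup>2 + r\<^sup>2 + s\<^sup>2) + 1) * sqn (u, v)"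
proof -
  have le: "(cmod (of_real p * u + of_real q * v))\<^sup>2 \<le> 2 * (p\<^sup>2 * (cmod u)\<^sup>2 + q\<^sup>2 * (cmod v)\<^sup>2)" for p q
  proof -
    have "(cmod (of_real p * u + of_real q * v))\<^sup>2 \<le> (\<bar>p\<bar> * cmod u + \<bar>q\<bar> * cmod v)\<^sup>2"
      by (rule power_mono) (auto intro: norm_triangle_le simp: norm_mult)
    also have "\<dots> \<le> 2 * ((\<bar>p\<bar> * cmod u)\<^sup>2 + (\<bar>q\<bar> * cmod v)\<^sup>2)"
      using zero_le_power2[of "\<bar>p\<bar> * cmod u - \<bar>q\<bar> * cmod v"]
      by (simp add: power2_sum power2_diff)
    finally show ?thesis by (simp add: power_mult_distrib)
  qed
  have n: "0 \<le> x\<^sup>2 * (cmod y)\<^sup>2" for x y by simp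
  show ?thesis
    using le[of p q] le[of r s] n[of p v] n[of q u] n[of r v] n[of s u]
      zero_le_power2[of "cmod u"] zero_le_power2[of "cmod v"]
    unfolding sqn_def fst_conv snd_conv by (simp only: algebra_simps)
qed

lemma sqn_act_le: "sqn (act A h) \<le> mat_bound A * sqn h"
  using sqn_lincomb_le[of "A$1$1" "fst h" "A$1$2" "snd h" "A$2$1" "A$2$2"]
  by (simp add: act_def mat_bound_def)

lemma sqn_le_act:
  assumes "det A = 1"
  shows "sqn h \<le> mat_bound A * sqn (act A h)"
proof -
  obtain u v where h: "h = (u, v)" by (cases h)
  have d: "of_real (A$1$1) * of_real (A$2$2) - of_real (A$1$2) * of_real (A$2$1) = (1::complex)"
    using assms unfolding det_2 by (metis of_real_1 of_real_diff of_real_mult)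
  obtain x y where xy: "act A h = (x, y)" by (cases "act A h")
  \<comment> \<open>The inverse matrix, by Cramer's rule with determinant 1.\<close>
  have "u = of_real (A$2$2) * x + of_real (- (A$1$2)) * y"
    "v = of_real (- (A$2$1)) * x + of_real (A$1$1) * y"
    using xy d unfolding h act_def by (auto, algebra+)
  then have "sqn h \<le> (2 * ((A$2$2)\<^sup>2 + (- (A$1$2))\<^sup>2 + (- (A$2$1))\<^sup>2 + (A$1$1)\<^sup>2) + 1) * sqn (x, y)"
    unfolding h using sqn_lincomb_le by presburger
  then show ?thesis by (simp add: xy mat_bound_def algebra_simps)
qed

context
  fixes A :: mat2
  assumes det: "det A = 1"
begin

lemma sqn_act_pos: "sqn (act A (hom x)) > 0"
  using sqn_le_act[OF det, of "hom x"] sqn_hom_pos[of x] mat_bound_ge_1[of A]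
  by (smt (verit) mult_nonneg_nonpos)

text \<open>At a finite point that is not a pole, \<open>c\<close> is the automorphy factor, the
  denominator in \<open>mob A\<close>.\<close>

lemma act_hom: "\<exists>c. c \<noteq> 0 \<and> act A (hom x) = smult2 c (hom (mob A x))"
proof -
  have nz: "act A (hom x) \<noteq> (0, 0)" using sqn_act_pos[of x] by (auto simp: sqn_def)
  show ?thesis
  proof (cases x)
    case (Fin z)
    show ?thesis
    proof (cases "of_real (A$2$1) * z + of_real (A$2$2) = 0")
      case True
      then show ?thesis using nz by (auto simp: Fin act_def smult2_def)
    next
      case False
      then show ?thesis
        by (intro exI[of _ "of_real (A$2$1) * z + of_real (A$2$2)"])
          (simp add: Fin act_def smult2_def)
    qed
  next
    case Infty
    then show ?thesis using nz
      by (cases "A$2$1 = 0")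
        (auto simp: act_def smult2_def intro: exI[of _ "of_real (A$2$1)"])
  qed
qed

lemma conf_factor_bounds: "1 / mat_bound A \<le> conf_factor A x" "conf_factor A x \<le> mat_bound A"
proof -
  have pos: "mat_bound A > 0" using mat_bound_ge_1[of A] by simp
  show "conf_factor A x \<le> mat_bound A"
    using sqn_le_act[OF det, of "hom x"] sqn_act_pos by (simp add: conf_factor_eq field_simps)
  show "1 / mat_bound A \<le> conf_factor A x"
    using sqn_act_le[of A "hom x"] sqn_act_pos[of x] pos by (simp add: conf_factor_eq field_simps)
qed

lemma hdet_act:
  assumes "act A (hom x) = smult2 c (hom x')" "act A (hom y) = smult2 d (hom y')"
  shows "hdet x y = c * d * hdet x' y'"
proof -
  have D: "of_real (A$1$1) * of_real (A$2$2) - of_real (A$1$2) * of_real (A$2$1) = (1::complex)"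
    using det unfolding det_2 by (metis of_real_1 of_real_diff of_real_mult)
  show ?thesis
    using assms D unfolding hdet_def act_def smult2_def prod.inject by (elim conjE) algebra
qed

text \<open>Both \<open>hdet\<close> and \<open>sqn\<close> pick up the automorphy factors of
  \<open>x\<close> and \<open>y\<close>, which cancel. This is the chordal counterpart of |A x - A
  y|^2 = |A'(x)| |A'(y)| |x - y|^2 and justifies reading \<open>conf_factor\<close> as a
  derivative.\<close>

lemma dist_mob: "(dist (mob A x) (mob A y))\<^sup>2 = (dist x y)\<^sup>2 * (conf_factor A x * conf_factor A y)"
proof -
  obtain c d where c: "c \<noteq> 0" "act A (hom x) = smult2 c (hom (mob A x))"
    and d: "d \<noteq> 0" "act A (hom y) = smult2 d (hom (mob A y))"
    using act_hom by blast
  have "(cmod (hdet x y))\<^sup>2 = (cmod c)\<^sup>2 * (cmod d)\<^sup>2 * (cmod (hdet (mob A x) (mob A y)))\<^sup>2"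
    unfolding hdet_act[OF c(2) d(2)] by (simp add: norm_mult power_mult_distrib)
  then show ?thesis
    using c(1) d(1) sqn_hom_pos[of x] sqn_hom_pos[of y]
    by (simp add: dist_csphere_hdet conf_factor_eq c(2) d(2) sqn_smult2)
qed

lemma dist_mob_le: "dist (mob A x) (mob A y) \<le> mat_bound A * dist x y"
proof (rule power2_le_imp_le)
  have "conf_factor A x * conf_factor A y \<le> mat_bound A * mat_bound A"
    using conf_factor_bounds mat_bound_ge_1[of A] sqn_hom_pos sqn_act_pos
    by (intro mult_mono) (auto simp: conf_factor_eq less_imp_le)
  then have "(dist x y)\<^sup>2 * (conf_factor A x * conf_factor A y)
      \<le> (dist x y)\<^sup>2 * (mat_bound A * mat_bound A)"
    by (rule mult_left_mono) simp
  then show "(dist (mob A x) (mob A y))\<^sup>2 \<le> (mat_bound A * dist x y)\<^sup>2"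
    by (simp add: dist_mob power_mult_distrib) (simp add: power2_eq_square mult_ac)
  show "0 \<le> mat_bound A * dist x y" using mat_bound_ge_1[of A] by simp
qed

lemma tendsto_mob:
  assumes "f \<longlonglongrightarrow> x"
  shows "(\<lambda>n. mob A (f n)) \<longlonglongrightarrow> mob A x"
proof -
  have "(\<lambda>n. mat_bound A * dist (f n) x) \<longlonglongrightarrow> 0"
    using tendsto_mult_right_zero[OF assms[THEN tendsto_dist_iff[THEN iffD1]]] by simp
  then have "(\<lambda>n. dist (mob A (f n)) (mob A x)) \<longlonglongrightarrow> 0"
    by (rule Lim_null_comparison[rotated]) (simp add: dist_mob_le)
  then show ?thesis by (simp add: tendsto_dist_iff[of _ "mob A x"])
qed

lemma mob_eqI: "act A (hom x) = smult2 c (hom y) \<Longrightarrow> mob A x = y"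
proof -
  assume *: "act A (hom x) = smult2 c (hom y)"
  obtain d where d: "d \<noteq> 0" "act A (hom x) = smult2 d (hom (mob A x))" using act_hom by blast
  have "hom (mob A x) = smult2 (1/d) (smult2 d (hom (mob A x)))"
    using d(1) by (simp add: smult2_def)
  also have "\<dots> = smult2 (c/d) (hom y)"
    unfolding d(2)[symmetric] * by (simp add: smult2_smult2)
  finally show ?thesis by (rule hom_proportional)
qed

section \<open>Attracting and repelling fixed points\<close>

lemma fixed_point_eq:
  assumes "act A (hom x) = smult2 c (hom x)"
  shows "conf_factor A x = 1 / (cmod c)\<^sup>2"
  using sqn_hom_pos[of x] by (simp add: conf_factor_eq assms sqn_smult2)

text \<open>Fixed points correspond to eigenvectors. If \<open>x\<close> and \<open>y\<close>
  differ, \<open>hdet x y\<close> is nonzero and its invariance gives eigenvalues with product 1;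
  the two conformal factors are then reciprocal and cannot lie on the same side of 1. This makes the
  descriptions in \<open>zplus\<close> and \<open>zminus\<close> unique.\<close>

lemma fixed_point_unique:
  assumes "mob A x = x" "mob A y = y" "conf_factor A x < 1 \<and> conf_factor A y < 1 \<or>
    conf_factor A x > 1 \<and> conf_factor A y > 1"
  shows "x = y"
proof -
  obtain c d where c: "c \<noteq> 0" "act A (hom x) = smult2 c (hom x)"
    and d: "d \<noteq> 0" "act A (hom y) = smult2 d (hom y)"
    using act_hom[of x] act_hom[of y] assms by auto
  have "hdet x y = c * d * hdet x y" by (rule hdet_act[OF c(2) d(2)])
  moreover have "c * d \<noteq> 1"
  proof
    assume "c * d = 1"
    then have "(cmod c)\<^sup>2 * (cmod d)\<^sup>2 = 1"
      by (metis norm_mult norm_one power_mult_distrib power_one)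
    moreover have "(cmod c)\<^sup>2 > 0" "(cmod d)\<^sup>2 > 0" using c d by simp_all
    ultimately show False
      using assms(3) less_1_mult[of "(cmod c)\<^sup>2" "(cmod d)\<^sup>2"]
        mult_strict_mono[of "(cmod c)\<^sup>2" 1 "(cmod d)\<^sup>2" 1]
      unfolding fixed_point_eq[OF c(2)] fixed_point_eq[OF d(2)]
      by (simp add: divide_less_eq_1 less_divide_eq_1) blast
  qed
  ultimately show ?thesis by (simp add: hdet_eq_0_iff)
qed

text \<open>The eigenvector is written down in the affine chart. If the lower left entry vanishes,
  the matrix is triangular: \<open>Infty\<close> belongs to the eigenvalue \<open>A$1$1\<close>, and
  a finite point to the other one.\<close>

lemma eigenvector_exists:
  assumes r: "r\<^sup>2 - trace A * r + 1 = 0"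
  shows "\<exists>x. act A (hom x) = smult2 (of_real r) (hom x)"
proof -
  have t: "trace A = A$1$1 + A$2$2" by (simp add: trace_def sum_2)
  have D: "A$1$1 * A$2$2 - A$1$2 * A$2$1 = 1" using det by (simp add: det_2)
  have finite: ?thesis if "A$1$1 * u + A$1$2 = r * u" "A$2$1 * u + A$2$2 = r" for u
  proof (intro exI[of _ "Fin (of_real u)"])
    have "of_real (A$1$1) * of_real u + of_real (A$1$2) = (of_real r * of_real u :: complex)"
      "of_real (A$2$1) * of_real u + of_real (A$2$2) = (of_real r :: complex)"
      using that by (simp_all only: of_real_mult[symmetric] of_real_add[symmetric])
    then show "act A (hom (Fin (of_real u))) = smult2 (of_real r) (hom (Fin (of_real u)))"
      by (simp only: act_def smult2_def hom.simps fst_conv snd_conv mult_1_right)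
  qed
  consider "A$2$1 \<noteq> 0" | "A$2$1 = 0" "r = A$1$1" | "A$2$1 = 0" "r \<noteq> A$1$1" by blast
  then show ?thesis
  proof cases
    case 1
    have "A$1$1 * (r - A$2$2) + A$1$2 * A$2$1 = r * (r - A$2$2)"
      using r D unfolding t by algebra
    then show ?thesis
      using 1 by (intro finite[of "(r - A$2$2) / A$2$1"]) (simp_all add: field_simps)
  next
    case 2
    then show ?thesis by (intro exI[of _ Infty]) (simp add: act_def smult2_def)
  next
    case 3
    have "(r - A$1$1) * (r - A$2$2) = 0" using r D 3(1) unfolding t by algebra
    then have "r = A$2$2" using 3(2) by simp
    then show ?thesis
      using 3 by (intro finite[of "A$1$2 / (r - A$1$1)"]) (simp_all add: field_simps)
  qed
qed

text \<open>The roots of the characteristic polynomial are real, with product 1 and sum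
  \<open>trace A\<close>. If one had modulus 1, both would be 1 or both would be -1, against the
  bound on the trace; so one modulus is above 1 and the other below.\<close>

lemma eigenvalues_exist:
  assumes tr: "\<bar>trace A\<bar> > 2"
  shows "\<exists>r s. r\<^sup>2 - trace A * r + 1 = 0 \<and> s\<^sup>2 - trace A * s + 1 = 0 \<and> \<bar>r\<bar> > 1 \<and> \<bar>s\<bar> < 1 \<and> s \<noteq> 0"
proof -
  let ?t = "trace A"
  have t4: "?t\<^sup>2 - 4 > 0"
    using power_strict_mono[of 2 "\<bar>?t\<bar>" 2] tr by simp
  define q where "q = sqrt (?t\<^sup>2 - 4)"
  have q: "q\<^sup>2 = ?t\<^sup>2 - 4" using t4 by (simp add: q_def)
  define r where "r = (?t + q) / 2"
  define s where "s = (?t - q) / 2"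
  have rs: "r * s = 1" using q unfolding r_def s_def by (simp add: field_simps power2_eq_square)
  have sum: "r + s = ?t" by (simp add: r_def s_def field_simps)
  have roots: "r\<^sup>2 - ?t * r + 1 = 0" "s\<^sup>2 - ?t * s + 1 = 0" using rs sum by algebra+
  have nz: "r \<noteq> 0" "s \<noteq> 0" using rs by auto
  have n1: "\<bar>r\<bar> \<noteq> 1"
  proof
    assume "\<bar>r\<bar> = 1"
    then have "r = 1 \<or> r = - 1" by linarith
    then have "s = r" using rs by auto
    with \<open>r = 1 \<or> r = - 1\<close> sum tr show False by auto
  qed
  have "\<bar>r\<bar> * \<bar>s\<bar> = 1" using rs by (metis abs_mult abs_one)
  with n1 nz have "\<bar>r\<bar> > 1 \<and> \<bar>s\<bar> < 1 \<or> \<bar>s\<bar> > 1 \<and> \<bar>r\<bar> < 1"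
    by (smt (verit) mult_less_cancel_left2 mult_less_cancel_right2 zero_less_abs_iff)
  with roots nz show ?thesis by blast
qed

text \<open>Conjugation commutes with \<open>mob A\<close> and preserves \<open>conf_factor\<close>,
  so it fixes the points that these two data determine uniquely. An eigenvalue of modulus above 1
  belongs to the attracting point, since the conformal factor is the inverse square of the
  modulus.\<close>

lemma zplus_zminus_real:
  assumes tr: "\<bar>trace A\<bar> > 2"
  shows "sconj (zplus A) = zplus A" "sconj (zminus A) = zminus A"
proof -
  obtain r s where r: "r\<^sup>2 - trace A * r + 1 = 0" "\<bar>r\<bar> > 1"
    and s: "s\<^sup>2 - trace A * s + 1 = 0" "\<bar>s\<bar> < 1" "s \<noteq> 0"
    using eigenvalues_exist[OF tr] by blast
  obtain x y where x: "act A (hom x) = smult2 (of_real r) (hom x)"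
    and y: "act A (hom y) = smult2 (of_real s) (hom y)"
    using eigenvector_exists r(1) s(1) by metis
  have "mob A x = x" "mob A y = y" using mob_eqI x y by blast+
  moreover have "conf_factor A x < 1"
    using r(2) power_strict_mono[of 1 "\<bar>r\<bar>" 2] unfolding fixed_point_eq[OF x] by (simp add: field_simps)
  moreover have "conf_factor A y > 1"
    using s(2,3) power_strict_mono[of "\<bar>s\<bar>" 1 2] unfolding fixed_point_eq[OF y]
    by (simp add: field_simps)
  ultimately have "\<exists>!x. mob A x = x \<and> conf_factor A x < 1" "\<exists>!x. mob A x = x \<and> conf_factor A x > 1"
    using fixed_point_unique by blast+
  from this[THEN theI'] have
    p: "mob A (zplus A) = zplus A \<and> conf_factor A (zplus A) < 1" and
    m: "mob A (zminus A) = zminus A \<and> conf_factor A (zminus A) > 1"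
    by (simp_all add: zplus_def zminus_def)
  show "sconj (zplus A) = zplus A"
    by (rule fixed_point_unique) (use p in \<open>simp_all add: mob_sconj conf_factor_sconj\<close>)
  show "sconj (zminus A) = zminus A"
    by (rule fixed_point_unique) (use m in \<open>simp_all add: mob_sconj conf_factor_sconj\<close>)
qed

end

lemma mob_mult:
  assumes "det A = 1" "det B = 1"
  shows "mob (A ** B) x = mob A (mob B x)"
proof -
  have det: "det (A ** B) = 1" using assms by (simp add: det_mul)
  obtain c where "act B (hom x) = smult2 c (hom (mob B x))" using act_hom[OF assms(2)] by blast
  moreover obtain d where "act A (hom (mob B x)) = smult2 d (hom (mob A (mob B x)))"
    using act_hom[OF assms(1)] by blast
  ultimately show ?thesis
    by (intro mob_eqI[OF det]) (simp add: act_mult act_smult2 smult2_smult2)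
qed

text \<open>The conformal factor lies between \<open>1 / mat_bound A\<close> and
  \<open>mat_bound A\<close>, so the exponent \<open>- \<bar>s\<bar>\<close> covers both signs of
  \<open>s\<close>. In this form \<open>critical_exponent X\<close> can be inserted without knowing
  its sign.\<close>

lemma conf_factor_powr_ge:
  assumes "det A = 1"
  shows "conf_factor A x powr s \<ge> mat_bound A powr - \<bar>s\<bar>"
proof -
  have M: "mat_bound A \<ge> 1" by (rule mat_bound_ge_1)
  have c: "1 / mat_bound A \<le> conf_factor A x" "conf_factor A x \<le> mat_bound A"
    using conf_factor_bounds[OF assms] by blast+
  have pos: "conf_factor A x > 0" using M c(1) by (smt (verit) divide_pos_pos)
  show ?thesis
  proof (cases "s \<ge> 0")
    case True
    have "mat_bound A powr - s = (1 / mat_bound A) powr s"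
      using M by (simp add: powr_minus_divide powr_divide)
    also have "\<dots> \<le> conf_factor A x powr s" using c(1) True M by (intro powr_mono2) auto
    finally show ?thesis using True by simp
  next
    case False
    have "mat_bound A powr s \<le> conf_factor A x powr s"
      using c(2) False pos by (intro powr_mono2') auto
    then show ?thesis using False by simp
  qed
qed

section \<open>The differentials under the involution\<close>

lemma hdet_Fin: "hdet x (Fin z) = fst (hom x) - snd (hom x) * z"
  by (simp add: hdet_def)

text \<open>The base point enters through a constant factor, which a logarithmic derivative does not
  see. Where the cross ratio degenerates it is 0 by division by zero, and there \<open>dlog\<close>
  is 0 for the same reason.\<close>

lemma dlog_cross_ratio:
  "dlog (\<lambda>z. cross_ratio a b (Fin z) d) z =
     (if cross_ratio a b (Fin z) d = 0 then 0
      else snd (hom b) / hdet b (Fin z) - snd (hom a) / hdet a (Fin z))"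
proof (cases "cross_ratio a b (Fin z) d = 0")
  case False
  define K where "K = hdet b d / hdet a d"
  have F: "(\<lambda>z. cross_ratio a b (Fin z) d)
      = (\<lambda>z. K * ((fst (hom a) - snd (hom a) * z) / (fst (hom b) - snd (hom b) * z)))"
    by (simp add: fun_eq_iff cross_ratio_def K_def hdet_Fin)
  have nz: "K \<noteq> 0" "fst (hom a) - snd (hom a) * z \<noteq> 0" "fst (hom b) - snd (hom b) * z \<noteq> 0"
    using False by (auto simp: cross_ratio_def K_def hdet_Fin)
  have "((\<lambda>z. cross_ratio a b (Fin z) d) has_field_derivative
      K * ((- snd (hom a) * (fst (hom b) - snd (hom b) * z)
        - (fst (hom a) - snd (hom a) * z) * (- snd (hom b)))
        / ((fst (hom b) - snd (hom b) * z) * (fst (hom b) - snd (hom b) * z)))) (at z)"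
    unfolding F using nz by (auto intro!: derivative_eq_intros simp: algebra_simps)
  from DERIV_imp_deriv[OF this] nz show ?thesis
    unfolding dlog_def if_not_P[OF False] by (simp add: fun_cong[OF F] hdet_Fin divide_simps)
qed (simp add: dlog_def)

text \<open>The base point \<open>d\<close> may be non-real: after \<open>dlog_cross_ratio\<close>
  it is visible only in the condition that the cross ratio vanishes, which is the same at
  \<open>z\<close> and at \<open>cnj z\<close>.\<close>

lemma dlog_cross_ratio_cnj:
  assumes "sconj a = a" "sconj b = b"
  shows "dlog (\<lambda>z. cross_ratio a b (Fin z) d) (cnj z) = cnj (dlog (\<lambda>z. cross_ratio a b (Fin z) d) z)"
proof -
  have h: "hdet x (Fin (cnj z)) = cnj (hdet x (Fin z))" if "sconj x = x" for x
    using hdet_sconj[of x "Fin z"] that by simp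
  have s: "cnj (snd (hom x)) = snd (hom x)" for x by (cases x) simp_all
  have "cross_ratio a b (Fin (cnj z)) d = 0 \<longleftrightarrow> cross_ratio a b (Fin z) d = 0"
    by (simp add: cross_ratio_def h assms)
  then show ?thesis by (simp add: dlog_cross_ratio h s assms)
qed

lemma word_mat_in_Gam: "w \<in> lists (letters X) \<Longrightarrow> word_mat X w \<in> Gam X"
  by (simp add: Gam_def)

context
  fixes X :: schottky
  assumes schottky: "fuchsian_schottky X"
begin

lemma det_gen: "k \<in> letters X \<Longrightarrow> det (gen X k) = 1"
  using schottky by (simp add: fuchsian_schottky_def)

lemma det_word_mat: "set w \<subseteq> letters X \<Longrightarrow> det (word_mat X w) = 1"
  by (induction w) (simp_all add: det_gen det_mul)

lemma gen_in_Gam: "k \<in> letters X \<Longrightarrow> gen X k \<in> Gam X"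
  using word_mat_in_Gam[of "[k]" X] by simp

lemma gen_hyperbolic:
  assumes "k \<in> letters X"
  shows "\<bar>trace (gen X k)\<bar> > 2"
proof -
  have "reduced X [k]" using assms by (simp add: reduced_def)
  then have "gen X k \<noteq> mat 1"
    using schottky by (force simp: fuchsian_schottky_def)
  then show ?thesis using schottky gen_in_Gam[OF assms] by (auto simp: fuchsian_schottky_def)
qed

lemma omega_cnj:
  assumes "k \<in> letters X"
  shows "omega X k (cnj z) (cnj v) = cnj (omega X k z v)"
proof -
  have r: "sconj (mob h (zplus (gen X k))) = mob h (zplus (gen X k))"
    "sconj (mob h (zminus (gen X k))) = mob h (zminus (gen X k))" for h
    using zplus_zminus_real[OF det_gen[OF assms] gen_hyperbolic[OF assms]]
    by (simp_all add: mob_sconj[symmetric])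
  show ?thesis
    unfolding omega_def by (simp add: dlog_cross_ratio_cnj[OF r] flip: infsum_cnj)
qed

lemma iota_phi:
  assumes "k \<in> letters X"
  shows "iota_pullback (phi X k) = (if k \<le> genus X then phi X k else fscale (- 1) (phi X k))"
proof (cases "k \<le> genus X")
  case True
  then show ?thesis
    using omega_cnj[OF assms] by (simp add: iota_pullback_def phi_def fun_eq_iff add.commute)
next
  case False
  then have "k - genus X \<in> letters X" using assms by (auto simp: letters_def)
  from omega_cnj[OF this] False show ?thesis
    by (simp add: iota_pullback_def phi_def fscale_def fun_eq_iff algebra_simps)
qed

end

section \<open>Spaces of forms\<close>

lemma cn_on_0: "cn_on n S (\<lambda>z. 0)"
  by (induction n) (auto intro!: exI[of _ "\<lambda>_. 0"])

text \<open>One induction treats sums and complex multiples together; they are recovered with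
  \<open>c = 1\<close> and with \<open>g = 0\<close>.\<close>

lemma cn_on_lin: "cn_on n S f \<Longrightarrow> cn_on n S g \<Longrightarrow> cn_on n S (\<lambda>z. c * f z + g z)"
proof (induction n arbitrary: f g)
  case (Suc n)
  obtain fx fy where f: "cn_on n S fx" "cn_on n S fy"
    "\<And>z. z \<in> S \<Longrightarrow> (f has_derivative (\<lambda>v. Re v *\<^sub>R fx z + Im v *\<^sub>R fy z)) (at z)"
    using Suc.prems(1) by auto
  obtain gx gy where g: "cn_on n S gx" "cn_on n S gy"
    "\<And>z. z \<in> S \<Longrightarrow> (g has_derivative (\<lambda>v. Re v *\<^sub>R gx z + Im v *\<^sub>R gy z)) (at z)"
    using Suc.prems(2) by auto
  have "((\<lambda>z. c * f z + g z) has_derivative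
      (\<lambda>v. Re v *\<^sub>R (c * fx z + gx z) + Im v *\<^sub>R (c * fy z + gy z))) (at z)" if "z \<in> S" for z
    using has_derivative_add[OF has_derivative_mult_right[OF f(3), of z c] g(3), OF that that]
    by (simp add: algebra_simps)
  then show ?case
    unfolding cn_on.simps using Suc.IH[OF f(1) g(1)] Suc.IH[OF f(2) g(2)] by blast
qed (auto intro!: continuous_intros)

lemma cn_on_cmult: "cn_on n S f \<Longrightarrow> cn_on n S (\<lambda>z. c * f z)"
  using cn_on_lin[OF _ cn_on_0, of n S f c] by simp

lemma cn_on_cnj: "cn_on n S f \<Longrightarrow> cn_on n {z. cnj z \<in> S} (\<lambda>z. f (cnj z))"
proof (induction n arbitrary: f)
  case 0
  have "continuous_on {z. cnj z \<in> S} cnj" by (intro continuous_intros)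
  then show ?case using 0 by (auto intro: continuous_on_compose2)
next
  case (Suc n)
  obtain fx fy where f: "cn_on n S fx" "cn_on n S fy"
    "\<And>z. z \<in> S \<Longrightarrow> (f has_derivative (\<lambda>v. Re v *\<^sub>R fx z + Im v *\<^sub>R fy z)) (at z)"
    using Suc.prems(1) by auto
  have cnj: "(cnj has_derivative cnj) (at z)" for z
    using bounded_linear_cnj by (rule bounded_linear_imp_has_derivative)
  \<comment> \<open>By the chain rule the partial derivative in the imaginary direction changes
    sign.\<close>
  have "((\<lambda>z. f (cnj z)) has_derivative (\<lambda>v. Re v *\<^sub>R fx (cnj z) + Im v *\<^sub>R (- 1 * fy (cnj z)))) (at z)"
    if "z \<in> {z. cnj z \<in> S}" for z
    using has_derivative_compose[OF cnj f(3), of z] that by simp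
  moreover have "cn_on n {z. cnj z \<in> S} (\<lambda>z. fx (cnj z))"
    "cn_on n {z. cnj z \<in> S} (\<lambda>z. - 1 * fy (cnj z))"
    using Suc.IH f(1,2) by (blast intro: cn_on_cmult)+
  ultimately show ?case unfolding cn_on.simps by blast
qed

lemma cn_on_subset: "cn_on n S f \<Longrightarrow> T \<subseteq> S \<Longrightarrow> cn_on n T f"
proof (induction n arbitrary: f)
  case (Suc n)
  then show ?case by simp (meson subsetD)
qed (auto intro: continuous_on_subset)

lemma cinf_on_lin: "cinf_on S f \<Longrightarrow> cinf_on S g \<Longrightarrow> cinf_on S (\<lambda>z. c * f z + g z)"
  by (simp add: cinf_on_def cn_on_lin)

lemma cinf_on_cmult: "cinf_on S f \<Longrightarrow> cinf_on S (\<lambda>z. c * f z)"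
  by (simp add: cinf_on_def cn_on_cmult)

lemma cinf_on_cnj: "cinf_on S f \<Longrightarrow> cinf_on {z. cnj z \<in> S} (\<lambda>z. f (cnj z))"
  by (simp add: cinf_on_def cn_on_cnj)

lemma cinf_on_subset: "cinf_on S f \<Longrightarrow> T \<subseteq> S \<Longrightarrow> cinf_on T f"
  by (auto simp: cinf_on_def intro: cn_on_subset)

lemma cinf_on_0: "cinf_on S (\<lambda>z. 0)"
  by (simp add: cinf_on_def cn_on_0)

lemma cinf_on_has_derivative:
  assumes "cinf_on S f" "z \<in> S"
  shows "(f has_derivative frechet_derivative f (at z)) (at z)"
proof -
  have "cn_on (Suc 0) S f" using assms(1) by (simp only: cinf_on_def)
  then have "f differentiable (at z)" using assms(2) by (auto simp: differentiable_def)
  then show ?thesis by (simp add: frechet_derivative_works)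
qed

section \<open>Closed and exact forms under scaling and pullback\<close>

lemma fscale_fscale: "fscale c (fscale d \<eta>) = fscale (c * d) \<eta>"
  by (simp add: fscale_def fun_eq_iff algebra_simps)

lemma fscale_1 [simp]: "fscale 1 \<eta> = \<eta>"
  by (simp add: fscale_def)

lemma fscale_add: "fscale c (\<eta> + \<xi>) = fscale c \<eta> + fscale c \<xi>"
  by (simp add: fscale_def plus_fun_def algebra_simps)

lemma fscale_scaleR: "fscale c (r *\<^sub>R \<eta>) = r *\<^sub>R fscale c \<eta>"
  by (simp add: fscale_def scaleR_fun_def)

lemma scaleR_fscale: "r *\<^sub>R \<eta> = fscale (of_real r) \<eta>"
  by (simp add: fscale_def scaleR_fun_def fun_eq_iff scaleR_conv_of_real)

lemma iota_pullback_add: "iota_pullback (\<eta> + \<xi>) = iota_pullback \<eta> + iota_pullback \<xi>"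
  by (simp add: iota_pullback_def plus_fun_def)

lemma iota_pullback_fscale: "iota_pullback (fscale c \<eta>) = fscale c (iota_pullback \<eta>)"
  by (simp add: iota_pullback_def fscale_def)

lemma iota_pullback_iota_pullback [simp]: "iota_pullback (iota_pullback \<eta>) = \<eta>"
  by (simp add: iota_pullback_def)

lemma closed_formsD:
  assumes "\<eta> \<in> closed_forms X"
  shows "z \<in> fdom X \<Longrightarrow> linear (\<eta> z)"
    and "cinf_on (fdom X) (\<lambda>z. \<eta> z v)"
    and "A \<in> Gam X \<Longrightarrow> z \<in> fdom X \<Longrightarrow> mob A (Fin z) = Fin z' \<Longrightarrow>
        \<eta> z' (v / (of_real (A$2$1) * z + of_real (A$2$2))\<^sup>2) = \<eta> z v"
    and "z \<in> fdom X \<Longrightarrow> frechet_derivative (\<lambda>z. \<eta> z v) (at z) u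
                      = frechet_derivative (\<lambda>z. \<eta> z u) (at z) v"
proof -
  note * = assms[unfolded closed_forms_def mem_Collect_eq]
  show "linear (\<eta> z)" if "z \<in> fdom X" using conjunct1[OF *] that by (rule bspec)
  show "cinf_on (fdom X) (\<lambda>z. \<eta> z v)" using *[THEN conjunct2, THEN conjunct1] by (rule spec)
  show "\<eta> z' (v / (of_real (A$2$1) * z + of_real (A$2$2))\<^sup>2) = \<eta> z v"
    if "A \<in> Gam X" "z \<in> fdom X" "mob A (Fin z) = Fin z'"
    using *[THEN conjunct2, THEN conjunct2, THEN conjunct2, THEN conjunct1] that by blast
  show "frechet_derivative (\<lambda>z. \<eta> z v) (at z) u = frechet_derivative (\<lambda>z. \<eta> z u) (at z) v"
    if "z \<in> fdom X"
    using *[THEN conjunct2, THEN conjunct2, THEN conjunct2, THEN conjunct2] that by blast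
qed

lemma closed_forms_lin:
  assumes "\<eta> \<in> closed_forms X" "\<xi> \<in> closed_forms X"
  shows "fscale c \<eta> + \<xi> \<in> closed_forms X"
proof -
  have s: "(fscale c \<eta> + \<xi>) z v = c * \<eta> z v + \<xi> z v" for z v
    by (simp add: fscale_def plus_fun_def)
  \<comment> \<open>\<open>frechet_derivative\<close> is additive only for differentiable functions;
    smoothness of the coefficients supplies this.\<close>
  have fd: "frechet_derivative (\<lambda>z. (fscale c \<eta> + \<xi>) z v) (at z) u =
      c * frechet_derivative (\<lambda>z. \<eta> z v) (at z) u + frechet_derivative (\<lambda>z. \<xi> z v) (at z) u"
    if "z \<in> fdom X" for z u v
  proof -
    note D = closed_formsD(2)[THEN cinf_on_has_derivative, OF _ that]
    have "((\<lambda>z. (fscale c \<eta> + \<xi>) z v) has_derivative (\<lambda>u. c * frechet_derivative (\<lambda>z. \<eta> z v) (at z) u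
        + frechet_derivative (\<lambda>z. \<xi> z v) (at z) u)) (at z)"
      unfolding s by (intro has_derivative_add has_derivative_mult_right D assms)
    from fun_cong[OF frechet_derivative_at[OF this, symmetric]] show ?thesis .
  qed
  have inf: "\<exists>S a b. open S \<and> 0 \<in> S \<and> cinf_on S a \<and> cinf_on S b \<and>
        (\<forall>w\<in>S - {0}. \<forall>v. (fscale c \<eta> + \<xi>) (1 / w) (- v / w\<^sup>2) = Re v *\<^sub>R a w + Im v *\<^sub>R b w)"
    if "Infty \<in> Omega X"
  proof -
    obtain S a b where 1: "open S" "0 \<in> S" "cinf_on S a" "cinf_on S b"
      "\<And>w v. w \<in> S - {0} \<Longrightarrow> \<eta> (1 / w) (- v / w\<^sup>2) = Re v *\<^sub>R a w + Im v *\<^sub>R b w"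
      using assms(1) \<open>Infty \<in> Omega X\<close> unfolding closed_forms_def mem_Collect_eq by metis
    obtain T a' b' where 2: "open T" "0 \<in> T" "cinf_on T a'" "cinf_on T b'"
      "\<And>w v. w \<in> T - {0} \<Longrightarrow> \<xi> (1 / w) (- v / w\<^sup>2) = Re v *\<^sub>R a' w + Im v *\<^sub>R b' w"
      using assms(2) \<open>Infty \<in> Omega X\<close> unfolding closed_forms_def mem_Collect_eq by metis
    have "cinf_on (S \<inter> T) (\<lambda>w. c * a w + a' w)" "cinf_on (S \<inter> T) (\<lambda>w. c * b w + b' w)"
      using 1 2 by (auto intro!: cinf_on_lin elim: cinf_on_subset)
    moreover have "(fscale c \<eta> + \<xi>) (1 / w) (- v / w\<^sup>2)
        = Re v *\<^sub>R (c * a w + a' w) + Im v *\<^sub>R (c * b w + b' w)" if "w \<in> S \<inter> T - {0}" for w v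
      unfolding s using 1(5)[of w v] 2(5)[of w v] that by (simp add: algebra_simps)
    ultimately show ?thesis
      using 1(1,2) 2(1,2)
      by (intro exI[of _ "S \<inter> T"] exI[of _ "\<lambda>w. c * a w + a' w"] exI[of _ "\<lambda>w. c * b w + b' w"]) auto
  qed
  show ?thesis
    unfolding closed_forms_def mem_Collect_eq
  proof (intro conjI)
    show "\<forall>z\<in>fdom X. linear ((fscale c \<eta> + \<xi>) z)"
    proof
      fix z assume z: "z \<in> fdom X"
      show "linear ((fscale c \<eta> + \<xi>) z)"
        using linear_compose_add[OF linear_compose[OF closed_formsD(1)[OF assms(1) z] linear_times]
            closed_formsD(1)[OF assms(2) z], of c]
        by (simp add: fscale_def plus_fun_def o_def)
    qed
    show "\<forall>v. cinf_on (fdom X) (\<lambda>z. (fscale c \<eta> + \<xi>) z v)"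
      unfolding s using assms by (intro allI cinf_on_lin closed_formsD(2))
    show "\<forall>A\<in>Gam X. \<forall>z\<in>fdom X. \<forall>z' v. mob A (Fin z) = Fin z' \<longrightarrow>
        (fscale c \<eta> + \<xi>) z' (v / (of_real (A$2$1) * z + of_real (A$2$2))\<^sup>2) = (fscale c \<eta> + \<xi>) z v"
      unfolding s using assms[THEN closed_formsD(3)] by metis
    show "\<forall>z\<in>fdom X. \<forall>u v. frechet_derivative (\<lambda>z. (fscale c \<eta> + \<xi>) z v) (at z) u
                      = frechet_derivative (\<lambda>z. (fscale c \<eta> + \<xi>) z u) (at z) v"
    proof (intro ballI allI)
      fix z u v assume z: "z \<in> fdom X"
      show "frechet_derivative (\<lambda>z. (fscale c \<eta> + \<xi>) z v) (at z) u
            = frechet_derivative (\<lambda>z. (fscale c \<eta> + \<xi>) z u) (at z) v"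
        unfolding fd[OF z] using assms[THEN closed_formsD(4)] z by metis
    qed
  qed (use inf in blast)
qed

lemma closed_forms_0: "0 \<in> closed_forms X"
proof -
  have "frechet_derivative (\<lambda>z::complex. 0 :: complex) (at z) = (\<lambda>v. 0)" for z
    by (rule frechet_derivative_at[symmetric]) simp
  then show ?thesis
    by (auto simp: closed_forms_def zero_fun_def cinf_on_0 module_hom_zero
        intro!: exI[of _ UNIV] exI[of _ "\<lambda>_. 0"])
qed

lemma closed_forms_add: "\<eta> \<in> closed_forms X \<Longrightarrow> \<xi> \<in> closed_forms X \<Longrightarrow> \<eta> + \<xi> \<in> closed_forms X"
  using closed_forms_lin[of \<eta> X \<xi> 1] by simp

lemma closed_forms_fscale: "\<eta> \<in> closed_forms X \<Longrightarrow> fscale c \<eta> \<in> closed_forms X"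
  using closed_forms_lin[OF _ closed_forms_0, of \<eta> X c] by simp

lemma exact_forms_0: "0 \<in> exact_forms X"
  by (auto simp: exact_forms_def zero_fun_def cinf_on_0 intro!: exI[of _ "\<lambda>_. 0"])

lemma exact_forms_lin:
  assumes "\<eta> \<in> exact_forms X" "\<xi> \<in> exact_forms X"
  shows "fscale c \<eta> + \<xi> \<in> exact_forms X"
proof -
  obtain f where f: "cinf_on (fdom X) (\<lambda>z. f (Fin z))"
      "cinf_on {w. inf_chart w \<in> Omega X} (\<lambda>w. f (inf_chart w))"
      "\<And>A x. A \<in> Gam X \<Longrightarrow> x \<in> Omega X \<Longrightarrow> f (mob A x) = f x"
      "\<And>z. z \<in> fdom X \<Longrightarrow> ((\<lambda>z. f (Fin z)) has_derivative \<eta> z) (at z)"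
    using assms(1) unfolding exact_forms_def by blast
  obtain g where g: "cinf_on (fdom X) (\<lambda>z. g (Fin z))"
      "cinf_on {w. inf_chart w \<in> Omega X} (\<lambda>w. g (inf_chart w))"
      "\<And>A x. A \<in> Gam X \<Longrightarrow> x \<in> Omega X \<Longrightarrow> g (mob A x) = g x"
      "\<And>z. z \<in> fdom X \<Longrightarrow> ((\<lambda>z. g (Fin z)) has_derivative \<xi> z) (at z)"
    using assms(2) unfolding exact_forms_def by blast
  show ?thesis
    unfolding exact_forms_def mem_Collect_eq plus_fun_def fscale_def
    by (intro exI[of _ "\<lambda>x. c * f x + g x"] conjI ballI)
      (use f g has_derivative_add[OF has_derivative_mult_right[OF f(4)] g(4)] in \<open>auto intro: cinf_on_lin\<close>)
qed

lemma exact_forms_add: "\<eta> \<in> exact_forms X \<Longrightarrow> \<xi> \<in> exact_forms X \<Longrightarrow> \<eta> + \<xi> \<in> exact_forms X"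
  using exact_forms_lin[of \<eta> X \<xi> 1] by simp

lemma exact_forms_fscale: "\<eta> \<in> exact_forms X \<Longrightarrow> fscale c \<eta> \<in> exact_forms X"
  using exact_forms_lin[OF _ exact_forms_0, of \<eta> X c] by simp

text \<open>The same group elements, applied to the conjugate base point, converge to the conjugate
  limit: the matrices are real and conjugation is an isometry of the chordal metric.\<close>

lemma limit_set_sconj: "x \<in> limit_set X \<Longrightarrow> sconj x \<in> limit_set X"
proof -
  assume "x \<in> limit_set X"
  then obtain z A where A: "\<forall>n::nat. A n \<in> Gam X" "\<forall>m n. m \<noteq> n \<longrightarrow> A m \<noteq> A n \<and> A m \<noteq> - A n"
    "(\<lambda>n. mob (A n) z) \<longlonglongrightarrow> x"
    unfolding limit_set_def by blast
  have "(\<lambda>n. mob (A n) (sconj z)) \<longlonglongrightarrow> sconj x"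
    using A(3) by (simp add: mob_sconj dist_sconj tendsto_dist_iff[of _ x] tendsto_dist_iff[of _ "sconj x"])
  with A(1,2) show ?thesis unfolding limit_set_def by blast
qed

lemma Omega_sconj: "sconj x \<in> Omega X \<longleftrightarrow> x \<in> Omega X"
  using limit_set_sconj[of x X] limit_set_sconj[of "sconj x" X] by (auto simp: Omega_def)

lemma fdom_cnj: "cnj z \<in> fdom X \<longleftrightarrow> z \<in> fdom X"
  using Omega_sconj[of "Fin z" X] by (simp add: fdom_def)

lemma closed_forms_iota_pullback:
  assumes "\<eta> \<in> closed_forms X"
  shows "iota_pullback \<eta> \<in> closed_forms X"
proof -
  have lin: "linear cnj" using bounded_linear_cnj by (rule bounded_linear.linear)
  have ci: "cinf_on (fdom X) (\<lambda>z. iota_pullback \<eta> z v)" for v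
  proof -
    have "cinf_on (fdom X) (\<lambda>z. \<eta> z (cnj v))" using assms by (simp add: closed_formsD)
    from cinf_on_cnj[OF this] show ?thesis by (simp add: fdom_cnj iota_pullback_def)
  qed
  have fd: "frechet_derivative (\<lambda>z. iota_pullback \<eta> z v) (at z) u =
      frechet_derivative (\<lambda>z. \<eta> z (cnj v)) (at (cnj z)) (cnj u)" if z: "z \<in> fdom X" for z u v
  proof -
    have cnj: "(cnj has_derivative cnj) (at z)" for z
      using bounded_linear_cnj by (rule bounded_linear_imp_has_derivative)
    have "cinf_on (fdom X) (\<lambda>z. \<eta> z (cnj v))" using assms by (simp add: closed_formsD)
    then have "((\<lambda>z. \<eta> z (cnj v)) has_derivative frechet_derivative (\<lambda>z. \<eta> z (cnj v)) (at (cnj z))) (at (cnj z))"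
      by (rule cinf_on_has_derivative) (simp add: fdom_cnj z)
    from has_derivative_compose[OF cnj this] show ?thesis
      by (simp only: iota_pullback_def frechet_derivative_at[symmetric])
  qed
  have inf: "\<exists>S a b. open S \<and> 0 \<in> S \<and> cinf_on S a \<and> cinf_on S b \<and>
        (\<forall>w\<in>S - {0}. \<forall>v. iota_pullback \<eta> (1 / w) (- v / w\<^sup>2) = Re v *\<^sub>R a w + Im v *\<^sub>R b w)"
    if "Infty \<in> Omega X"
  proof -
    obtain S a b where 1: "open S" "0 \<in> S" "cinf_on S a" "cinf_on S b"
      "\<And>w v. w \<in> S - {0} \<Longrightarrow> \<eta> (1 / w) (- v / w\<^sup>2) = Re v *\<^sub>R a w + Im v *\<^sub>R b w"
      using assms(1) \<open>Infty \<in> Omega X\<close> unfolding closed_forms_def mem_Collect_eq by metis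
    let ?S = "{w. cnj w \<in> S}"
    have "open ?S"
      using open_vimage[OF 1(1), of cnj] by (simp add: vimage_def continuous_on_cnj continuous_on_id)
    moreover have "cinf_on ?S (\<lambda>w. a (cnj w))" "cinf_on ?S (\<lambda>w. - 1 * b (cnj w))"
      by (rule cinf_on_cnj[OF 1(3)], rule cinf_on_cmult[OF cinf_on_cnj[OF 1(4)]])
    \<comment> \<open>The expansion is evaluated at \<open>cnj w\<close> and \<open>cnj v\<close>,
      so the coefficient of \<open>Im v\<close> changes sign.\<close>
    moreover have "iota_pullback \<eta> (1 / w) (- v / w\<^sup>2) = Re v *\<^sub>R a (cnj w) + Im v *\<^sub>R (- 1 * b (cnj w))"
      if "w \<in> ?S - {0}" for w v
      using 1(5)[of "cnj w" "cnj v"] that by (simp add: iota_pullback_def)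
    ultimately show ?thesis
      using 1(2) by (intro exI[of _ ?S] exI[of _ "\<lambda>w. a (cnj w)"] exI[of _ "\<lambda>w. - 1 * b (cnj w)"]) auto
  qed
  show ?thesis
    unfolding closed_forms_def mem_Collect_eq
  proof (intro conjI)
    show "\<forall>z\<in>fdom X. linear (iota_pullback \<eta> z)"
      using linear_compose[OF lin closed_formsD(1)[OF assms]] unfolding iota_pullback_def o_def
      by (simp add: fdom_cnj)
    show "\<forall>A\<in>Gam X. \<forall>z\<in>fdom X. \<forall>z' v. mob A (Fin z) = Fin z' \<longrightarrow>
        iota_pullback \<eta> z' (v / (of_real (A$2$1) * z + of_real (A$2$2))\<^sup>2) = iota_pullback \<eta> z v"
    proof (intro ballI allI impI)
      fix A z z' v assume *: "A \<in> Gam X" "z \<in> fdom X" "mob A (Fin z) = Fin z'"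
      \<comment> \<open>Invariance at \<open>z\<close> follows from invariance at
        \<open>cnj z\<close>, as a real matrix commutes with conjugation.\<close>
      have "mob A (Fin (cnj z)) = Fin (cnj z')"
        using mob_sconj[of A "Fin z"] by (simp only: sconj_simps *)
      then have "\<eta> (cnj z') (cnj v / (of_real (A$2$1) * cnj z + of_real (A$2$2))\<^sup>2) = \<eta> (cnj z) (cnj v)"
        using assms * by (intro closed_formsD(3)) (simp_all only: fdom_cnj)
      then show "iota_pullback \<eta> z' (v / (of_real (A$2$1) * z + of_real (A$2$2))\<^sup>2) = iota_pullback \<eta> z v"
        by (simp add: iota_pullback_def)
    qed
    show "\<forall>z\<in>fdom X. \<forall>u v. frechet_derivative (\<lambda>z. iota_pullback \<eta> z v) (at z) u
                      = frechet_derivative (\<lambda>z. iota_pullback \<eta> z u) (at z) v"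
      using fd closed_formsD(4)[OF assms] by (simp add: fdom_cnj)
  qed (use inf ci in blast)+
qed

lemma exact_forms_iota_pullback:
  assumes "\<eta> \<in> exact_forms X"
  shows "iota_pullback \<eta> \<in> exact_forms X"
proof -
  obtain f where f: "cinf_on (fdom X) (\<lambda>z. f (Fin z))"
      "cinf_on {w. inf_chart w \<in> Omega X} (\<lambda>w. f (inf_chart w))"
      "\<And>A x. A \<in> Gam X \<Longrightarrow> x \<in> Omega X \<Longrightarrow> f (mob A x) = f x"
      "\<And>z. z \<in> fdom X \<Longrightarrow> ((\<lambda>z. f (Fin z)) has_derivative \<eta> z) (at z)"
    using assms(1) unfolding exact_forms_def by blast
  have chart: "inf_chart (cnj w) = sconj (inf_chart w)" for w
    by (simp add: inf_chart_def)
  have cnj: "(cnj has_derivative cnj) (at z)" for z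
    using bounded_linear_cnj by (rule bounded_linear_imp_has_derivative)
  show ?thesis
    unfolding exact_forms_def mem_Collect_eq
  proof (intro exI[of _ "\<lambda>x. f (sconj x)"] conjI ballI)
    show "cinf_on (fdom X) (\<lambda>z. f (sconj (Fin z)))"
      using cinf_on_cnj[OF f(1)] by (simp add: fdom_cnj)
    show "cinf_on {w. inf_chart w \<in> Omega X} (\<lambda>w. f (sconj (inf_chart w)))"
      using cinf_on_cnj[OF f(2)] by (simp add: chart Omega_sconj)
    show "f (sconj (mob A x)) = f (sconj x)" if "A \<in> Gam X" "x \<in> Omega X" for A x
      using f(3)[of A "sconj x"] that by (simp add: mob_sconj Omega_sconj)
    show "((\<lambda>z. f (sconj (Fin z))) has_derivative iota_pullback \<eta> z) (at z)" if "z \<in> fdom X" for z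
      using has_derivative_compose[OF cnj f(4), of z] that by (simp add: fdom_cnj iota_pullback_def)
  qed
qed

section \<open>Twists\<close>

lemma twopii_nonzero [simp]: "twopii \<noteq> 0"
  by (simp add: twopii_def)

lemma tate_0 [simp]: "0 \<in> tate p"
  by (auto simp: tate_def intro!: exI[of _ 0])

lemma tate_add: "a \<in> tate p \<Longrightarrow> b \<in> tate p \<Longrightarrow> a + b \<in> tate p"
  by (auto simp: tate_def simp flip: distrib_left of_real_add)

lemma tate_of_real_mult: "a \<in> tate p \<Longrightarrow> of_real r * a \<in> tate p"
  by (force simp: tate_def mult.left_commute simp flip: of_real_mult)

lemma tate_twist: "a \<in> tate p \<Longrightarrow> twopii powi q * a \<in> tate (q + p)"
  by (auto simp: tate_def power_int_add)

text \<open>The sign is displayed as a real scalar, because real scalars preserve the lines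
  \<open>tate p\<close>.\<close>

lemma powi_neg_one: "(- 1) powi p = (of_real (if even p then 1 else - 1) :: complex)"
  by (simp add: power_int_minus_left)

section \<open>Cohomology with twisted coefficients, its twists and its Frobenius\<close>

lemma Zforms_subspace: "subspace (Zforms X p)"
  unfolding subspace_def
  by (auto simp: Zforms_def closed_forms_0 closed_forms_add scaleR_fscale closed_forms_fscale
      zero_fun_def plus_fun_def fscale_def tate_add tate_of_real_mult
      intro: closed_forms_0[unfolded zero_fun_def] closed_forms_add[unfolded plus_fun_def]
      closed_forms_fscale[unfolded fscale_def])

lemma exact_forms_subspace: "subspace (exact_forms X)"
  unfolding subspace_def
  by (simp add: exact_forms_0 exact_forms_add scaleR_fscale exact_forms_fscale)

lemma Bforms_subspace: "subspace (Bforms X p)"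
  unfolding Bforms_def by (intro subspace_inter Zforms_subspace exact_forms_subspace)

lemma H1_presentation: "presentation (H1 X p) (Zforms X p) (H1_class X p)"
  using presentation.presentation_rquot[OF presentation_rsub[OF Zforms_subspace[of X p]]
      Bforms_subspace[of X p]]
  by (simp add: H1_def H1_class_def[abs_def] Bforms_def)

text \<open>The inclusion for arbitrary exponents gives both directions, since scaling with exponent
  \<open>- q\<close> is inverse to scaling with \<open>q\<close>.\<close>

lemma fscale_twopii_Zforms: "fscale (twopii powi q) ` Zforms X p = Zforms X (p + q)"
proof -
  have 1: "fscale (twopii powi q) \<eta> \<in> Zforms X (p + q)" if "\<eta> \<in> Zforms X p" for q p \<eta>
  proof -
    have "fscale (twopii powi q) \<eta> z v \<in> tate (p + q - 1)" if "z \<in> fdom X" for z v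
      using tate_twist[of "\<eta> z v" "p - 1" q] \<open>\<eta> \<in> _\<close> that
      by (simp add: Zforms_def fscale_def add.commute add_diff_eq)
    then show ?thesis using that by (simp add: Zforms_def closed_forms_fscale)
  qed
  have "\<eta> = fscale (twopii powi q) (fscale (twopii powi (- q)) \<eta>)" for \<eta>
    by (simp add: fscale_fscale flip: power_int_add)
  with 1 1[of _ "p + q" "- q"] show ?thesis by (auto intro!: image_eqI)
qed

lemma fscale_twopii_Bforms: "fscale (twopii powi q) ` Bforms X p = Bforms X (p + q)"
proof -
  have 1: "fscale (twopii powi q) \<eta> \<in> Bforms X (p + q)" if "\<eta> \<in> Bforms X p" for q p \<eta>
    using that fscale_twopii_Zforms[of q X p] by (auto simp: Bforms_def exact_forms_fscale)
  have "\<eta> = fscale (twopii powi q) (fscale (twopii powi (- q)) \<eta>)" for \<eta>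
    by (simp add: fscale_fscale flip: power_int_add)
  with 1 1[of _ "p + q" "- q"] show ?thesis by (auto intro!: image_eqI)
qed

lemma twist_H_class:
  "twist_H p (H1_class X 1 \<eta>) = H1_class X p (fscale (twopii powi (p - 1)) \<eta>)"
  unfolding twist_H_def H1_class_def
  by (rule image_rcls_rsub) (use fscale_twopii_Bforms[of "p - 1" X 1] in \<open>simp_all add: fscale_add\<close>)

definition frob_form :: "int \<Rightarrow> form \<Rightarrow> form" where
  "frob_form p \<eta> = fscale ((- 1) powi (p - 1)) (iota_pullback \<eta>)"

text \<open>As an involution, \<open>frob_form p\<close> maps \<open>Bforms X p\<close> onto itself
  and not only into it, as \<open>image_rcls_rsub\<close> requires.\<close>

lemma frob_form_frob_form: "frob_form p (frob_form p \<eta>) = \<eta>"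
proof -
  have "((- 1) powi (p - 1)) * ((- 1) powi (p - 1)) = (1::complex)" by (simp add: powi_neg_one)
  then show ?thesis by (simp add: frob_form_def iota_pullback_fscale fscale_fscale)
qed

lemma frob_form_Zforms: "\<eta> \<in> Zforms X p \<Longrightarrow> frob_form p \<eta> \<in> Zforms X p"
  unfolding Zforms_def mem_Collect_eq frob_form_def
  by (auto intro!: closed_forms_fscale closed_forms_iota_pullback)
    (auto simp: fscale_def iota_pullback_def powi_neg_one fdom_cnj simp del: of_real_minus of_real_1
      intro!: tate_of_real_mult)

lemma frob_form_Bforms: "frob_form p ` Bforms X p = Bforms X p"
proof -
  have 1: "frob_form p \<eta> \<in> Bforms X p" if "\<eta> \<in> Bforms X p" for \<eta>
    using that frob_form_Zforms[of \<eta> X p]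
    by (auto simp: Bforms_def frob_form_def intro: exact_forms_fscale exact_forms_iota_pullback)
  then show ?thesis by (metis (no_types, lifting) frob_form_frob_form image_iff subsetI subset_antisym image_subsetI)
qed

lemma frob_form_add: "frob_form p (\<eta> + \<xi>) = frob_form p \<eta> + frob_form p \<xi>"
  by (simp add: frob_form_def iota_pullback_add fscale_add)

lemma frob_form_scaleR: "frob_form p (r *\<^sub>R \<eta>) = r *\<^sub>R frob_form p \<eta>"
  by (simp add: frob_form_def scaleR_fscale iota_pullback_fscale fscale_fscale mult.commute)

lemma frob_H_class: "frob_H X p (H1_class X p \<eta>) = H1_class X p (frob_form p \<eta>)"
  unfolding frob_H_def H1_class_def frob_form_def[symmetric]
  by (rule image_rcls_rsub) (simp_all add: frob_form_Bforms frob_form_add)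

lemma frob_H_rlinear: "rlinear (H1 X p) (H1 X p) (frob_H X p)"
proof -
  interpret presentation "H1 X p" "Zforms X p" "H1_class X p" by (rule H1_presentation)
  show ?thesis
    unfolding rlinear_def carr
    by (auto simp: frob_H_class radd rscl frob_form_Zforms frob_form_add frob_form_scaleR)
qed

definition tphi :: "schottky \<Rightarrow> int \<Rightarrow> nat \<Rightarrow> form" where
  "tphi X p k = fscale (twopii powi (p - 1)) (phi X k)"

lemma frob_form_tphi:
  assumes "fuchsian_schottky X" "k \<in> letters X"
  shows "frob_form p (tphi X p k) =
    (if k \<le> genus X then (- 1) powi (p - 1) else (- 1) powi p :: real) *\<^sub>R tphi X p k"
  using iota_phi[OF assms]
  by (simp add: frob_form_def tphi_def iota_pullback_fscale fscale_fscale scaleR_fscale powi_neg_one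
      power_int_minus_left)

lemma span_fscale: "fscale c ` span S = span (fscale c ` S)"
  by (rule linear_span_image[symmetric]) (simp add: linear_iff fscale_add fscale_scaleR)

lemma tphi_Zforms_span:
  assumes basis: "rbasis (H1 X 1) (letters X) (\<lambda>k. H1_class X 1 (phi X k))"
  shows "k \<in> letters X \<Longrightarrow> tphi X p k \<in> Zforms X p"
    and "carr (H1 X p) = H1_class X p ` span (tphi X p ` letters X)"
proof -
  interpret H: presentation "H1 X 1" "Zforms X 1" "H1_class X 1" by (rule H1_presentation)
  interpret Hp: presentation "H1 X p" "Zforms X p" "H1_class X p" by (rule H1_presentation)
  \<comment> \<open>The hypothesis \<open>basis\<close> speaks of classes only. The class of
    \<open>phi X k\<close> contains \<open>phi X k\<close> itself and equals the class of some
    closed real-valued form, so the two forms differ by an element of \<open>Bforms X 1\<close>.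
    Hence \<open>phi X k\<close> is itself closed and real-valued.\<close>
  have phi: "phi X k \<in> Zforms X 1" if k: "k \<in> letters X" for k
  proof -
    have "H1_class X 1 (phi X k) \<in> H1_class X 1 ` Zforms X 1"
      using basis k by (auto simp: rbasis_def H.carr)
    then obtain \<eta> where \<eta>: "\<eta> \<in> Zforms X 1" "H1_class X 1 (phi X k) = H1_class X 1 \<eta>" by blast
    have "0 \<in> Bforms X 1" using Bforms_subspace by (rule subspace_0)
    then have "phi X k + 0 \<in> H1_class X 1 (phi X k)"
      unfolding H1_class_def rcls_def rsub_def by (intro CollectI exI[of _ 0]) simp
    then obtain w where "w \<in> Bforms X 1" "phi X k = \<eta> + w"
      unfolding \<eta>(2) by (auto simp: H1_class_def rcls_def rsub_def)
    then show ?thesis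
      using \<eta>(1) Zforms_subspace[of X 1] by (auto simp: Bforms_def intro: subspace_add)
  qed
  have scale: "fscale (twopii powi (p - 1)) ` Zforms X 1 = Zforms X p"
    using fscale_twopii_Zforms[of "p - 1" X 1] by simp
  show "tphi X p k \<in> Zforms X p" if "k \<in> letters X"
    using phi[OF that] unfolding tphi_def scale[symmetric] by (rule imageI)
  have "carr (H1 X 1) = H1_class X 1 ` span (phi X ` letters X)"
    using basis H.rspan_image[of "phi X ` letters X"] phi
    by (auto simp: rbasis_def image_image image_subset_iff)
  moreover have "carr (H1 X p) = twist_H p ` carr (H1 X 1)"
    by (simp add: Hp.carr H.carr image_image twist_H_class flip: scale)
  ultimately show "carr (H1 X p) = H1_class X p ` span (tphi X p ` letters X)"
    by (simp add: image_image twist_H_class tphi_def[abs_def] span_fscale flip: image_image[of _ "fscale _"])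
qed

section \<open>Reduced sequences\<close>

definition cyl :: "schottky \<Rightarrow> nat list \<Rightarrow> seqn set" where
  "cyl X w = {a \<in> splus X. \<forall>i<length w. a i = w ! i}"

definition scons :: "nat \<Rightarrow> seqn \<Rightarrow> seqn" where
  "scons k a = (\<lambda>i. case i of 0 \<Rightarrow> k | Suc j \<Rightarrow> a j)"

text \<open>The first \<open>n + 1\<close> letters, which are those that functions in
  \<open>PC X n\<close> see.\<close>

definition pre :: "nat \<Rightarrow> seqn \<Rightarrow> nat list" where
  "pre n a = map a [0..<Suc n]"

lemma chi_cyl: "chi X w = indicator (cyl X w)"
  by (simp add: chi_def cyl_def)

lemma length_pre [simp]: "length (pre n a) = Suc n"
  by (simp add: pre_def)

lemma pre_nth: "i \<le> n \<Longrightarrow> pre n a ! i = a i"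
  unfolding pre_def by (subst nth_map) (auto simp del: upt_Suc)

lemma pre_eq_iff: "pre n a = pre n b \<longleftrightarrow> (\<forall>i\<le>n. a i = b i)"
  unfolding pre_def by (auto simp del: upt_Suc)

lemma mem_cyl_pre: "b \<in> cyl X (pre n a) \<longleftrightarrow> b \<in> splus X \<and> pre n b = pre n a"
  by (auto simp: cyl_def pre_nth pre_eq_iff less_Suc_eq_le)

lemma cyl_subset: "cyl X w \<subseteq> splus X"
  by (auto simp: cyl_def)

lemma closed_coord: "closed {a :: nat \<Rightarrow> nat. P (a i)}"
proof -
  have "continuous_on UNIV (\<lambda>a :: nat \<Rightarrow> nat. a i)" by (simp add: continuous_on_product_coordinates)
  then have "closed ((\<lambda>a :: nat \<Rightarrow> nat. a i) -` {x. P x})"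
    by (intro closed_vimage) (simp_all add: closed_def open_discrete)
  then show ?thesis by (simp add: vimage_def)
qed

text \<open>A cylinder is cut out of a product of finite alphabets, compact by Tychonoff, by closed
  conditions on coordinates. Compactness passes to the image under the coding map and makes
  \<open>ecyl\<close> Borel.\<close>

lemma compact_cyl: "compact (cyl X w)"
proof -
  have "compactin (product_topology (\<lambda>i::nat. euclidean :: nat topology) UNIV) (PiE UNIV (\<lambda>_. letters X))"
    unfolding compactin_PiE by (auto simp: letters_def intro: finite_imp_compact)
  then have c: "compact (PiE UNIV (\<lambda>_::nat. letters X))"
    by (simp add: euclidean_product_topology)
  \<comment> \<open>The condition on successive letters, read as an implication for each possible
    value \<open>k\<close> of \<open>a i\<close>; this makes it a union of two closed coordinate
    conditions.\<close>
  let ?S = "\<lambda>i k. {a :: nat \<Rightarrow> nat. a i \<noteq> k} \<union> {a. a (Suc i) \<noteq> linv X k}"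
  have "cyl X w = PiE UNIV (\<lambda>_. letters X) \<inter> ((\<Inter>i. \<Inter>k. ?S i k) \<inter> (\<Inter>i\<in>{..<length w}. {a. a i = w ! i}))"
    by (auto simp: cyl_def splus_def PiE_iff)
  moreover have "closed (?S i k)" for i k by (intro closed_Un closed_coord)
  then have "closed ((\<Inter>i. \<Inter>k. ?S i k) \<inter> (\<Inter>i\<in>{..<length w}. {a :: nat \<Rightarrow> nat. a i = w ! i}))"
    by (intro closed_Int closed_INT ballI closed_coord) auto
  ultimately show ?thesis using c by (simp add: compact_Int_closed)
qed

locale schottky_setting =
  fixes X :: schottky
  assumes genus_ge_2: "genus X \<ge> 2"
    and fuchsian: "fuchsian_schottky X"
    and coding_homeo: "coding_homeo X"
    and patterson: "patterson_sullivan X (psm X)"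
begin

abbreviation inv_coding :: "csphere \<Rightarrow> seqn" where
  "inv_coding \<equiv> the_inv_into (splus X) (coding X)"

definition ecyl :: "nat list \<Rightarrow> csphere set" where
  "ecyl w = coding X ` cyl X w"

section \<open>Letters, reduced sequences and the coding map\<close>

lemma linv_letters [simp]: "k \<in> letters X \<Longrightarrow> linv X k \<in> letters X"
  by (auto simp: letters_def linv_def)

lemma linv_linv [simp]: "k \<in> letters X \<Longrightarrow> linv X (linv X k) = k"
  by (auto simp: letters_def linv_def)

lemma linv_neq: "k \<in> letters X \<Longrightarrow> linv X k \<noteq> k"
  using genus_ge_2 by (auto simp: letters_def linv_def)

lemma finite_letters [simp]: "finite (letters X)"
  by (simp add: letters_def)

text \<open>For genus at least 2 the letters 1 and 2 lie in different pairs of inverse letters, so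
  one of them avoids the pair of \<open>k\<close>.\<close>

lemma other_letter:
  assumes "k \<in> letters X"
  shows "\<exists>j\<in>letters X. j \<noteq> k \<and> j \<noteq> linv X k"
proof -
  have "\<exists>j\<in>{1, 2}. j \<noteq> k \<and> j \<noteq> linv X k"
    using genus_ge_2 by (auto simp: linv_def)
  then show ?thesis using genus_ge_2 by (auto simp: letters_def)
qed

lemma const_splus: "k \<in> letters X \<Longrightarrow> (\<lambda>_. k) \<in> splus X"
  using linv_neq[of k] by (auto simp: splus_def)

lemma scons_splus: "k \<in> letters X \<Longrightarrow> a \<in> splus X \<Longrightarrow> a 0 \<noteq> linv X k \<Longrightarrow> scons k a \<in> splus X"
  by (auto simp: splus_def scons_def split: nat.split)

lemma shift_splus: "a \<in> splus X \<Longrightarrow> shift a \<in> splus X"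
  by (auto simp: splus_def shift_def)

lemma coding_tendsto:
  assumes "a \<in> splus X"
  shows "(\<lambda>l. mob (word_mat X (map a [0..<Suc l])) (codept X)) \<longlonglongrightarrow> coding X a"
proof -
  have "convergent (\<lambda>l. mob (word_mat X (map a [0..<Suc l])) (codept X))"
    using coding_homeo assms unfolding coding_homeo_def by blast
  then show ?thesis unfolding coding_def by (rule convergent_LIMSEQ_iff[THEN iffD1])
qed

text \<open>Prepending a letter multiplies each prefix matrix by \<open>gen X k\<close> from the
  left, and the limit passes through the continuous map \<open>mob (gen X k)\<close>.\<close>

lemma coding_scons:
  assumes "k \<in> letters X" "a \<in> splus X" "a 0 \<noteq> linv X k"
  shows "coding X (scons k a) = mob (gen X k) (coding X a)"
proof -
  let ?f = "\<lambda>a l. mob (word_mat X (map a [0..<Suc l])) (codept X)"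
  have "?f (scons k a) (Suc l) = mob (gen X k) (?f a l)" for l
  proof -
    have "[0..<Suc (Suc l)] = 0 # map Suc [0..<Suc l]" by (simp add: map_Suc_upt upt_conv_Cons del: upt_Suc)
    then have "map (scons k a) [0..<Suc (Suc l)] = k # map a [0..<Suc l]"
      by (simp add: scons_def del: upt_Suc)
    moreover have "set (map a [0..<Suc l]) \<subseteq> letters X" using assms by (auto simp: splus_def)
    ultimately show ?thesis
      using assms(1) by (simp add: mob_mult det_gen[OF fuchsian] det_word_mat[OF fuchsian] del: upt_Suc)
  qed
  then have "(\<lambda>l. ?f (scons k a) (Suc l)) \<longlonglongrightarrow> mob (gen X k) (coding X a)"
    using tendsto_mob[OF det_gen[OF fuchsian assms(1)] coding_tendsto[OF assms(2)]] by simp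
  moreover have "(\<lambda>l. ?f (scons k a) (Suc l)) \<longlonglongrightarrow> coding X (scons k a)"
    using coding_tendsto[OF scons_splus[OF assms]] by (rule LIMSEQ_Suc)
  ultimately show ?thesis using LIMSEQ_unique by blast
qed

lemma coding_continuous: "continuous_on (splus X) (coding X)"
  and coding_image: "coding X ` splus X = limit_set X"
  and coding_inj: "inj_on (coding X) (splus X)"
proof -
  obtain h where h: "homeomorphism (splus X) (limit_set X) (coding X) h"
    using coding_homeo by (auto simp: coding_homeo_def)
  then show "continuous_on (splus X) (coding X)" "coding X ` splus X = limit_set X"
    by (auto simp: homeomorphism_def)
  show "inj_on (coding X) (splus X)"
    using h by (intro inj_on_inverseI[of _ h]) (simp add: homeomorphism_def)
qed

lemma inv_coding [simp]: "a \<in> splus X \<Longrightarrow> inv_coding (coding X a) = a"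
  by (rule the_inv_into_f_f[OF coding_inj])

section \<open>Every cylinder has positive mass\<close>

lemma sets_psm [measurable_cong, simp]: "sets (psm X) = sets borel"
  using patterson by (simp add: patterson_sullivan_def)

lemma space_psm [simp]: "space (psm X) = UNIV"
  using sets_eq_imp_space_eq[OF sets_psm] by simp

sublocale finite_measure "psm X"
  by (rule finite_measureI) (use patterson in \<open>simp add: patterson_sullivan_def\<close>)

lemma ecyl_borel [measurable, simp]: "ecyl w \<in> sets borel"
proof -
  have "compact (ecyl w)"
    unfolding ecyl_def
    by (rule compact_continuous_image[OF continuous_on_subset[OF coding_continuous cyl_subset] compact_cyl])
  then show ?thesis by (intro borel_closed compact_imp_closed)
qed

text \<open>A nonempty \<open>w\<close> fixes the first letter of every sequence in its cylinder, so
  that prepending \<open>k\<close> always gives a reduced sequence; then \<open>coding_scons\<close>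
  applies pointwise.\<close>

lemma ecyl_Cons:
  assumes "k \<in> letters X" "w \<noteq> []" "w ! 0 \<noteq> linv X k"
  shows "ecyl (k # w) = mob (gen X k) ` ecyl w"
proof -
  have "cyl X (k # w) = scons k ` cyl X w"
  proof (intro equalityI subsetI)
    fix a assume a: "a \<in> cyl X (k # w)"
    have "a = scons k (shift a)"
      using a by (auto simp: scons_def shift_def cyl_def fun_eq_iff split: nat.split)
    moreover have "shift a i = w ! i" if "i < length w" for i
      using a that by (auto simp: cyl_def shift_def dest: spec[of _ "Suc i"])
    then have "shift a \<in> cyl X w" using a shift_splus by (auto simp: cyl_def)
    ultimately show "a \<in> scons k ` cyl X w" by blast
  next
    fix a assume "a \<in> scons k ` cyl X w"
    then obtain b where b: "b \<in> cyl X w" "a = scons k b" by blast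
    then have "b 0 \<noteq> linv X k" using assms by (auto simp: cyl_def)
    then have "a \<in> splus X" using b assms by (auto simp: cyl_def intro: scons_splus)
    then show "a \<in> cyl X (k # w)"
      using b by (auto simp: cyl_def scons_def nth_Cons split: nat.split)
  qed
  then show ?thesis
    unfolding ecyl_def image_image using assms
    by (simp add: image_image) (rule image_cong[OF refl coding_scons], auto simp: cyl_def)
qed

lemma emeasure_ecyl_Cons:
  assumes "k \<in> letters X" "w \<noteq> []" "w ! 0 \<noteq> linv X k" "emeasure (psm X) (ecyl w) > 0"
  shows "emeasure (psm X) (ecyl (k # w)) > 0"
proof -
  let ?s = "critical_exponent X" and ?A = "gen X k"
  have det: "det ?A = 1" by (rule det_gen[OF fuchsian assms(1)])
  have "emeasure (psm X) (ecyl (k # w))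
      = (\<integral>\<^sup>+x\<in>ecyl w. ennreal (conf_factor ?A x powr ?s) \<partial>psm X)"
    unfolding ecyl_Cons[OF assms(1-3)]
    using patterson gen_in_Gam[OF fuchsian assms(1)] by (simp add: patterson_sullivan_def)
  \<comment> \<open>The density is bounded below on the whole sphere by a positive constant.\<close>
  also have "\<dots> \<ge> (\<integral>\<^sup>+x. ennreal (mat_bound ?A powr - \<bar>?s\<bar>) * indicator (ecyl w) x \<partial>psm X)"
    by (intro nn_integral_mono mult_right_mono ennreal_leI conf_factor_powr_ge det) auto
  also have "(\<integral>\<^sup>+x. ennreal (mat_bound ?A powr - \<bar>?s\<bar>) * indicator (ecyl w) x \<partial>psm X)
      = ennreal (mat_bound ?A powr - \<bar>?s\<bar>) * emeasure (psm X) (ecyl w)"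
    by (rule nn_integral_cmult_indicator) simp
  finally have "ennreal (mat_bound ?A powr - \<bar>?s\<bar>) * emeasure (psm X) (ecyl w)
      \<le> emeasure (psm X) (ecyl (k # w))" .
  moreover have "mat_bound ?A powr - \<bar>?s\<bar> > 0" using mat_bound_ge_1[of ?A] by simp
  ultimately show ?thesis
    using assms(4) by (meson ennreal_zero_less_mult_iff ennreal_less_zero_iff less_le_trans)
qed

lemma ecyl_mono: "ecyl (v @ w) \<subseteq> ecyl v"
  unfolding ecyl_def by (intro image_mono) (auto simp: cyl_def nth_append)

text \<open>The limit set carries the measure and is the union of the one-letter cylinders, so some
  letter \<open>k0\<close> has positive mass. Every \<open>j\<close> other than the inverse of
  \<open>k0\<close> inherits this, because its cylinder contains that of \<open>j\<close> followed
  by \<open>k0\<close>. The inverse of \<open>k0\<close> itself is reached through a letter outside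
  this pair.\<close>

lemma emeasure_ecyl_single:
  assumes "k \<in> letters X"
  shows "emeasure (psm X) (ecyl [k]) > 0"
proof -
  have step: "emeasure (psm X) (ecyl [j]) > 0"
    if "emeasure (psm X) (ecyl [k]) > 0" "j \<in> letters X" "k \<in> letters X" "k \<noteq> linv X j" for j k
  proof -
    have "emeasure (psm X) (ecyl [j, k]) > 0" using that by (intro emeasure_ecyl_Cons[where w = "[k]"]) auto
    also have "emeasure (psm X) (ecyl [j, k]) \<le> emeasure (psm X) (ecyl [j])"
      using ecyl_mono[of "[j]" "[k]"] by (intro emeasure_mono) auto
    finally show ?thesis .
  qed
  have "\<exists>k\<in>letters X. emeasure (psm X) (ecyl [k]) > 0"
  proof (rule ccontr)
    assume *: "\<not> ?thesis"
    have "(\<Union>k\<in>letters X. ecyl [k]) \<in> null_sets (psm X)"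
      using * by (intro null_sets.finite_UN) (auto simp: null_sets_def)
    moreover have "(\<Union>k\<in>letters X. ecyl [k]) = limit_set X"
      unfolding coding_image[symmetric] by (auto simp: ecyl_def cyl_def splus_def)
    ultimately have "AE x in psm X. x \<notin> limit_set X" by (simp add: AE_not_in)
    moreover have "AE x in psm X. x \<in> limit_set X" using patterson by (simp add: patterson_sullivan_def)
    ultimately have "AE x in psm X. False" by eventually_elim simp
    then have "UNIV \<in> null_sets (psm X)" using AE_iff_null[of "psm X" "\<lambda>_. False"] by simp
    then have "emeasure (psm X) (space (psm X)) = 0" by (simp add: null_sets_def)
    then show False using patterson by (simp add: patterson_sullivan_def)
  qed
  then obtain k0 where k0: "k0 \<in> letters X" "emeasure (psm X) (ecyl [k0]) > 0" by blast
  show ?thesis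
  proof (cases "k0 = linv X k")
    case False
    then show ?thesis using step[OF k0(2) assms k0(1)] by simp
  next
    case True
    obtain j where j: "j \<in> letters X" "j \<noteq> k0" "j \<noteq> linv X k0" using other_letter[OF k0(1)] by blast
    then have "k0 \<noteq> linv X j" using linv_linv[of j] k0 by (metis linv_linv)
    then have "emeasure (psm X) (ecyl [j]) > 0" using step[OF k0(2) j(1) k0(1)] by simp
    from step[OF this assms j(1)] show ?thesis using True j assms by simp
  qed
qed

lemma emeasure_ecyl_pos:
  assumes "reduced X w" "w \<noteq> []"
  shows "emeasure (psm X) (ecyl w) > 0"
  using assms
proof (induction w)
  case (Cons k w)
  show ?case
  proof (cases "w = []")
    case True
    then show ?thesis using Cons emeasure_ecyl_single by (simp add: reduced_def)
  next
    case False
    have r: "k \<in> letters X" "set w \<subseteq> letters X" "w ! 0 \<noteq> linv X k" "\<forall>i. Suc i < length w \<longrightarrow> w ! Suc i \<noteq> linv X (w ! i)"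
      using Cons.prems False unfolding reduced_def by (auto dest: spec[of _ 0] spec[of _ "Suc _"])
    then show ?thesis using Cons.IH False by (intro emeasure_ecyl_Cons) (auto simp: reduced_def)
  qed
qed simp

lemma reduced_pre: "a \<in> splus X \<Longrightarrow> reduced X (pre n a)"
  by (auto simp: reduced_def splus_def pre_nth set_conv_nth less_Suc_eq_le)

definition mass :: "nat list \<Rightarrow> real" where
  "mass w = measure (psm X) (ecyl w)"

lemma mass_pos: "reduced X w \<Longrightarrow> w \<noteq> [] \<Longrightarrow> mass w > 0"
  using emeasure_ecyl_pos[of w] by (simp add: mass_def emeasure_eq_measure)

end

section \<open>Orthogonal projections\<close>

lemma cscale_apply: "cscale c f a = c * f a"
  by (simp add: cscale_def)

lemma cscale_cscale: "cscale c (cscale d f) = cscale (c * d) f"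
  by (simp add: cscale_def mult.assoc)

lemma cscale_1 [simp]: "cscale 1 f = f"
  by (simp add: cscale_def)

lemma cscale_0 [simp]: "cscale c 0 = 0"
  by (simp add: cscale_def fun_eq_iff)

lemma cscale_add: "cscale c (f + g) = cscale c f + cscale c g"
  by (simp add: cscale_def fun_eq_iff algebra_simps)

lemma cscale_diff: "cscale c (f - g) = cscale c f - cscale c g"
  by (simp add: cscale_def fun_eq_iff algebra_simps)

lemma scaleR_cscale: "r *\<^sub>R f = cscale (of_real r) f"
  by (simp add: cscale_def scaleR_fun_def fun_eq_iff scaleR_conv_of_real)

lemma sum_fun_apply: "(\<Sum>i\<in>I. f i) a = (\<Sum>i\<in>I. f i a)"
  by (induction I rule: infinite_finite_induct) auto

lemma PC_I:
  assumes "\<And>a. a \<notin> splus X \<Longrightarrow> f a = 0"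
    and "\<And>a b. a \<in> splus X \<Longrightarrow> b \<in> splus X \<Longrightarrow> pre n a = pre n b \<Longrightarrow> f a = f b"
  shows "f \<in> PC X n"
  unfolding PC_def mem_Collect_eq pre_eq_iff[symmetric] using assms by blast

lemma PC_outside: "f \<in> PC X n \<Longrightarrow> a \<notin> splus X \<Longrightarrow> f a = 0"
  unfolding PC_def by blast

lemma PC_cong: "f \<in> PC X n \<Longrightarrow> a \<in> splus X \<Longrightarrow> b \<in> splus X \<Longrightarrow> pre n a = pre n b \<Longrightarrow> f a = f b"
  unfolding PC_def mem_Collect_eq pre_eq_iff[symmetric] by blast

lemma PC_mono:
  assumes "f \<in> PC X m" "m \<le> n"
  shows "f \<in> PC X n"
proof (rule PC_I)
  fix a b assume "a \<in> splus X" "b \<in> splus X" "pre n a = pre n b"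
  with assms show "f a = f b" by (intro PC_cong[OF assms(1)]) (auto simp: pre_eq_iff)
qed (rule PC_outside[OF assms(1)])

lemma PC_0: "0 \<in> PC X n"
  by (simp add: PC_def)

text \<open>The condition \<open>h 0 0 = 0\<close> preserves the convention that functions vanish
  outside \<open>splus X\<close>.\<close>

lemma PC_op:
  assumes "f \<in> PC X n" "g \<in> PC X n" "h 0 0 = 0"
  shows "(\<lambda>a. h (f a) (g a)) \<in> PC X n"
proof (rule PC_I)
  fix a b assume *: "a \<in> splus X" "b \<in> splus X" "pre n a = pre n b"
  show "h (f a) (g a) = h (f b) (g b)"
    using PC_cong[OF assms(1) *] PC_cong[OF assms(2) *] by simp
qed (simp add: PC_outside[OF assms(1)] PC_outside[OF assms(2)] assms(3))

lemma PC_add: "f \<in> PC X n \<Longrightarrow> g \<in> PC X n \<Longrightarrow> f + g \<in> PC X n"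
  using PC_op[of f X n g "(+)"] by (simp add: plus_fun_def)

lemma PC_cscale: "f \<in> PC X n \<Longrightarrow> cscale c f \<in> PC X n"
  using PC_op[of f X n f "\<lambda>x y. c * x"] by (simp add: cscale_def)

lemma PC_diff: "f \<in> PC X n \<Longrightarrow> g \<in> PC X n \<Longrightarrow> f - g \<in> PC X n"
  using PC_op[of f X n g "(-)"] by (simp add: fun_diff_def)

lemma PC_mult: "f \<in> PC X n \<Longrightarrow> q \<in> PC X n \<Longrightarrow> (\<lambda>a. f a * cnj (q a)) \<in> PC X n"
  using PC_op[of f X n q "\<lambda>x y. x * cnj y"] by simp

lemma chi_PC: "length w \<le> Suc n \<Longrightarrow> chi X w \<in> PC X n"
  by (auto simp: PC_def chi_def indicator_def)

text \<open>The complexification of P, on which all projections and all functions of D are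
  computed.\<close>

definition PCinf :: "schottky \<Rightarrow> (seqn \<Rightarrow> complex) set" where
  "PCinf X = (\<Union>n. PC X n)"

lemma PCinfI: "f \<in> PC X n \<Longrightarrow> f \<in> PCinf X"
  by (auto simp: PCinf_def)

lemma PCinf2:
  assumes "f \<in> PCinf X" "g \<in> PCinf X"
  obtains n where "f \<in> PC X n" "g \<in> PC X n"
proof -
  obtain i j where "f \<in> PC X i" "g \<in> PC X j" using assms by (auto simp: PCinf_def)
  then have "f \<in> PC X (max i j)" "g \<in> PC X (max i j)"
    using PC_mono[of f X i "max i j"] PC_mono[of g X j "max i j"] by simp_all
  then show ?thesis by (rule that)
qed

lemma PCinf_0: "0 \<in> PCinf X"
  using PC_0 by (rule PCinfI)

lemma PCinf_add: "f \<in> PCinf X \<Longrightarrow> g \<in> PCinf X \<Longrightarrow> f + g \<in> PCinf X"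
  by (erule PCinf2, assumption, rule PCinfI[OF PC_add])

lemma PCinf_diff: "f \<in> PCinf X \<Longrightarrow> g \<in> PCinf X \<Longrightarrow> f - g \<in> PCinf X"
  by (erule PCinf2, assumption, rule PCinfI[OF PC_diff])

lemma PCinf_mult: "f \<in> PCinf X \<Longrightarrow> g \<in> PCinf X \<Longrightarrow> (\<lambda>a. f a * cnj (g a)) \<in> PCinf X"
  by (erule PCinf2, assumption, rule PCinfI[OF PC_mult])

lemma PCinf_cscale: "f \<in> PCinf X \<Longrightarrow> cscale c f \<in> PCinf X"
  by (auto simp: PCinf_def intro: PC_cscale)

lemma PCinf_subspace: "subspace (PCinf X)"
  by (simp add: subspace_def PCinf_0 PCinf_add scaleR_cscale PCinf_cscale)

lemma chi_PCinf: "chi X w \<in> PCinf X"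
  using chi_PC[of w "length w" X] by (intro PCinfI) simp

context schottky_setting
begin

section \<open>Step functions and their integrals\<close>

definition words :: "nat \<Rightarrow> nat list set" where
  "words n = pre n ` splus X"

lemma finite_words: "finite (words n)"
proof (rule finite_subset)
  show "words n \<subseteq> {w. set w \<subseteq> letters X \<and> length w = Suc n}"
    by (auto simp: words_def splus_def pre_def simp del: upt_Suc)
  show "finite {w. set w \<subseteq> letters X \<and> length w = Suc n}"
    by (rule finite_lists_length_eq) simp
qed

lemma chi_pre: "b \<in> splus X \<Longrightarrow> chi X (pre n a) b = (if pre n b = pre n a then 1 else 0)"
  by (simp add: chi_cyl indicator_def mem_cyl_pre)

definition rep :: "nat \<Rightarrow> nat list \<Rightarrow> seqn" where
  "rep n w = (SOME a. a \<in> splus X \<and> pre n a = w)"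

lemma rep: "w \<in> words n \<Longrightarrow> rep n w \<in> splus X \<and> pre n (rep n w) = w"
proof -
  assume "w \<in> words n"
  then have "\<exists>a. a \<in> splus X \<and> pre n a = w" by (auto simp: words_def)
  from someI_ex[OF this] show ?thesis unfolding rep_def .
qed

lemma PC_eq:
  assumes "f \<in> PC X n"
  shows "f = (\<Sum>w\<in>words n. cscale (f (rep n w)) (chi X w))"
proof
  fix b
  show "f b = (\<Sum>w\<in>words n. cscale (f (rep n w)) (chi X w)) b"
  proof (cases "b \<in> splus X")
    case False
    then show ?thesis
      using PC_outside[OF assms] by (simp add: sum_fun_apply cscale_apply chi_def)
  next
    case True
    have *: "cscale (f (rep n w)) (chi X w) b = (if w = pre n b then f b else 0)" if "w \<in> words n" for w
    proof -
      have r: "rep n w \<in> splus X" "pre n (rep n w) = w" using rep[OF that] by auto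
      have "f (rep n w) = f b" if "w = pre n b"
        using r True that by (intro PC_cong[OF assms]) simp_all
      then show ?thesis using chi_pre[OF True, of n "rep n w"] r(2) by (auto simp: cscale_apply)
    qed
    have "pre n b \<in> words n" using True by (simp add: words_def)
    then show ?thesis by (simp add: sum_fun_apply * finite_words)
  qed
qed

definition intg :: "(seqn \<Rightarrow> complex) \<Rightarrow> complex" where
  "intg f = (LINT x:limit_set X|psm X. f (inv_coding x))"

lemma ip_intg: "ip X f q = intg (\<lambda>a. f a * cnj (q a))"
  by (simp add: ip_def intg_def)

text \<open>This is the integrand of a set integral over the limit set; the indicator hides the
  arbitrary values of \<open>inv_coding\<close> outside its domain.\<close>

lemma chi_inv_coding: "indicator (limit_set X) x *\<^sub>R chi X w (inv_coding x) = indicator (ecyl w) x"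
proof (cases "x \<in> limit_set X")
  case True
  then obtain a where a: "a \<in> splus X" "x = coding X a" using coding_image by blast
  then have "x \<in> ecyl w \<longleftrightarrow> a \<in> cyl X w"
    using inj_on_image_mem_iff[OF coding_inj a(1) cyl_subset] by (simp add: ecyl_def)
  then show ?thesis using a True by (simp add: chi_cyl indicator_def)
next
  case False
  moreover have "ecyl w \<subseteq> limit_set X"
    unfolding ecyl_def coding_image[symmetric] by (intro image_mono cyl_subset)
  ultimately have "x \<notin> ecyl w" by blast
  then show ?thesis using False by simp
qed

lemma set_integrable_chi: "set_integrable (psm X) (limit_set X) (\<lambda>x. chi X w (inv_coding x))"
proof -
  have "integrable (psm X) (\<lambda>x. of_real (indicator (ecyl w) x) :: complex)"
    by (intro integrable_of_real integrable_real_indicator) (auto simp: less_top[symmetric])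
  then show ?thesis
    unfolding set_integrable_def chi_inv_coding
    by (rule back_subst[of "integrable (psm X)"]) (simp add: fun_eq_iff indicator_def)
qed

lemma intg_chi: "intg (chi X w) = of_real (mass w)"
proof -
  have "(\<lambda>x. indicator (ecyl w) x :: complex) = (\<lambda>x. of_real (indicator (ecyl w) x))"
    by (simp add: fun_eq_iff indicator_def)
  then show ?thesis
    unfolding intg_def set_lebesgue_integral_def chi_inv_coding mass_def
    by (simp only: integral_of_real integral_indicator) simp
qed

lemma set_integrable_PC:
  assumes "f \<in> PCinf X"
  shows "set_integrable (psm X) (limit_set X) (\<lambda>x. f (inv_coding x))"
proof -
  obtain n where n: "f \<in> PC X n" using assms by (auto simp: PCinf_def)
  have "f a = (\<Sum>w\<in>words n. f (rep n w) * chi X w a)" for a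
    using fun_cong[OF PC_eq[OF n], of a] unfolding sum_fun_apply cscale_apply .
  then have eq: "(\<lambda>x. f (inv_coding x)) = (\<lambda>x. \<Sum>w\<in>words n. f (rep n w) * chi X w (inv_coding x))"
    by (rule ext)
  show ?thesis
    unfolding eq set_integrable_def scaleR_sum_right
    by (intro Bochner_Integration.integrable_sum set_integrable_mult_right[unfolded set_integrable_def]
        set_integrable_chi[unfolded set_integrable_def])
qed

lemma intg_add: "f \<in> PCinf X \<Longrightarrow> g \<in> PCinf X \<Longrightarrow> intg (f + g) = intg f + intg g"
  unfolding intg_def by (simp add: set_integral_add(2) set_integrable_PC)

lemma intg_cscale: "intg (cscale c f) = c * intg f"
  unfolding intg_def cscale_def by simp

lemma intg_diff: "f \<in> PCinf X \<Longrightarrow> g \<in> PCinf X \<Longrightarrow> intg (f - g) = intg f - intg g"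
  unfolding intg_def by (simp add: set_integral_diff(2) set_integrable_PC)

lemma intg_0 [simp]: "intg 0 = 0"
  by (simp add: intg_def)

lemma intg_sum:
  "finite I \<Longrightarrow> (\<And>i. i \<in> I \<Longrightarrow> f i \<in> PCinf X) \<Longrightarrow> intg (\<Sum>i\<in>I. f i) = (\<Sum>i\<in>I. intg (f i))"
proof (induction I rule: finite_induct)
  case (insert i I)
  have "(\<Sum>i\<in>I. f i) \<in> PCinf X" using insert by (auto intro!: subspace_sum[OF PCinf_subspace])
  then show ?case
    unfolding sum.insert[OF insert(1,2)] using insert by (subst intg_add) auto
qed simp

lemma intg_real:
  assumes "f \<in> PCinf X" "\<And>a. f a \<in> \<real>"
  shows "intg f \<in> \<real>"
proof -
  obtain n where n: "f \<in> PC X n" using assms by (auto simp: PCinf_def)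
  have "intg f = (\<Sum>w\<in>words n. f (rep n w) * of_real (mass w))"
    by (subst PC_eq[OF n]) (simp add: intg_sum finite_words PCinf_cscale chi_PCinf intg_cscale intg_chi)
  also have "\<dots> \<in> \<real>" using assms by (auto intro!: sum_in_Reals)
  finally show ?thesis .
qed

lemma ip_diff: "f \<in> PCinf X \<Longrightarrow> g \<in> PCinf X \<Longrightarrow> q \<in> PCinf X \<Longrightarrow> ip X (f - g) q = ip X f q - ip X g q"
proof -
  assume *: "f \<in> PCinf X" "g \<in> PCinf X" "q \<in> PCinf X"
  have "(\<lambda>a. (f - g) a * cnj (q a)) = (\<lambda>a. f a * cnj (q a)) - (\<lambda>a. g a * cnj (q a))"
    by (simp add: fun_eq_iff algebra_simps)
  then show ?thesis unfolding ip_intg using * by (simp add: intg_diff PCinf_mult)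
qed

lemma ip_add: "f \<in> PCinf X \<Longrightarrow> g \<in> PCinf X \<Longrightarrow> q \<in> PCinf X \<Longrightarrow> ip X (f + g) q = ip X f q + ip X g q"
proof -
  assume *: "f \<in> PCinf X" "g \<in> PCinf X" "q \<in> PCinf X"
  have "(\<lambda>a. (f + g) a * cnj (q a)) = (\<lambda>a. f a * cnj (q a)) + (\<lambda>a. g a * cnj (q a))"
    by (simp add: fun_eq_iff algebra_simps)
  then show ?thesis unfolding ip_intg using * by (simp add: intg_add PCinf_mult)
qed

lemma ip_cscale: "ip X (cscale c f) q = c * ip X f q"
proof -
  have "(\<lambda>a. cscale c f a * cnj (q a)) = cscale c (\<lambda>a. f a * cnj (q a))"
    by (simp add: fun_eq_iff cscale_apply)
  then show ?thesis unfolding ip_intg by (simp add: intg_cscale)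
qed

lemma ip_PC_chi:
  assumes "h \<in> PC X n" "a \<in> splus X"
  shows "ip X h (chi X (pre n a)) = h a * of_real (mass (pre n a))"
proof -
  have "h b * cnj (chi X (pre n a) b) = h a * chi X (pre n a) b" for b
  proof (cases "b \<in> splus X \<and> pre n b = pre n a")
    case True
    then have "h b = h a" using assms by (intro PC_cong[OF assms(1)]) simp_all
    then show ?thesis using True by (simp add: chi_pre)
  next
    case False
    then have "chi X (pre n a) b = 0" by (simp add: chi_cyl mem_cyl_pre)
    then show ?thesis by simp
  qed
  then have "(\<lambda>b. h b * cnj (chi X (pre n a) b)) = cscale (h a) (chi X (pre n a))"
    by (simp add: fun_eq_iff cscale_apply)
  then show ?thesis by (simp add: ip_intg intg_cscale intg_chi)
qed

lemma mass_pre_pos: "a \<in> splus X \<Longrightarrow> mass (pre n a) > 0"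
  using mass_pos[OF reduced_pre[of a n]] by (simp add: pre_def)

text \<open>The conditional expectation in explicit form: the mean of \<open>f\<close> over the
  cylinder of length \<open>n + 1\<close> around \<open>a\<close>.\<close>

definition pavg :: "nat \<Rightarrow> (seqn \<Rightarrow> complex) \<Rightarrow> seqn \<Rightarrow> complex" where
  "pavg n f a = (if a \<in> splus X then ip X f (chi X (pre n a)) / of_real (mass (pre n a)) else 0)"

lemma pavg_PC: "pavg n f \<in> PC X n"
  by (rule PC_I) (simp_all add: pavg_def)

text \<open>Orthogonality is tested on the characteristic functions of cylinders, which span
  \<open>PC X n\<close>. Each test determines \<open>h\<close> on one cylinder because its mass is
  positive; this yields existence and uniqueness for the \<open>THE\<close> in
  \<open>Pi_proj\<close>.\<close>

lemma ip_orth_iff: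
  assumes f: "f \<in> PCinf X" and h: "h \<in> PC X n"
  shows "(\<forall>q\<in>PC X n. ip X (f - h) q = 0) \<longleftrightarrow> h = pavg n f"
proof
  assume *: "\<forall>q\<in>PC X n. ip X (f - h) q = 0"
  show "h = pavg n f"
  proof
    fix a show "h a = pavg n f a"
    proof (cases "a \<in> splus X")
      case True
      have "ip X (f - h) (chi X (pre n a)) = 0" using * chi_PC[of "pre n a" n X] by simp
      then have "ip X f (chi X (pre n a)) = h a * of_real (mass (pre n a))"
        using ip_diff[OF f PCinfI[OF h] chi_PCinf] ip_PC_chi[OF h True] by simp
      then show ?thesis using mass_pre_pos[OF True, of n] True by (simp add: pavg_def)
    next
      case False
      then show ?thesis using PC_outside[OF h] by (simp add: pavg_def)
    qed
  qed
next
  assume h_eq: "h = pavg n f"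
  have 0: "ip X (f - h) (chi X w) = 0" if "w \<in> words n" for w
  proof -
    obtain a where a: "a \<in> splus X" "w = pre n a"
      using \<open>w \<in> words n\<close> by (auto simp: words_def)
    have "h a * of_real (mass w) = ip X f (chi X w)"
      using mass_pre_pos[OF a(1), of n] a by (simp add: h_eq pavg_def)
    then show ?thesis
      using ip_diff[OF f PCinfI[OF h] chi_PCinf] ip_PC_chi[OF h a(1)] a(2) by simp
  qed
  show "\<forall>q\<in>PC X n. ip X (f - h) q = 0"
  proof
    fix q assume q: "q \<in> PC X n"
    have fh: "f - h \<in> PCinf X" using f PCinfI[OF h] by (rule PCinf_diff)
    have "(\<lambda>a. (f - h) a * cnj (q a))
        = (\<Sum>w\<in>words n. cscale (cnj (q (rep n w))) (\<lambda>a. (f - h) a * cnj (chi X w a)))"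
      by (subst PC_eq[OF q])
        (simp add: fun_eq_iff sum_fun_apply cscale_apply sum_distrib_left mult_ac del: minus_apply)
    then have "ip X (f - h) q = (\<Sum>w\<in>words n. cnj (q (rep n w)) * ip X (f - h) (chi X w))"
      unfolding ip_intg
      by (simp only:) (simp add: intg_sum finite_words PCinf_cscale PCinf_mult fh chi_PCinf intg_cscale del: minus_apply)
    then show "ip X (f - h) q = 0" by (simp add: 0)
  qed
qed

lemma Pi_proj_eq:
  assumes "f \<in> PCinf X"
  shows "Pi_proj X n f = pavg n f"
  unfolding Pi_proj_def
proof (rule the_equality)
  show "pavg n f \<in> PC X n \<and> (\<forall>q\<in>PC X n. ip X (f - pavg n f) q = 0)"
    using ip_orth_iff[OF assms pavg_PC] pavg_PC by simp
  show "h = pavg n f" if "h \<in> PC X n \<and> (\<forall>q\<in>PC X n. ip X (f - h) q = 0)" for h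
    using that ip_orth_iff[OF assms, of h n] by blast
qed

section \<open>Algebra of the projections and functions of D\<close>

lemma Pi_proj_PC: "f \<in> PCinf X \<Longrightarrow> Pi_proj X n f \<in> PC X n"
  by (simp add: Pi_proj_eq pavg_PC)

lemma Pi_proj_id:
  assumes "f \<in> PC X n"
  shows "Pi_proj X n f = f"
  using ip_orth_iff[OF PCinfI[OF assms] assms] Pi_proj_eq[OF PCinfI[OF assms]]
  by (simp add: ip_intg zero_fun_def[symmetric] intg_0[unfolded zero_fun_def])

lemma Pi_proj_add:
  assumes "f \<in> PCinf X" "g \<in> PCinf X"
  shows "Pi_proj X n (f + g) = Pi_proj X n f + Pi_proj X n g"
  using assms by (auto simp: Pi_proj_eq PCinf_add pavg_def fun_eq_iff ip_add chi_PCinf add_divide_distrib)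

lemma Pi_proj_cscale: "f \<in> PCinf X \<Longrightarrow> Pi_proj X n (cscale c f) = cscale c (Pi_proj X n f)"
  by (auto simp: Pi_proj_eq PCinf_cscale pavg_def fun_eq_iff ip_cscale cscale_apply)

text \<open>The tower property: functions of fewer letters are among the test functions for
  \<open>n\<close>, so the residual is orthogonal to them as well.\<close>

lemma Pi_proj_Pi_proj:
  assumes f: "f \<in> PCinf X" and mn: "m \<le> n"
  shows "Pi_proj X m (Pi_proj X n f) = Pi_proj X m f"
proof -
  have h: "Pi_proj X n f \<in> PC X n" by (rule Pi_proj_PC[OF f])
  have "ip X (f - Pi_proj X n f) (chi X (pre m a)) = 0" for a
    using ip_orth_iff[OF f h] Pi_proj_eq[OF f] chi_PC[of "pre m a" n X] mn by simp
  then have eq: "ip X (Pi_proj X n f) (chi X (pre m a)) = ip X f (chi X (pre m a))" for a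
    using ip_diff[OF f PCinfI[OF h] chi_PCinf] by simp
  show ?thesis
    unfolding Pi_proj_eq[OF f, of m] Pi_proj_eq[OF PCinfI[OF h], of m] pavg_def eq by (rule refl)
qed

lemma Pi_proj_real:
  assumes "f \<in> PCinf X" "\<And>a. f a \<in> \<real>"
  shows "Pi_proj X n f a \<in> \<real>"
proof -
  have "f b * cnj (chi X (pre n a) b) \<in> \<real>" for b
    using assms(2) by (auto simp: chi_def indicator_def)
  then have "ip X f (chi X (pre n a)) \<in> \<real>"
    unfolding ip_intg using assms(1) by (intro intg_real PCinf_mult chi_PCinf)
  then show ?thesis by (simp add: Pi_proj_eq assms pavg_def)
qed

lemma Pi_hat_PC: "f \<in> PCinf X \<Longrightarrow> Pi_hat X n f \<in> PC X n"
  unfolding Pi_hat_def by (auto intro!: PC_diff Pi_proj_PC elim: PC_mono[OF Pi_proj_PC])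

lemma Pi_hat_add: "f \<in> PCinf X \<Longrightarrow> g \<in> PCinf X \<Longrightarrow> Pi_hat X n (f + g) = Pi_hat X n f + Pi_hat X n g"
  by (simp add: Pi_hat_def Pi_proj_add)

lemma Pi_hat_cscale: "f \<in> PCinf X \<Longrightarrow> Pi_hat X n (cscale c f) = cscale c (Pi_hat X n f)"
  by (simp add: Pi_hat_def Pi_proj_cscale cscale_diff)

lemma Pi_proj_diff:
  "f \<in> PCinf X \<Longrightarrow> g \<in> PCinf X \<Longrightarrow> Pi_proj X n (f - g) = Pi_proj X n f - Pi_proj X n g"
  using Pi_proj_add[of "f - g" g n] PCinf_diff by simp

lemma Pi_hat_eq_0:
  assumes "f \<in> PC X m" "m < n"
  shows "Pi_hat X n f = 0"
  using assms Pi_proj_id[of f n] Pi_proj_id[of f "n - 1"] PC_mono[OF assms(1), of n]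
    PC_mono[OF assms(1), of "n - 1"]
  by (simp add: Pi_hat_def)

lemma Pi_hat_Pi_hat:
  assumes f: "f \<in> PCinf X"
  shows "Pi_hat X m (Pi_hat X n f) = (if m = n then Pi_hat X n f else 0)"
proof (cases "m > n")
  case True
  then show ?thesis using Pi_hat_eq_0[OF Pi_hat_PC[OF f]] by simp
next
  case False
  note inf = Pi_proj_PC[OF f, THEN PCinfI]
  show ?thesis
  proof (cases "n = 0")
    case True
    then show ?thesis using False Pi_proj_id[OF Pi_proj_PC[OF f]] by (simp add: Pi_hat_def)
  next
    case n: False
    \<comment> \<open>For \<open>i < n\<close> the two terms of \<open>Pi_hat X n f\<close> have the
      same projection by the tower property.\<close>
    have *: "Pi_proj X i (Pi_hat X n f) = (if i = n then Pi_hat X n f else 0)" if "i \<le> n" for i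
    proof (cases "i = n")
      case True
      then show ?thesis using Pi_proj_id[OF Pi_hat_PC[OF f]] by simp
    next
      case False
      then show ?thesis
        using that n f by (simp add: Pi_hat_def Pi_proj_diff inf Pi_proj_Pi_proj)
    qed
    have "Pi_hat X m (Pi_hat X n f) = (if m = 0 then Pi_proj X 0 (Pi_hat X n f)
        else Pi_proj X m (Pi_hat X n f) - Pi_proj X (m - 1) (Pi_hat X n f))"
      by (simp add: Pi_hat_def[of X m])
    then show ?thesis using *[of m] *[of "m - 1"] False n by auto
  qed
qed

lemma Pi_hat_real:
  assumes "f \<in> PCinf X" "\<And>a. f a \<in> \<real>"
  shows "Pi_hat X n f a \<in> \<real>"
  using Pi_proj_real[OF assms] by (simp add: Pi_hat_def)

lemma fun_of_D_eq:
  assumes "f \<in> PC X N"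
  shows "fun_of_D X c f = (\<Sum>n\<le>N. cscale (c n) (Pi_hat X n f))"
  unfolding fun_of_D_def
proof (rule sum.mono_neutral_left)
  show "{n. Pi_hat X n f \<noteq> 0} \<subseteq> {..N}"
    using Pi_hat_eq_0[OF assms] by force
qed auto

lemma fun_of_D_add:
  assumes "f \<in> PCinf X" "g \<in> PCinf X"
  shows "fun_of_D X c (f + g) = fun_of_D X c f + fun_of_D X c g"
proof -
  obtain N where N: "f \<in> PC X N" "g \<in> PC X N" using PCinf2[OF assms] .
  then show ?thesis
    by (simp add: fun_of_D_eq[where N = N] PC_add Pi_hat_add assms cscale_add sum.distrib)
qed

lemma fun_of_D_cscale:
  assumes "f \<in> PCinf X"
  shows "fun_of_D X c (cscale b f) = cscale b (fun_of_D X c f)"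
proof -
  obtain N where N: "f \<in> PC X N" using assms by (auto simp: PCinf_def)
  then show ?thesis
    by (simp add: fun_of_D_eq[where N = N] PC_cscale Pi_hat_cscale assms)
      (simp add: fun_eq_iff sum_fun_apply cscale_apply sum_distrib_left mult_ac)
qed

lemma fun_of_D_Pi_hat:
  assumes "f \<in> PCinf X"
  shows "fun_of_D X c (Pi_hat X n f) = cscale (c n) (Pi_hat X n f)"
  using fun_of_D_eq[OF Pi_hat_PC[OF assms, of n]]
  by (simp add: Pi_hat_Pi_hat assms if_distrib[of "cscale _"] cong: if_cong)

end

section \<open>The space V\<close>

lemma sum_double:
  fixes F :: "nat \<Rightarrow> 'b::comm_monoid_add"
  shows "(\<Sum>k\<in>{1..2 * g}. F k) = (\<Sum>k\<in>{1..g}. F k + F (k + g))"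
proof -
  have "(\<Sum>k\<in>{1..g + g}. F k) = (\<Sum>k\<in>{1..g}. F k) + (\<Sum>k\<in>{g+1..g + g}. F k)"
    by (rule sum.ub_add_nat) simp
  also have "(\<Sum>k\<in>{g+1..g + g}. F k) = (\<Sum>k\<in>{1..g}. F (k + g))"
    using sum.shift_bounds_cl_nat_ivl[of F 1 g g] by (simp add: add.commute)
  finally show ?thesis by (simp add: sum.distrib mult_2)
qed

text \<open>Indexed so that the combination with index \<open>k\<close> is the prescribed image of
  the form \<open>phi X k\<close>. The vectors \<open>e\<close> will be twisted generators of V,
  untwisted ones, or representatives of classes.\<close>

definition half :: "nat \<Rightarrow> (nat \<Rightarrow> 'b::real_vector) \<Rightarrow> nat \<Rightarrow> 'b" where
  "half g e k = (if k \<le> g then (1/2) *\<^sub>R (e k - e (k + g)) else (1/2) *\<^sub>R (e (k - g) + e k))"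

lemma double_cases:
  assumes "k \<in> {1..2 * g :: nat}"
  obtains "k \<in> {1..g}" | j where "j \<in> {1..g}" "k = j + g"
proof (cases "k \<le> g")
  case True
  with assms that(1) show thesis by simp
next
  case False
  with assms that(2)[of "k - g"] show thesis by simp
qed

lemma half_simps:
  assumes "k \<in> {1..g}"
  shows "half g e k = (1/2) *\<^sub>R (e k - e (k + g))" "half g e (k + g) = (1/2) *\<^sub>R (e k + e (k + g))"
  using assms by (auto simp: half_def)

text \<open>The base change is invertible: the sum and the difference of two partners give back the
  vectors \<open>e\<close>.\<close>

lemma span_half: "span (half g e ` {1..2 * g}) = span (e ` {1..2 * g})"
proof (subst span_eq, intro conjI image_subsetI)
  fix k assume "k \<in> {1..2 * g}"
  moreover have e: "e j \<in> span (e ` {1..2 * g})" if "j \<in> {1..2 * g}" for j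
    using that by (intro span_base imageI)
  ultimately show "half g e k \<in> span (e ` {1..2 * g})"
    by (cases rule: double_cases) (auto simp: half_simps intro!: span_scale span_diff span_add e)
next
  fix k assume k: "k \<in> {1..2 * g}"
  have h: "half g e j \<in> span (half g e ` {1..2 * g})" if "j \<in> {1..2 * g}" for j
    using that by (intro span_base imageI)
  have eq: "x = (1/2) *\<^sub>R (x - y) + (1/2) *\<^sub>R (x + y)" "y = (1/2) *\<^sub>R (x + y) - (1/2) *\<^sub>R (x - y)" for x y :: 'a
    by (simp_all add: scaleR_2[symmetric] flip: scaleR_add_right scaleR_diff_right)
  from k show "e k \<in> span (half g e ` {1..2 * g})"
  proof (cases rule: double_cases)
    case 1
    have "e k = half g e k + half g e (k + g)" unfolding half_simps[OF 1] by (rule eq)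
    moreover have "half g e k + half g e (k + g) \<in> span (half g e ` {1..2 * g})"
      using 1 by (intro span_add h) auto
    ultimately show ?thesis by (rule ssubst)
  next
    case (2 j)
    have "e k = half g e (j + g) - half g e j" unfolding half_simps[OF 2(1)] 2(2) by (rule eq)
    moreover have "half g e (j + g) - half g e j \<in> span (half g e ` {1..2 * g})"
      using 2 by (intro span_diff h) auto
    ultimately show ?thesis by (rule ssubst)
  qed
qed

lemma sum_half:
  "(\<Sum>k\<in>{1..2 * g}. c k *\<^sub>R half g e k) =
   (\<Sum>k\<in>{1..2 * g}. (if k \<le> g then (c k + c (k + g)) / 2 else (c k - c (k - g)) / 2) *\<^sub>R e k)"
proof -
  have "c *\<^sub>R ((1/2) *\<^sub>R (x - y)) + d *\<^sub>R ((1/2) *\<^sub>R (x + y)) = ((c + d) / 2) *\<^sub>R x + ((d - c) / 2) *\<^sub>R y"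
    for c d :: real and x y :: 'a
    by (simp add: add_divide_distrib diff_divide_distrib scaleR_add_left scaleR_diff_left
        scaleR_add_right scaleR_diff_right)
  then show ?thesis
    unfolding sum_double by (intro sum.cong refl) (simp add: half_def)
qed

text \<open>\<open>K\<close> is the zero space for functions and the kernel of a class map for
  \<open>Gr\<close>, so one argument serves both. By \<open>sum_half\<close> the coefficients change
  by an invertible linear map.\<close>

lemma half_indep:
  assumes "\<And>c k. (\<Sum>k\<in>{1..2 * g}. c k *\<^sub>R e k) \<in> K \<Longrightarrow> k \<in> {1..2 * g} \<Longrightarrow> c k = 0"
    and "(\<Sum>k\<in>{1..2 * g}. c k *\<^sub>R half g e k) \<in> K" "k \<in> {1..2 * g}"
  shows "c k = 0"
proof -
  have *: "(if k \<le> g then (c k + c (k + g)) / 2 else (c k - c (k - g)) / 2) = 0" if "k \<in> {1..2 * g}" for k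
    using assms(1)[OF assms(2)[unfolded sum_half] that] .
  show ?thesis
  proof (cases "k \<le> g")
    case True
    then show ?thesis using *[of k] *[of "k + g"] assms(3) by auto
  next
    case False
    then obtain j where j: "k = j + g" "j \<ge> 1" by (metis add.commute le_add_diff_inverse less_imp_add_positive not_le One_nat_def Suc_leI)
    then show ?thesis using *[of k] *[of j] assms(3) by auto
  qed
qed

text \<open>An exchange of two vectors has their difference and their sum as eigenvectors. Linearity
  is asked only for the combinations that occur, since \<open>frob_V X\<close> is known to be linear
  only on \<open>Vtot X\<close>.\<close>

lemma half_swap:
  assumes k: "k \<in> {1..2 * g}"
    and swap: "\<And>j. j \<in> {1..g} \<Longrightarrow> f (e j) = t *\<^sub>R e (j + g)"
      "\<And>j. j \<in> {1..g} \<Longrightarrow> f (e (j + g)) = t *\<^sub>R e j"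
    and lin: "\<And>j r s. j \<in> {1..g} \<Longrightarrow>
      f (r *\<^sub>R (e j + s *\<^sub>R e (j + g))) = r *\<^sub>R (f (e j) + s *\<^sub>R f (e (j + g)))"
  shows "f (half g e k) = (if k \<le> g then - t else t) *\<^sub>R half g e k"
  using k
proof (cases rule: double_cases)
  case 1
  have "f (half g e k) = (1/2) *\<^sub>R (f (e k) + (- 1) *\<^sub>R f (e (k + g)))"
    unfolding half_simps[OF 1] using lin[OF 1, of "1/2" "- 1"] by simp
  then show ?thesis
    unfolding swap[OF 1] half_simps[OF 1] using 1 by (simp add: algebra_simps)
next
  case (2 j)
  have "f (half g e (j + g)) = (1/2) *\<^sub>R (f (e j) + 1 *\<^sub>R f (e (j + g)))"
    unfolding half_simps[OF 2(1)] using lin[OF 2(1), of "1/2" 1] by simp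
  then show ?thesis
    unfolding 2(2) swap[OF 2(1)] half_simps[OF 2(1)] using 2(1) by (simp add: algebra_simps)
qed

section \<open>From the graded pieces to the total space\<close>

lemma sum_map_eq:
  assumes "x \<in> carr (rdsum {..0} A)" "\<And>p. p \<le> 0 \<Longrightarrow> f p (rzero (A p)) = 0"
    and "finite P" "P \<subseteq> {..0}" "{p \<in> {..0}. x p \<noteq> rzero (A p)} \<subseteq> P"
  shows "sum_map f x = (\<Sum>p\<in>P. f p (x p))"
  unfolding sum_map_def
proof (rule sum.mono_neutral_left[OF assms(3)])
  \<comment> \<open>\<open>sum_map\<close> adds over a set depending on \<open>x\<close>; enlarging
    it to a given finite \<open>P\<close> allows the sums for different arguments to be
    compared.\<close>
  show "{p. p \<le> 0 \<and> f p (x p) \<noteq> 0} \<subseteq> P"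
  proof
    fix p assume "p \<in> {p. p \<le> 0 \<and> f p (x p) \<noteq> 0}"
    then have "p \<in> {p \<in> {..0}. x p \<noteq> rzero (A p)}" using assms(2)[of p] by (auto intro: ccontr)
    then show "p \<in> P" using assms(5) by blast
  qed
  show "\<forall>p\<in>P - {p. p \<le> 0 \<and> f p (x p) \<noteq> 0}. f p (x p) = 0" using assms(4) by blast
qed

text \<open>The operators \<open>Q p\<close> recover the component of degree \<open>p\<close> from
  the total, so the sum of the spaces \<open>S p\<close> is direct. In the application they are the
  projections \<open>Pi_hat X (nat (- p))\<close>, and \<open>T\<close> is a subspace on which these
  are additive.\<close>

lemma sum_map_riso:
  fixes f :: "int \<Rightarrow> 'a \<Rightarrow> 'b::real_vector"
  assumes A: "\<And>p. p \<le> 0 \<Longrightarrow> presentation (A p) (V p) (\<pi> p)"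
    and S: "\<And>p. p \<le> 0 \<Longrightarrow> subspace (S p)"
    and f: "\<And>p. p \<le> 0 \<Longrightarrow> riso (A p) (rsub (S p)) (f p)"
    and T: "subspace T" "\<And>p. p \<le> 0 \<Longrightarrow> S p \<subseteq> T"
    and Q_add: "\<And>p y z. y \<in> T \<Longrightarrow> z \<in> T \<Longrightarrow> Q p (y + z) = Q p y + Q p z"
    and Q: "\<And>p q y. p \<le> 0 \<Longrightarrow> q \<le> 0 \<Longrightarrow> y \<in> S q \<Longrightarrow> Q p y = (if p = q then y else 0)"
  shows "riso (rdsum {..0} A) (rsub (span (\<Union>p\<in>{..0}. S p))) (sum_map f)"
proof -
  let ?D = "rdsum {..0} A" and ?V = "span (\<Union>p\<in>{..0}. S p)"
  let ?supp = "\<lambda>x. {p \<in> {..0}. x p \<noteq> rzero (A p)}"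
  have f0: "f p (rzero (A p)) = 0" if "p \<le> 0" for p
    using rlinear_zero[OF A[OF that] presentation_rsub[OF S[OF that]], of "f p"] f[OF that]
    by (simp add: riso_def rsub_def)
  have fS: "f p (x p) \<in> S p" if "x \<in> carr ?D" "p \<le> 0" for x p
    using that f[OF that(2)] by (auto simp: riso_def rlinear_def rsub_def rdsum_def PiE_iff)
  have fin: "finite (?supp x)" if "x \<in> carr ?D" for x using that by (simp add: rdsum_def)
  have sm: "sum_map f x = (\<Sum>p\<in>P. f p (x p))"
    if "x \<in> carr ?D" "finite P" "P \<subseteq> {..0}" "?supp x \<subseteq> P" for x P
    by (rule sum_map_eq[where A = A]) (use that f0 in auto)
  have add_closed: "radd ?D x y \<in> carr ?D" and supp_add: "?supp (radd ?D x y) \<subseteq> ?supp x \<union> ?supp y"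
    if xy: "x \<in> carr ?D" "y \<in> carr ?D" for x y
  proof -
    show s: "?supp (radd ?D x y) \<subseteq> ?supp x \<union> ?supp y"
      using presentation.radd_rzero[OF A] by (auto simp: rdsum_def)
    have "finite (?supp (radd ?D x y))"
      using finite_subset[OF s] fin xy by blast
    moreover have "radd ?D x y \<in> Pi\<^sub>E {..0} (\<lambda>p. carr (A p))"
      using xy presentation.radd_closed[OF A] by (auto simp: rdsum_def PiE_iff)
    ultimately show "radd ?D x y \<in> carr ?D" by (simp add: rdsum_def)
  qed
  have scl_closed: "rscl ?D r x \<in> carr ?D" and supp_scl: "?supp (rscl ?D r x) \<subseteq> ?supp x"
    if x: "x \<in> carr ?D" for x r
  proof -
    show s: "?supp (rscl ?D r x) \<subseteq> ?supp x"
      using presentation.rscl_rzero[OF A] by (auto simp: rdsum_def)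
    have "finite (?supp (rscl ?D r x))"
      using finite_subset[OF s] fin x by blast
    moreover have "rscl ?D r x \<in> Pi\<^sub>E {..0} (\<lambda>p. carr (A p))"
      using x presentation.rscl_closed[OF A] by (auto simp: rdsum_def PiE_iff)
    ultimately show "rscl ?D r x \<in> carr ?D" by (simp add: rdsum_def)
  qed
  have add: "sum_map f (radd ?D x y) = sum_map f x + sum_map f y"
    if xy: "x \<in> carr ?D" "y \<in> carr ?D" for x y
  proof -
    let ?P = "?supp x \<union> ?supp y"
    have P: "finite ?P" "?P \<subseteq> {..0}" using fin xy by auto
    have "f p (radd ?D x y p) = f p (x p) + f p (y p)" if "p \<in> ?P" for p
    proof -
      have "p \<le> 0" using that by auto
      then show ?thesis
        using xy f[of p] by (auto simp: rdsum_def PiE_iff riso_def rlinear_def rsub_def)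
    qed
    then show ?thesis
      using sm[OF add_closed[OF xy] P supp_add[OF xy]] sm[OF xy(1) P] sm[OF xy(2) P]
      by (simp add: sum.distrib)
  qed
  have scl: "sum_map f (rscl ?D r x) = r *\<^sub>R sum_map f x" if x: "x \<in> carr ?D" for x r
  proof -
    have P: "finite (?supp x)" "?supp x \<subseteq> {..0}" using fin x by auto
    have "f p (rscl ?D r x p) = r *\<^sub>R f p (x p)" if "p \<in> ?supp x" for p
    proof -
      have "p \<le> 0" using that by auto
      then show ?thesis
        using x f[of p] by (auto simp: rdsum_def PiE_iff riso_def rlinear_def rsub_def)
    qed
    then show ?thesis
      using sm[OF scl_closed[OF x] P supp_scl[OF x]] sm[OF x P]
      by (simp add: scaleR_sum_right)
  qed
  have into: "sum_map f x \<in> ?V" if x: "x \<in> carr ?D" for x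
  proof -
    have "sum_map f x = (\<Sum>p\<in>?supp x. f p (x p))" using sm[OF x fin[OF x]] by blast
    moreover have "f p (x p) \<in> ?V" if "p \<in> ?supp x" for p
      using fS[OF x] that by (intro span_base) auto
    ultimately show ?thesis by (simp only: span_sum)
  qed
  have Q0: "Q p 0 = 0" for p using Q_add[of 0 0 p] T(1) by (simp add: subspace_0)
  have Q_sum: "Q p (\<Sum>i\<in>P. y i) = (\<Sum>i\<in>P. Q p (y i))" if "finite P" "\<And>i. i \<in> P \<Longrightarrow> y i \<in> T" for P y p
    using that
  proof (induction P rule: finite_induct)
    case (insert i P)
    then show ?case using subspace_sum[OF T(1), of P y] by (simp add: Q_add)
  qed (simp add: Q0)
  have comp: "Q p (sum_map f x) = f p (x p)" if x: "x \<in> carr ?D" and p: "p \<le> 0" for x p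
  proof -
    let ?P = "insert p (?supp x)"
    have P: "finite ?P" "?P \<subseteq> {..0}" "?supp x \<subseteq> ?P" using fin[OF x] p by auto
    have "Q p (sum_map f x) = (\<Sum>q\<in>?P. Q p (f q (x q)))"
      unfolding sm[OF x P] using fS[OF x] T(2) P(2) by (intro Q_sum P) auto
    also have "\<dots> = (\<Sum>q\<in>?P. if q = p then f p (x p) else 0)"
      using fS[OF x] P(2) p Q by (intro sum.cong refl) auto
    finally show ?thesis using P(1) by simp
  qed
  have inj: "inj_on (sum_map f) (carr ?D)"
  proof
    fix x y assume x: "x \<in> carr ?D" and y: "y \<in> carr ?D" and eq: "sum_map f x = sum_map f y"
    show "x = y"
    proof
      fix p show "x p = y p"
      proof (cases "p \<le> 0")
        case True
        have "f p (x p) = f p (y p)" using comp[OF x True] comp[OF y True] eq by simp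
        then show ?thesis
          using f[OF True] x y True by (auto simp: riso_def bij_betw_def inj_on_def rdsum_def PiE_iff)
      next
        case False
        with x y show ?thesis by (auto simp: rdsum_def PiE_iff extensional_def)
      qed
    qed
  qed
  have zero: "(\<lambda>p\<in>{..0}. rzero (A p)) \<in> carr ?D"
    using presentation.rzero_closed[OF A] by (simp add: rdsum_def)
  have surj: "v \<in> sum_map f ` carr ?D" if "v \<in> ?V" for v
    using that
  proof (induction rule: span_induct_alt)
    case base
    have "sum_map f (\<lambda>p\<in>{..0}. rzero (A p)) = 0"
      using sm[OF zero, of "{}"] by auto
    with zero show ?case by (metis imageI)
  next
    case (step r y z)
    then obtain p where p: "p \<le> 0" "y \<in> S p" by auto
    have "y \<in> f p ` carr (A p)"
      using f[OF p(1)] p(2) by (simp add: riso_def bij_betw_def rsub_def)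
    then obtain y' where y': "y' \<in> carr (A p)" "f p y' = y" by blast
    define x where "x = (\<lambda>q\<in>{..0}. if q = p then y' else rzero (A q))"
    have supp: "?supp x \<subseteq> {p}" by (auto simp: x_def)
    then have "finite (?supp x)" by (rule finite_subset) simp
    then have x: "x \<in> carr ?D"
      using y'(1) presentation.rzero_closed[OF A] by (auto simp: rdsum_def x_def)
    have fx: "sum_map f x = y" using sm[OF x, of "{p}"] supp p y' by (simp add: x_def)
    from step obtain x' where x': "x' \<in> carr ?D" "sum_map f x' = z" by blast
    have "sum_map f (radd ?D (rscl ?D r x) x') = r *\<^sub>R y + z"
      using x x' fx by (simp add: add scl scl_closed)
    moreover have "radd ?D (rscl ?D r x) x' \<in> carr ?D" using x x' by (simp add: add_closed scl_closed)
    ultimately show ?case by (metis imageI)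
  qed
  have "sum_map f ` carr ?D = ?V" using into surj by blast
  then show ?thesis
    unfolding riso_def bij_betw_def rlinear_def rsub_def rspace.simps
    using add scl inj by simp
qed

lemma neg_one_powi: "p \<le> 0 \<Longrightarrow> ((- 1) ^ nat (- p) :: real) = (- 1) powi p"
  by (auto simp: power_int_def power_inverse[symmetric])

context schottky_setting
begin

section \<open>The generators of V and their independence\<close>

lemma letters_eq: "letters X = {1..2 * genus X}"
  by (simp add: letters_def)

lemma wnk_Suc: "p \<le> 0 \<Longrightarrow> wnk (nat (- p + 1)) k = wnk (Suc (nat (- p))) k"
  by (simp add: Suc_nat_eq_nat_zadd1 add.commute)

lemma pre_const: "pre n (\<lambda>_. k) = wnk (Suc n) k"
  by (simp add: pre_def wnk_def map_replicate_const del: upt_Suc)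

lemma chi_wnk: "chi X (wnk n k) a = (if a \<in> splus X \<and> (\<forall>i<n. a i = k) then 1 else 0)"
  by (auto simp: chi_def wnk_def indicator_def)

lemma chi_wnk_const: "j \<in> letters X \<Longrightarrow> chi X (wnk (Suc n) k) (\<lambda>_. j) = (if j = k then 1 else 0)"
  using const_splus[of j] by (auto simp: chi_wnk)

text \<open>The cylinder of the shorter word also contains the disjoint cylinder of that word
  followed by a letter \<open>l\<close> outside the pair of \<open>k\<close>, and this has positive
  mass.\<close>

lemma mass_wnk_less:
  assumes k: "k \<in> letters X"
  shows "mass (wnk (Suc (Suc n)) k) < mass (wnk (Suc n) k)"
proof -
  obtain l where l: "l \<in> letters X" "l \<noteq> k" "l \<noteq> linv X k" using other_letter[OF k] by blast
  let ?w = "wnk (Suc n) k" and ?v = "wnk (Suc n) k @ [l]"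
  have eq: "wnk (Suc (Suc n)) k = ?w @ [k]"
    by (simp add: wnk_def replicate_append_same)
  have "reduced X ?v"
    using k l linv_neq[OF k] by (auto simp: reduced_def wnk_def nth_append nth_Cons split: nat.split)
  then have pos: "mass ?v > 0" by (intro mass_pos) auto
  have "a (Suc n) = x" if "a \<in> cyl X (?w @ [x])" for a x
    using that by (auto simp: cyl_def wnk_def nth_append dest!: spec[of _ "Suc n"])
  then have "cyl X (?w @ [k]) \<inter> cyl X ?v = {}"
    using l(2) by blast
  then have disj: "ecyl (?w @ [k]) \<inter> ecyl ?v = {}"
    unfolding ecyl_def using inj_on_image_Int[OF coding_inj cyl_subset cyl_subset] by (metis image_empty)
  have "mass (?w @ [k]) + mass ?v = measure (psm X) (ecyl (?w @ [k]) \<union> ecyl ?v)"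
    unfolding mass_def by (rule finite_measure_Union[symmetric]) (use disj in auto)
  also have "\<dots> \<le> mass ?w"
    unfolding mass_def by (intro finite_measure_mono Un_least ecyl_mono) auto
  finally show ?thesis using pos unfolding eq by simp
qed

lemma Pi_hat_chi_const:
  assumes k: "k \<in> letters X" and j: "j \<in> letters X"
  shows "Pi_hat X n (chi X (wnk (Suc n) k)) (\<lambda>_. j) = 0 \<longleftrightarrow> j \<noteq> k"
proof -
  have PC: "chi X (wnk (Suc n) k) \<in> PC X n" by (rule chi_PC) (simp add: wnk_def)
  show ?thesis
  proof (cases n)
    case 0
    then show ?thesis using Pi_proj_id[OF PC] chi_wnk_const[OF j] by (simp add: Pi_hat_def)
  next
    case (Suc m)
    \<comment> \<open>The cylinder of k^(n+1) lies in that of k^n and is disjoint from that of j^n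
      for \<open>j \<noteq> k\<close>. Here \<open>n\<close> is positive, so that these words are
      not empty.\<close>
    have "chi X (wnk (Suc n) k) a * cnj (chi X (wnk (Suc m) j) a)
        = (if j = k then chi X (wnk (Suc n) k) a else 0)" for a
    proof (cases "a \<in> splus X \<and> (\<forall>i<Suc n. a i = k)")
      case True
      then have "a 0 = k" "\<forall>i<Suc m. a i = k" by (simp_all add: Suc)
      then show ?thesis using True by (auto simp: chi_wnk)
    next
      case False
      then have "chi X (wnk (Suc n) k) a = 0" unfolding chi_wnk by (rule if_not_P)
      then show ?thesis by simp
    qed
    then have "ip X (chi X (wnk (Suc n) k)) (chi X (wnk (Suc m) j))
        = (if j = k then of_real (mass (wnk (Suc n) k)) else 0)"
      using intg_chi[of "wnk (Suc n) k"] intg_0[unfolded zero_fun_def] by (simp add: ip_intg)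
    then have "Pi_proj X m (chi X (wnk (Suc n) k)) (\<lambda>_. j)
        = (if j = k then of_real (mass (wnk (Suc n) k) / mass (wnk (Suc m) k)) else 0)"
      by (auto simp: Pi_proj_eq[OF chi_PCinf] pavg_def const_splus[OF j] pre_const)
    \<comment> \<open>The conditional probability of the longer word given the shorter one: at the
      constant sequence of \<open>k\<close> the projected function takes this value, and the
      function itself the value 1.\<close>
    moreover have "mass (wnk (Suc n) k) / mass (wnk (Suc m) k) < 1"
      using mass_wnk_less[OF k, of m] le_less_trans[OF _ mass_wnk_less[OF k, of m], of 0]
      unfolding Suc by (simp add: mass_def divide_less_eq_1)
    then have "of_real (mass (wnk (Suc n) k) / mass (wnk (Suc m) k)) \<noteq> (1 :: complex)"
      by (metis less_irrefl of_real_eq_1_iff)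
    ultimately show ?thesis
      using Pi_proj_id[OF PC] chi_wnk_const[OF j, of n k] Suc by (auto simp: Pi_hat_def)
  qed
qed

text \<open>The eigenspace of D for the eigenvalue \<open>n\<close>, on which every
  \<open>fun_of_D X c\<close> acts as the scalar \<open>c n\<close>.\<close>

definition homog :: "nat \<Rightarrow> (seqn \<Rightarrow> complex) set" where
  "homog n = {f \<in> PCinf X. Pi_hat X n f = f}"

lemma homog_PCinf: "f \<in> homog n \<Longrightarrow> f \<in> PCinf X"
  by (simp add: homog_def)

lemma homog_cscale: "f \<in> homog n \<Longrightarrow> cscale c f \<in> homog n"
  by (simp add: homog_def PCinf_cscale Pi_hat_cscale)

lemma Pi_hat_0: "Pi_hat X n 0 = 0"
  using Pi_hat_cscale[OF PCinf_0, of n 0] by (simp add: cscale_def zero_fun_def)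

lemma homog_subspace: "subspace (homog n)"
  by (simp add: subspace_def scaleR_cscale homog_cscale)
    (simp add: homog_def PCinf_0 PCinf_add Pi_hat_add Pi_hat_0)

lemma Pi_hat_homog: "f \<in> homog n \<Longrightarrow> Pi_hat X m f = (if m = n then f else 0)"
  using Pi_hat_Pi_hat[of f m n] by (simp add: homog_def)

lemma fun_of_D_homog: "f \<in> homog n \<Longrightarrow> fun_of_D X c f = cscale (c n) f"
  using fun_of_D_Pi_hat[of f c n] by (simp add: homog_def)

lemma v_untw_homog: "v_untw X p k \<in> homog (nat (- p))"
  by (simp add: v_untw_def homog_def Pi_hat_Pi_hat chi_PCinf PCinfI[OF Pi_hat_PC])

lemma v_gen_homog: "v_gen X p k \<in> homog (nat (- p))"
  by (simp add: v_gen_def v_untw_homog homog_cscale)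

lemma span_v_gen_homog: "span (v_gen X p ` letters X) \<subseteq> homog (nat (- p))"
  using v_gen_homog by (intro span_minimal homog_subspace) auto

lemma span_v_untw_homog: "span (v_untw X p ` letters X) \<subseteq> homog (nat (- p))"
  using v_untw_homog by (intro span_minimal homog_subspace) auto

lemma v_gen_const:
  assumes "p \<le> 0" "k \<in> letters X" "j \<in> letters X"
  shows "v_gen X p k (\<lambda>_. j) = 0 \<longleftrightarrow> j \<noteq> k"
  using Pi_hat_chi_const[OF assms(2,3), of "nat (- p)"]
  unfolding v_gen_def v_untw_def cscale_apply wnk_Suc[OF assms(1)] by simp

lemma v_gen_indep:
  assumes "p \<le> 0" "(\<Sum>k\<in>letters X. c k *\<^sub>R v_gen X p k) = 0" "k \<in> letters X"
  shows "c k = 0"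
proof -
  have "(\<Sum>j\<in>letters X. c j *\<^sub>R v_gen X p j) (\<lambda>_. k) = (\<Sum>j\<in>letters X. if j = k then c k *\<^sub>R v_gen X p k (\<lambda>_. k) else 0)"
    unfolding sum_fun_apply using v_gen_const[OF assms(1) _ assms(3)]
    by (intro sum.cong refl) (auto simp: scaleR_fun_def)
  then show ?thesis using assms v_gen_const[OF assms(1,3,3)] by simp
qed

lemma Vtot_PCinf: "carr (Vtot X) \<subseteq> PCinf X"
  unfolding Vtot_def rsub_def rspace.simps
  using homog_PCinf[OF v_gen_homog] by (intro span_minimal PCinf_subspace) auto

lemma Vtot_span: "Vtot X = rsub (span (\<Union>p\<in>{..0}. span (v_gen X p ` letters X)))"
proof -
  have "span (\<Union>p\<in>{..0}. span (v_gen X p ` letters X)) = span (\<Union>p\<in>{..0}. v_gen X p ` letters X)"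
  proof (subst span_eq, intro conjI)
    show "(\<Union>p\<in>{..0}. span (v_gen X p ` letters X)) \<subseteq> span (\<Union>p\<in>{..0}. v_gen X p ` letters X)"
      by (intro UN_least span_mono) auto
    show "(\<Union>p\<in>{..0}. v_gen X p ` letters X) \<subseteq> span (\<Union>p\<in>{..0}. span (v_gen X p ` letters X))"
      by (auto intro!: span_base)
  qed
  then show ?thesis by (simp add: Vtot_def)
qed

lemma grV_sub_Vtot: "p \<le> 0 \<Longrightarrow> carr (grV X p) \<subseteq> carr (Vtot X)"
  unfolding grV_def Vtot_def rsub_def by simp (intro span_mono, auto)

lemma Vtot_presentation: "presentation (Vtot X) (carr (Vtot X)) (\<lambda>x. x)"
  unfolding Vtot_def by (simp add: rsub_def) (rule presentation_rsub[unfolded rsub_def], simp)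

lemma grV_presentation: "presentation (grV X p) (carr (grV X p)) (\<lambda>x. x)"
  unfolding grV_def by (simp add: rsub_def) (rule presentation_rsub[unfolded rsub_def], simp)

lemma Pi_hat_sum:
  "finite I \<Longrightarrow> (\<And>i. i \<in> I \<Longrightarrow> f i \<in> PCinf X) \<Longrightarrow> Pi_hat X n (\<Sum>i\<in>I. f i) = (\<Sum>i\<in>I. Pi_hat X n (f i))"
proof (induction I rule: finite_induct)
  case (insert i I)
  have "(\<Sum>i\<in>I. f i) \<in> PCinf X" using insert by (auto intro!: subspace_sum[OF PCinf_subspace])
  then show ?case
    unfolding sum.insert[OF insert(1,2)] using insert by (subst Pi_hat_add) auto
qed (simp add: Pi_hat_0)

text \<open>Projecting to a degree before evaluating at a constant sequence separates the generators
  of all degrees at once; up to normalization this is a dual system.\<close>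

lemma dual_functional:
  assumes "p \<le> 0" "q \<le> 0" "k \<in> letters X" "j \<in> letters X"
  shows "Pi_hat X (nat (- p)) (v_gen X q j) (\<lambda>_. k) = 0 \<longleftrightarrow> (q, j) \<noteq> (p, k)"
proof (cases "p = q")
  case True
  then have "Pi_hat X (nat (- p)) (v_gen X q j) = v_gen X q j"
    using v_gen_homog[of q j] by (simp add: homog_def)
  then show ?thesis using v_gen_const[OF assms(2,4,3)] True by auto
next
  case False
  then have "nat (- p) \<noteq> nat (- q)" using assms by simp
  then have "Pi_hat X (nat (- p)) (v_gen X q j) = 0"
    using Pi_hat_homog[OF v_gen_homog, of "nat (- p)" q j] by (simp only: if_False)
  then show ?thesis using False by simp
qed

text \<open>\<open>reversal_V\<close> is chosen by \<open>SOME\<close>, and this provides a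
  candidate. By \<open>dual_functional\<close> the generators are independent as one family over
  pairs of degree and letter, so a permutation of them extends linearly.\<close>

lemma reversal_exists:
  "\<exists>J. rlinear (Vtot X) (Vtot X) J \<and> (\<forall>p\<le>0. \<forall>k\<in>letters X. J (v_gen X p k) = v_gen X p (linv X k))"
proof -
  define I where "I = {..0 :: int} \<times> letters X"
  define v where "v = (\<lambda>(p, k). v_gen X p k)"
  define w where "w = (\<lambda>(p, k). v_gen X p (linv X k))"
  define \<Phi> where "\<Phi> = (\<lambda>(p :: int, k) f. Pi_hat X (nat (- p)) f (\<lambda>_. k))"
  have dual: "\<Phi> i (v j) = 0 \<longleftrightarrow> j \<noteq> i" if "i \<in> I" "j \<in> I" for i j
    using dual_functional that by (auto simp: \<Phi>_def v_def I_def)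
  \<comment> \<open>The extension below is prescribed on vectors and not on indices, so the
    generators have to be distinct.\<close>
  have inj: "inj_on v I"
    using dual by (intro inj_onI) metis
  have PC: "v i \<in> PCinf X" for i
    using homog_PCinf[OF v_gen_homog] by (simp add: v_def split: prod.split)
  have "independent (v ` I)"
    unfolding independent_explicit_module
  proof (intro allI impI)
    fix t u y
    assume t: "finite t" "t \<subseteq> v ` I" and sum0: "(\<Sum>y\<in>t. u y *\<^sub>R y) = 0" and y: "y \<in> t"
    obtain i where i: "i \<in> I" "y = v i" using t y by blast
    obtain p k where pk: "i = (p, k)" by (cases i)
    have \<Phi>: "\<Phi> i f = Pi_hat X (nat (- p)) f (\<lambda>_. k)" for f by (simp only: \<Phi>_def pk prod.case)
    have tPC: "z \<in> PCinf X" if "z \<in> t" for z using t(2) PC that by blast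
    have "Pi_hat X (nat (- p)) (\<Sum>y\<in>t. u y *\<^sub>R y) = (\<Sum>z\<in>t. u z *\<^sub>R Pi_hat X (nat (- p)) z)"
      by (subst Pi_hat_sum[OF t(1)])
        (simp_all only: scaleR_cscale PCinf_cscale tPC Pi_hat_cscale cong: sum.cong)
    then have "\<Phi> i (\<Sum>y\<in>t. u y *\<^sub>R y) = (\<Sum>z\<in>t. u z *\<^sub>R \<Phi> i z)"
      by (simp only: \<Phi> sum_fun_apply scaleR_fun_def)
    also have "\<dots> = (\<Sum>z\<in>t. if z = y then u y *\<^sub>R \<Phi> i y else 0)"
    proof (intro sum.cong refl)
      fix z assume "z \<in> t"
      then obtain j where "j \<in> I" "z = v j" using t by blast
      then show "u z *\<^sub>R \<Phi> i z = (if z = y then u y *\<^sub>R \<Phi> i y else 0)"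
        using dual[OF i(1), of j] i(2) by auto
    qed
    also have "\<dots> = u y *\<^sub>R \<Phi> i y" using t(1) y by simp
    finally have "u y *\<^sub>R \<Phi> i y = 0"
      by (simp only: sum0 \<Phi> Pi_hat_0 zero_fun_apply)
    then show "u y = 0" using dual[OF i(1) i(1)] i(2) by simp
  qed
  from linear_independent_extend[OF this, of "\<lambda>y. w (inv_into I v y)"]
  obtain J where J: "linear J" "\<And>i. i \<in> I \<Longrightarrow> J (v i) = w i"
    using inj by (auto simp: inv_into_f_f)
  have B: "(\<Union>p\<in>{..0}. v_gen X p ` letters X) = v ` I" by (auto simp: v_def I_def)
  have "J ` v ` I \<subseteq> v ` I"
  proof (intro image_subsetI)
    fix y assume "y \<in> v ` I"
    then obtain i where i: "i \<in> I" "y = v i" by blast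
    obtain p k where pk: "i = (p, k)" by (cases i)
    then have "J y = v (p, linv X k)" using J(2)[OF i(1)] i by (simp add: w_def v_def)
    then show "J y \<in> v ` I" using i pk by (auto simp: I_def)
  qed
  then have "J ` span (v ` I) \<subseteq> span (v ` I)"
    using linear_span_image[OF J(1), of "v ` I"] span_mono by metis
  then have "rlinear (Vtot X) (Vtot X) J"
    using J(1) by (simp add: rlinear_def Vtot_def rsub_def B linear_add linear_scale)
  moreover have "J (v_gen X p k) = v_gen X p (linv X k)" if "p \<le> 0" "k \<in> letters X" for p k
    using J(2)[of "(p, k)"] that by (simp add: I_def v_def w_def)
  ultimately show ?thesis by blast
qed

section \<open>The Frobenius on V\<close>

lemma reversal_V: "rlinear (Vtot X) (Vtot X) (reversal_V X)"
  and reversal_V_gen: "p \<le> 0 \<Longrightarrow> k \<in> letters X \<Longrightarrow> reversal_V X (v_gen X p k) = v_gen X p (linv X k)"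
proof -
  note * = someI_ex[OF reversal_exists, folded reversal_V_def]
  show "rlinear (Vtot X) (Vtot X) (reversal_V X)" using * by (rule conjunct1)
  show "reversal_V X (v_gen X p k) = v_gen X p (linv X k)" if "p \<le> 0" "k \<in> letters X"
    using conjunct2[OF *] that by simp
qed

lemma neg_one_power_cscale: "cscale ((- 1) ^ n) f = ((- 1) ^ n :: real) *\<^sub>R f"
  by (simp add: scaleR_cscale)

lemma sign_D_Vtot: "f \<in> carr (Vtot X) \<Longrightarrow> sign_D X f \<in> carr (Vtot X)"
proof -
  let ?B = "\<Union>p\<in>{..0}. v_gen X p ` letters X"
  assume "f \<in> carr (Vtot X)"
  then have "f \<in> span ?B" by (simp add: Vtot_def rsub_def)
  then have "f \<in> PCinf X \<and> sign_D X f \<in> span ?B"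
  proof (induction rule: span_induct_alt)
    case base
    have "sign_D X 0 = 0"
      unfolding sign_D_def fun_of_D_homog[OF subspace_0[OF homog_subspace, of 0]] by (rule cscale_0)
    show ?case unfolding \<open>sign_D X 0 = 0\<close> by (rule conjI[OF PCinf_0 span_zero])
  next
    case (step r y z)
    then obtain p k where pk: "p \<le> 0" "k \<in> letters X" "y = v_gen X p k" by auto
    have y: "y \<in> homog (nat (- p))" using pk v_gen_homog by simp
    have ry: "r *\<^sub>R y \<in> homog (nat (- p))" using y homog_subspace by (simp add: subspace_scale)
    have "sign_D X (r *\<^sub>R y + z) = sign_D X (r *\<^sub>R y) + sign_D X z"
      unfolding sign_D_def using homog_PCinf[OF ry] step by (simp add: fun_of_D_add)
    also have "sign_D X (r *\<^sub>R y) = ((- 1) ^ nat (- p) :: real) *\<^sub>R r *\<^sub>R y"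
      unfolding sign_D_def fun_of_D_homog[OF ry] neg_one_power_cscale ..
    finally have eq: "sign_D X (r *\<^sub>R y + z) = ((- 1) ^ nat (- p) :: real) *\<^sub>R r *\<^sub>R y + sign_D X z" .
    show ?case
      unfolding eq using step homog_PCinf[OF ry]
      by (intro conjI PCinf_add span_add span_scale) (simp_all add: span_base)
  qed
  then show ?thesis by (simp add: Vtot_def rsub_def)
qed

lemma frob_V_rlinear: "rlinear (Vtot X) (Vtot X) (frob_V X)"
proof -
  have "sign_D X (f + h) = sign_D X f + sign_D X h" "sign_D X (r *\<^sub>R f) = r *\<^sub>R sign_D X f"
    if "f \<in> carr (Vtot X)" "h \<in> carr (Vtot X)" for f h r
    using that[THEN subsetD[OF Vtot_PCinf]]
    by (simp_all only: sign_D_def scaleR_cscale fun_of_D_add fun_of_D_cscale)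
  moreover have "radd (Vtot X) = (+)" "rscl (Vtot X) = (*\<^sub>R)" by (simp_all add: Vtot_def rsub_def)
  ultimately show ?thesis
    using reversal_V sign_D_Vtot unfolding rlinear_def frob_V_def by (simp add: image_subset_iff)
qed

lemma frob_V_gen:
  assumes "p \<le> 0" "k \<in> letters X"
  shows "frob_V X (v_gen X p k) = ((- 1) powi p :: real) *\<^sub>R v_gen X p (linv X k)"
proof -
  have "v_gen X p k \<in> carr (Vtot X)"
    using assms by (auto simp: Vtot_def rsub_def intro!: span_base)
  then have "reversal_V X (r *\<^sub>R v_gen X p k) = r *\<^sub>R reversal_V X (v_gen X p k)" for r
    using reversal_V by (simp add: rlinear_def Vtot_def rsub_def)
  then show ?thesis
    unfolding frob_V_def sign_D_def fun_of_D_homog[OF v_gen_homog] neg_one_power_cscale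
      neg_one_powi[OF assms(1)] reversal_V_gen[OF assms] .
qed

end

section \<open>Dynamical cohomology\<close>

context schottky_setting
begin

lemma Pn_subspace: "subspace (Pn X n p)"
  by (auto simp: subspace_def Pn_def PC_0 PC_add scaleR_cscale PC_cscale cscale_apply
      intro: tate_add tate_of_real_mult)

lemma Pn_PC: "f \<in> Pn X n p \<Longrightarrow> f \<in> PC X n"
  by (simp add: Pn_def)

lemma Pn_mono: "f \<in> Pn X m p \<Longrightarrow> m \<le> n \<Longrightarrow> f \<in> Pn X n p"
  using PC_mono[of f X m n] by (simp add: Pn_def)

lemma delta_PC:
  assumes "h \<in> PC X n"
  shows "delta X h \<in> PC X (Suc n)"
proof (rule PC_I)
  fix a b assume ab: "a \<in> splus X" "b \<in> splus X" "pre (Suc n) a = pre (Suc n) b"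
  have "h a = h b" using ab by (intro PC_cong[OF assms]) (simp_all add: pre_eq_iff)
  moreover have "h (shift a) = h (shift b)"
    using ab by (intro PC_cong[OF assms]) (simp_all add: pre_eq_iff shift_splus, simp add: shift_def)
  ultimately show "delta X h a = delta X h b" using ab by (simp add: delta_def)
qed (simp add: delta_def)

lemma delta_Pn:
  assumes "h \<in> Pn X n p"
  shows "delta X h \<in> Pn X (Suc n) p"
proof -
  have "delta X h a \<in> tate p" for a
    using assms tate_add[of "h a" p "of_real (- 1) * h (shift a)"] tate_of_real_mult[of "h (shift a)" p "- 1"]
    by (simp add: Pn_def delta_def)
  then show ?thesis using assms delta_PC by (simp add: Pn_def)
qed

lemma delta_linear: "linear (delta X)"
  by (rule linearI) (auto simp: delta_def fun_eq_iff scaleR_fun_def algebra_simps)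

lemma dP_subspace: "subspace (dP X n p)"
  by (cases n) (auto intro: linear_subspace_image[OF delta_linear] Pn_subspace)

lemma dP_Pn: "dP X n p \<subseteq> Pn X n p"
  using subspace_0[OF Pn_subspace] by (cases n) (auto intro: delta_Pn)

definition fcls :: "nat \<Rightarrow> int \<Rightarrow> (seqn \<Rightarrow> complex) \<Rightarrow> (seqn \<Rightarrow> complex) set" where
  "fcls n p = rcls (rsub (Pn X n p)) (dP X n p)"

lemma Fn_presentation: "presentation (Fn X n p) (Pn X n p) (fcls n p)"
  using presentation.presentation_rquot[OF presentation_rsub[OF Pn_subspace] dP_subspace dP_Pn]
  by (simp add: Fn_def fcls_def[abs_def])

text \<open>The functions that represent \<open>F_prev X n p\<close>.\<close>

definition lower :: "nat \<Rightarrow> int \<Rightarrow> (seqn \<Rightarrow> complex) set" where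
  "lower n p = (case n of 0 \<Rightarrow> {0} | Suc m \<Rightarrow> Pn X m p)"

lemma lower_subspace: "subspace (lower n p)"
  by (cases n) (simp_all add: lower_def Pn_subspace)

lemma lower_Pn: "lower n p \<subseteq> Pn X n p"
  using subspace_0[OF Pn_subspace] by (cases n) (auto simp: lower_def intro: Pn_mono)

lemma F_prev_eq: "F_prev X n p = fcls n p ` lower n p"
  by (cases n) (simp_all add: lower_def fcls_def presentation.rzero[OF Fn_presentation, unfolded fcls_def])

lemma Gr_presentation: "presentation (Gr X n p) (Pn X n p) (gr_class X n p)"
  using presentation.presentation_rquot[OF Fn_presentation lower_subspace lower_Pn]
  by (simp add: Gr_def F_prev_eq gr_class_def[abs_def] fcls_def)

lemma fcls_eq_iff:
  assumes "f \<in> Pn X n p" "h \<in> Pn X n p"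
  shows "fcls n p f = fcls n p h \<longleftrightarrow> f - h \<in> dP X n p"
proof -
  have "fcls n p f = fcls n p h \<longleftrightarrow> (\<exists>w\<in>dP X n p. f = h + w)"
    using presentation.rcls_eq_iff[OF presentation_rsub[OF Pn_subspace] dP_subspace dP_Pn assms]
    by (simp add: fcls_def)
  also have "\<dots> \<longleftrightarrow> f - h \<in> dP X n p"
    by (metis add_diff_cancel_left' diff_add_cancel add.commute)
  finally show ?thesis .
qed

text \<open>Undoes both quotients and so brings vanishing in \<open>Gr\<close> back to an equation
  between functions.\<close>

lemma gr_class_eq_0:
  assumes "f \<in> Pn X n p" "gr_class X n p f = gr_class X n p 0"
  shows "\<exists>w\<in>lower n p. f - w \<in> dP X n p"
proof -
  have 0: "0 \<in> Pn X n p" using Pn_subspace by (rule subspace_0)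
  obtain w where w: "w \<in> lower n p" "fcls n p f = fcls n p (0 + w)"
    using presentation.rcls_eq_iff[OF Fn_presentation lower_subspace lower_Pn assms(1) 0] assms(2)
    by (auto simp: gr_class_def F_prev_eq fcls_def)
  then have "f - w \<in> dP X n p" using fcls_eq_iff[OF assms(1), of w] lower_Pn by auto
  with w show ?thesis by blast
qed

lemma gr_class_image:
  "f \<in> Pn X n p \<Longrightarrow> gr_class X n p f = (\<lambda>w. fcls n p (f + w)) ` lower n p"
  using presentation.rcls_image[OF Fn_presentation lower_Pn]
  by (simp add: gr_class_def F_prev_eq fcls_def)

section \<open>Representatives of the classes and their independence\<close>

definition tchi :: "int \<Rightarrow> nat \<Rightarrow> seqn \<Rightarrow> complex" where
  "tchi p k = cscale (twopii powi p) (chi X (wnk (Suc (nat (- p))) k))"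

lemma tchi_Pn: "tchi p k \<in> Pn X (nat (- p)) p"
proof -
  have "twopii powi p * chi X w a \<in> tate p" for w a
    using tate_twist[of 1 0 p] by (auto simp: chi_def indicator_def tate_def intro: exI[of _ 1] exI[of _ 0])
  moreover have "chi X (wnk (Suc (nat (- p))) k) \<in> PC X (nat (- p))" by (rule chi_PC) (simp add: wnk_def)
  ultimately show ?thesis by (simp add: tchi_def Pn_def PC_cscale cscale_apply)
qed

lemma chi_class_tchi: "p \<le> 0 \<Longrightarrow> chi_class X p k = gr_class X (nat (- p)) p (tchi p k)"
  by (simp only: chi_class_def tchi_def wnk_Suc)

lemma grVbar_presentation:
  assumes "p \<le> 0"
  shows "presentation (grVbar X p) (span (tchi p ` letters X)) (gr_class X (nat (- p)) p)"
    and "carr (grVbar X p) = gr_class X (nat (- p)) p ` span (tchi p ` letters X)"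
proof -
  interpret Gr: presentation "Gr X (nat (- p)) p" "Pn X (nat (- p)) p" "gr_class X (nat (- p)) p"
    by (rule Gr_presentation)
  have sub: "tchi p ` letters X \<subseteq> Pn X (nat (- p)) p" using tchi_Pn by blast
  have "chi_class X p ` letters X = gr_class X (nat (- p)) p ` tchi p ` letters X"
    by (simp add: image_image chi_class_tchi[OF assms])
  then have eq: "grVbar X p = (Gr X (nat (- p)) p)\<lparr>carr := rspan (Gr X (nat (- p)) p)
      (gr_class X (nat (- p)) p ` tchi p ` letters X)\<rparr>"
    by (simp add: grVbar_def grHdyn_def)
  show "presentation (grVbar X p) (span (tchi p ` letters X)) (gr_class X (nat (- p)) p)"
    unfolding eq by (rule Gr.presentation_rspan[OF sub])
  then show "carr (grVbar X p) = gr_class X (nat (- p)) p ` span (tchi p ` letters X)"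
    by (rule presentation.carr)
qed

text \<open>At most one of the words k^(N+1), with \<open>N = nat (- p)\<close>, is a prefix of
  \<open>a\<close>, namely the one made of its first letter.\<close>

lemma sum_tchi:
  assumes "a \<in> splus X"
  shows "(\<Sum>k\<in>letters X. c k *\<^sub>R tchi p k) a =
    (if \<forall>i\<le>nat (- p). a i = a 0 then twopii powi p * of_real (c (a 0)) else 0)"
proof -
  let ?V = "if \<forall>i\<le>nat (- p). a i = a 0 then twopii powi p * of_real (c (a 0)) else 0"
  have *: "(c k *\<^sub>R tchi p k) a = (if k = a 0 then ?V else 0)" for k
  proof -
    have chi: "chi X (wnk (Suc (nat (- p))) k) a = (if \<forall>i\<le>nat (- p). a i = k then 1 else 0)"
      using assms unfolding chi_wnk less_Suc_eq_le by simp
    have eq: "(c k *\<^sub>R tchi p k) a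
        = (if \<forall>i\<le>nat (- p). a i = k then twopii powi p * of_real (c k) else 0)"
      unfolding scaleR_cscale cscale_apply tchi_def chi
      by (simp only: if_distrib[of "(*) _"] mult_1_right mult_zero_right mult.commute[of "of_real _"])
    show ?thesis
    proof (cases "k = a 0")
      case True
      then show ?thesis unfolding eq by (simp only: if_True simp_thms)
    next
      case False
      then have "\<not> (\<forall>i\<le>nat (- p). a i = k)" by blast
      then show ?thesis unfolding eq using False by (simp only: if_False)
    qed
  qed
  have "(\<Sum>k\<in>letters X. c k *\<^sub>R tchi p k) a = (\<Sum>k\<in>letters X. if k = a 0 then ?V else 0)"
    unfolding sum_fun_apply by (rule sum.cong[OF refl *])
  also have "\<dots> = (if a 0 \<in> letters X then ?V else 0)" by (rule sum.delta) simp
  also have "\<dots> = ?V" using assms by (simp add: splus_def)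
  finally show ?thesis .
qed

lemma test_letters:
  assumes "k \<in> letters X" "genus X \<ge> 3 \<or> N \<noteq> 1"
  shows "\<exists>i\<in>letters X. \<exists>j\<in>letters X. i \<noteq> k \<and> i \<noteq> linv X k \<and> j \<noteq> k \<and> j \<noteq> linv X k \<and>
    (N = 1 \<longrightarrow> i \<noteq> j \<and> j \<noteq> linv X i)"
proof (cases "N = 1")
  case False
  then show ?thesis using other_letter[OF assms(1)] by blast
next
  case True
  with assms have g: "genus X \<ge> 3" by simp
  \<comment> \<open>For genus at least 3 these letters lie in three different pairs of inverses, and
    at most one of them is in the pair of \<open>k\<close>.\<close>
  have "\<exists>i\<in>{1, 2, 3}. \<exists>j\<in>{1, 2, 3}. i \<noteq> k \<and> i \<noteq> linv X k \<and> j \<noteq> k \<and> j \<noteq> linv X k \<and> i \<noteq> j"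
    using assms(1) g by (auto simp: linv_def letters_def)
  then obtain i j where ij: "i \<in> {1, 2, 3}" "j \<in> {1, 2, 3}"
    "i \<noteq> k" "i \<noteq> linv X k" "j \<noteq> k" "j \<noteq> linv X k" "i \<noteq> j" by blast
  moreover have "i \<in> letters X" "j \<in> letters X" "j \<noteq> linv X i"
    using ij(1,2) g by (auto simp: letters_def linv_def)
  ultimately show ?thesis by blast
qed

lemma tchi_indep:
  assumes p: "p \<le> 0" and gp: "genus X \<ge> 3 \<or> p \<noteq> - 1" and k: "k \<in> letters X"
    and eq: "gr_class X (nat (- p)) p (\<Sum>k\<in>letters X. c k *\<^sub>R tchi p k) = gr_class X (nat (- p)) p 0"
  shows "c k = 0"
proof -
  define N where "N = nat (- p)"
  have N1: "genus X \<ge> 3 \<or> N \<noteq> 1" using gp p by (auto simp: N_def)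
  define F where "F = (\<Sum>k\<in>letters X. c k *\<^sub>R tchi p k)"
  have F: "F a = (if \<forall>i\<le>N. a i = a 0 then twopii powi p * of_real (c (a 0)) else 0)" if "a \<in> splus X" for a
    unfolding F_def N_def by (rule sum_tchi[OF that])
  have nz: "twopii powi p \<noteq> 0" by simp
  have "F \<in> Pn X N p"
    unfolding F_def N_def using tchi_Pn by (intro subspace_sum[OF Pn_subspace] subspace_scale[OF Pn_subspace])
  then obtain w where w: "w \<in> lower N p" "F - w \<in> dP X N p"
    using gr_class_eq_0[of F N p] eq unfolding F_def N_def by blast
  show ?thesis
  proof (cases N)
    case 0
    then have "F = 0" using w by (simp add: lower_def)
    then show ?thesis using F[OF const_splus[OF k]] nz by simp
  next
    case (Suc M)
    obtain h where h: "h \<in> Pn X M p" "F - w = delta X h" using w(2) Suc by auto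
    have wM: "w \<in> PC X M" "h \<in> PC X M" using w(1) h(1) Suc by (simp_all add: lower_def Pn_PC)
    obtain i j where i: "i \<in> letters X" "i \<noteq> k" "i \<noteq> linv X k"
      and j: "j \<in> letters X" "j \<noteq> k" "j \<noteq> linv X k" and ij: "N = 1 \<longrightarrow> i \<noteq> j \<and> j \<noteq> linv X i"
      using test_letters[OF k N1] by blast
    \<comment> \<open>The test word x k^(N-1) y, continued by repeating \<open>y\<close>, which
      keeps the infinite sequence reduced.\<close>
    define s where "s = (\<lambda>x y n. if n = 0 then x else if n < N then k else y :: nat)"
    have kk: "k \<noteq> linv X k" "i \<noteq> linv X i" "j \<noteq> linv X j" using linv_neq i j k by metis+
    have ki: "k \<noteq> linv X i" "k \<noteq> linv X j" using i j k by (metis linv_linv)+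
    have s: "s x y \<in> splus X" if "(x, y) \<in> {k, i} \<times> {k, j}" for x y
    proof -
      have xy: "x \<in> {k, i}" "y \<in> {k, j}" using that by auto
      then have c: "k \<noteq> linv X x" "y \<noteq> linv X k" "y \<noteq> linv X y" "N = 1 \<longrightarrow> y \<noteq> linv X x"
        and l: "x \<in> letters X" "y \<in> letters X"
        using ij kk ki i j k by auto
      have "s x y (Suc n) \<noteq> linv X (s x y n)" for n
        using c kk(1) Suc by (simp add: s_def)
      moreover have "s x y n \<in> letters X" for n using l k by (simp add: s_def)
      ultimately show ?thesis by (simp add: splus_def)
    qed
    have Fs: "F (s x y) = w (s x y) + h (s x y) - h (shift (s x y))" if "(x, y) \<in> {k, i} \<times> {k, j}" for x y
    proof -
      have "(F - w) (s x y) = delta X h (s x y)" using h(2) by simp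
      then show ?thesis using s[OF that] by (simp add: delta_def algebra_simps)
    qed
    \<comment> \<open>Functions of the letters up to \<open>M = N - 1\<close> do not see the final
      letter \<open>y\<close>.\<close>
    have u: "u (s x y) = u (s x y')" if "u \<in> PC X M" "x \<in> {k, i}" "y \<in> {k, j}" "y' \<in> {k, j}" for u x y y'
      using s that by (intro PC_cong[OF that(1)]) (auto simp: pre_eq_iff s_def Suc)
    \<comment> \<open>After the shift the initial letter \<open>x\<close> is gone.\<close>
    have v: "h (shift (s x y)) = h (shift (s x' y))" if "x \<in> {k, i}" "x' \<in> {k, i}" "y \<in> {k, j}" for x x' y
      using s that by (intro PC_cong[OF wM(2)] shift_splus) (auto simp: pre_eq_iff s_def shift_def)
    have eq: "F (s k k) + F (s i j) = F (s k j) + F (s i k)"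
      using Fs[of k k] Fs[of i j] Fs[of k j] Fs[of i k] u[OF wM(1), of k k j] u[OF wM(1), of i k j]
        u[OF wM(2), of k k j] u[OF wM(2), of i k j] v[of k i k] v[of k i j]
      by simp
    have c: "F (s k k) = twopii powi p * of_real (c k)"
      using F[OF s, of k k] by (simp add: s_def)
    have F0: "F (s x y) = 0" if "(x, y) \<in> {(i, j), (k, j), (i, k)}" for x y
    proof -
      \<comment> \<open>For \<open>(k, j)\<close> and \<open>(i, k)\<close> the last letter differs
        from the first. For \<open>(i, j)\<close> the letter at position 1 does: it is
        \<open>k\<close> if \<open>N > 1\<close>, and \<open>j\<close> if \<open>N = 1\<close>,
        where \<open>i \<noteq> j\<close> by the choice of the letters.\<close>
      have "s x y 1 \<noteq> s x y 0 \<or> s x y N \<noteq> s x y 0" using that i j ij Suc by (auto simp: s_def)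
      moreover have "1 \<le> N" using Suc by simp
      ultimately have "\<not> (\<forall>n\<le>N. s x y n = s x y 0)" by auto
      moreover have "(x, y) \<in> {k, i} \<times> {k, j}" using that by auto
      ultimately show ?thesis unfolding F[OF s[OF \<open>(x, y) \<in> {k, i} \<times> {k, j}\<close>]] by (intro if_not_P)
    qed
    have zero: "F (s i j) = 0" "F (s k j) = 0" "F (s i k) = 0" by (rule F0, simp)+
    have "twopii powi p * of_real (c k) = 0" using eq unfolding zero c by simp
    then show ?thesis using nz by simp
  qed
qed

subsection \<open>Reversal of orientation\<close>

lemma reversed_exists:
  assumes "a \<in> splus X"
  shows "\<exists>b. b \<in> splus X \<and> (\<forall>i\<le>n. b i = linv X (a (n - i)))"
proof (intro exI conjI)
  \<comment> \<open>Truncated subtraction makes the tail constant: beyond \<open>n\<close> every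
    letter is the inverse of \<open>a 0\<close>, and the sequence stays reduced as no letter is its
    own inverse.\<close>
  let ?b = "\<lambda>i. linv X (a (n - i))"
  have l: "a i \<in> letters X" "a (Suc i) \<noteq> linv X (a i)" for i using assms by (auto simp: splus_def)
  have "?b (Suc i) \<noteq> linv X (?b i)" for i
  proof (cases "i < n")
    case True
    then have "n - i = Suc (n - Suc i)" by simp
    then show ?thesis using l by simp metis
  next
    case False
    then show ?thesis using l linv_neq by simp
  qed
  then show "?b \<in> splus X" using l by (simp add: splus_def)
  show "\<forall>i\<le>n. ?b i = linv X (a (n - i))" by simp
qed

definition rev_seq :: "nat \<Rightarrow> seqn \<Rightarrow> seqn" where
  "rev_seq n a = (SOME b. b \<in> splus X \<and> (\<forall>i\<le>n. b i = linv X (a (n - i))))"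

lemma rev_seq: "a \<in> splus X \<Longrightarrow> rev_seq n a \<in> splus X"
  and rev_seq_nth: "a \<in> splus X \<Longrightarrow> i \<le> n \<Longrightarrow> rev_seq n a i = linv X (a (n - i))"
  using someI_ex[OF reversed_exists[of a n], folded rev_seq_def] by simp_all

lemma reversal_apply: "reversal X n f a = (if a \<in> splus X then f (rev_seq n a) else 0)"
  by (simp add: reversal_def rev_seq_def)

lemma reversal_PC:
  assumes "f \<in> PC X n"
  shows "reversal X n f \<in> PC X n"
proof (rule PC_I)
  fix a b assume ab: "a \<in> splus X" "b \<in> splus X" "pre n a = pre n b"
  have "f (rev_seq n a) = f (rev_seq n b)"
    using ab by (intro PC_cong[OF assms] rev_seq) (auto simp: pre_eq_iff rev_seq_nth)
  then show "reversal X n f a = reversal X n f b" using ab by (simp add: reversal_apply)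
qed (simp add: reversal_apply)

lemma reversal_Pn: "f \<in> Pn X n p \<Longrightarrow> reversal X n f \<in> Pn X n p"
  using reversal_PC[of f n] by (simp add: Pn_def) (simp add: reversal_apply)

lemma reversal_linear: "linear (reversal X n)"
  by (rule linearI) (auto simp: reversal_apply fun_eq_iff scaleR_fun_def)

lemma reversal_cscale: "reversal X n (cscale c f) = cscale c (reversal X n f)"
  by (auto simp: reversal_apply cscale_apply fun_eq_iff)

lemma reversal_reversal:
  assumes "f \<in> PC X n"
  shows "reversal X n (reversal X n f) = f"
proof
  fix a
  have "f (rev_seq n (rev_seq n a)) = f a" if a: "a \<in> splus X"
  proof (intro PC_cong[OF assms] rev_seq a)
    have "a i \<in> letters X" for i using a by (simp add: splus_def)
    then show "pre n (rev_seq n (rev_seq n a)) = pre n a"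
      using a by (simp add: pre_eq_iff rev_seq_nth rev_seq)
  qed
  then show "reversal X n (reversal X n f) a = f a"
    using rev_seq PC_outside[OF assms] by (simp add: reversal_apply)
qed

text \<open>Reversing one letter more moves the reversed word by one place, so the result is
  composed with the shift. Up to coboundaries the reversal therefore does not depend on the
  level.\<close>

lemma reversal_Suc:
  assumes "f \<in> PC X n"
  shows "reversal X (Suc n) f = reversal X n f - delta X (reversal X n f)"
proof
  fix a
  have "f (rev_seq (Suc n) a) = f (rev_seq n (shift a))" if a: "a \<in> splus X"
    using a by (intro PC_cong[OF assms] rev_seq shift_splus)
      (auto simp: pre_eq_iff rev_seq_nth shift_splus, auto simp: shift_def Suc_diff_le)
  then show "reversal X (Suc n) f a = (reversal X n f - delta X (reversal X n f)) a"
    using shift_splus by (simp add: reversal_apply delta_def)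
qed

text \<open>Reversal exchanges the two terms of a coboundary, whence the sign.\<close>

lemma reversal_delta:
  assumes "h \<in> PC X n"
  shows "reversal X (Suc n) (delta X h) = - delta X (reversal X n h)"
proof
  fix a
  have "h (rev_seq (Suc n) a) = h (rev_seq n (shift a))"
    "h (shift (rev_seq (Suc n) a)) = h (rev_seq n a)" if a: "a \<in> splus X"
    using a by (intro PC_cong[OF assms] rev_seq shift_splus;
        auto simp: pre_eq_iff rev_seq_nth shift_splus; auto simp: shift_def Suc_diff_le rev_seq_nth)+
  then show "reversal X (Suc n) (delta X h) a = (- delta X (reversal X n h)) a"
    using shift_splus rev_seq by (simp add: reversal_apply delta_def)
qed

text \<open>A word of equal letters is its own reverse, so only the inversion of the letters is
  left.\<close>

lemma reversal_chi:
  assumes k: "k \<in> letters X"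
  shows "reversal X n (chi X (wnk (Suc n) k)) = chi X (wnk (Suc n) (linv X k))"
proof
  fix a
  have "(\<forall>i<Suc n. rev_seq n a i = k) \<longleftrightarrow> (\<forall>i<Suc n. a i = linv X k)" if a: "a \<in> splus X"
  proof -
    have l: "a i \<in> letters X" for i using a by (simp add: splus_def)
    have "(\<forall>i<Suc n. rev_seq n a i = k) \<longleftrightarrow> (\<forall>i\<le>n. linv X (a (n - i)) = k)"
      using rev_seq_nth[OF a, of _ n] by (auto simp: less_Suc_eq_le)
    also have "\<dots> \<longleftrightarrow> (\<forall>i\<le>n. a i = linv X k)"
    proof safe
      fix i assume *: "\<forall>i\<le>n. linv X (a (n - i)) = k" "i \<le> n"
      then have "linv X (a (n - (n - i))) = k" by (metis diff_le_self)
      then show "a i = linv X k" using l[of i] *(2) by auto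
    next
      fix i assume "\<forall>i\<le>n. a i = linv X k" "i \<le> n"
      then show "linv X (a (n - i)) = k" using k by simp
    qed
    finally show ?thesis by (simp add: less_Suc_eq_le)
  qed
  then show "reversal X n (chi X (wnk (Suc n) k)) a = chi X (wnk (Suc n) (linv X k)) a"
    using rev_seq by (simp add: reversal_apply chi_wnk)
qed

definition frob_fun :: "int \<Rightarrow> (seqn \<Rightarrow> complex) \<Rightarrow> seqn \<Rightarrow> complex" where
  "frob_fun p f = cscale ((- 1) powi p) (reversal X (nat (- p)) f)"

lemma neg_one_powi_cscale: "cscale ((- 1) powi p) f = ((- 1) powi p :: real) *\<^sub>R f"
  by (simp add: scaleR_cscale powi_neg_one power_int_minus_left)

lemma frob_fun_scaleR: "frob_fun p f = ((- 1) powi p :: real) *\<^sub>R reversal X (nat (- p)) f"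
  by (simp add: frob_fun_def neg_one_powi_cscale)

lemma frob_fun_linear: "linear (frob_fun p)"
  unfolding frob_fun_scaleR[abs_def] by (intro linear_compose_scale_right reversal_linear)

lemma frob_fun_Pn: "f \<in> Pn X (nat (- p)) p \<Longrightarrow> frob_fun p f \<in> Pn X (nat (- p)) p"
  unfolding frob_fun_scaleR by (intro subspace_scale[OF Pn_subspace] reversal_Pn)

lemma neg_one_powi_sq: "((- 1) powi p :: real) * (- 1) powi p = 1"
  by (simp add: power_int_minus_left)

lemma frob_fun_frob_fun: "f \<in> PC X (nat (- p)) \<Longrightarrow> frob_fun p (frob_fun p f) = f"
  unfolding frob_fun_scaleR linear_scale[OF reversal_linear]
  by (simp only: scaleR_scaleR neg_one_powi_sq reversal_reversal scaleR_one)

text \<open>Equality follows from inclusion, since \<open>frob_fun p\<close> is an involution on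
  \<open>PC X (nat (- p))\<close>.\<close>

lemma frob_fun_dP: "frob_fun p ` dP X (nat (- p)) p = dP X (nat (- p)) p"
proof -
  have into: "frob_fun p f \<in> dP X (nat (- p)) p" if f: "f \<in> dP X (nat (- p)) p" for f
  proof (cases "nat (- p)")
    case 0
    then show ?thesis using f linear_0[OF frob_fun_linear] by simp
  next
    case (Suc n)
    then obtain h where h: "h \<in> Pn X n p" "f = delta X h" using f by auto
    have "- delta X (reversal X n h) \<in> dP X (nat (- p)) p"
      using h Suc by (intro subspace_neg[OF dP_subspace]) (simp add: reversal_Pn)
    then show ?thesis
      unfolding frob_fun_scaleR using h reversal_delta[OF Pn_PC[OF h(1)]] Suc
      by (intro subspace_scale[OF dP_subspace]) simp
  qed
  show ?thesis
  proof
    show "frob_fun p ` dP X (nat (- p)) p \<subseteq> dP X (nat (- p)) p" using into by blast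
    show "dP X (nat (- p)) p \<subseteq> frob_fun p ` dP X (nat (- p)) p"
    proof
      fix f assume f: "f \<in> dP X (nat (- p)) p"
      then have "f = frob_fun p (frob_fun p f)" using frob_fun_frob_fun dP_Pn Pn_PC by (metis subsetD)
      then show "f \<in> frob_fun p ` dP X (nat (- p)) p" using into[OF f] by blast
    qed
  qed
qed

lemma frob_fun_fcls: "frob_fun p ` fcls (nat (- p)) p f = fcls (nat (- p)) p (frob_fun p f)"
  unfolding fcls_def by (rule image_rcls_rsub) (simp_all only: linear_add[OF frob_fun_linear] frob_fun_dP)

text \<open>In positive degree \<open>G\<close> is the reversal at the level of the functions of
  fewer letters, with the same sign. It permutes them, and by \<open>reversal_Suc\<close> it agrees
  with \<open>frob_fun p\<close> up to coboundaries.\<close>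

lemma frob_fun_lower:
  "\<exists>G. G ` lower (nat (- p)) p = lower (nat (- p)) p \<and>
    (\<forall>w\<in>lower (nat (- p)) p. frob_fun p w - G w \<in> dP X (nat (- p)) p)"
proof (cases "nat (- p)")
  case 0
  then show ?thesis using linear_0[OF frob_fun_linear, of p]
    by (intro exI[of _ "\<lambda>w. w"]) (simp add: lower_def)
next
  case (Suc n)
  let ?G = "\<lambda>w. ((- 1) powi p :: real) *\<^sub>R reversal X n w"
  have G: "?G w \<in> Pn X n p" if "w \<in> Pn X n p" for w
    using that by (intro subspace_scale[OF Pn_subspace] reversal_Pn)
  have GG: "?G (?G w) = w" if "w \<in> Pn X n p" for w
    unfolding linear_scale[OF reversal_linear] scaleR_scaleR neg_one_powi_sq
    using reversal_reversal[OF Pn_PC[OF that]] by simp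
  have "?G ` Pn X n p = Pn X n p"
  proof
    show "?G ` Pn X n p \<subseteq> Pn X n p" using G by blast
    show "Pn X n p \<subseteq> ?G ` Pn X n p"
    proof
      fix w assume w: "w \<in> Pn X n p"
      show "w \<in> ?G ` Pn X n p"
        by (rule image_eqI[where x = "?G w"], rule GG[OF w, symmetric], rule G[OF w])
    qed
  qed
  moreover have "frob_fun p w - ?G w \<in> dP X (Suc n) p" if w: "w \<in> Pn X n p" for w
  proof -
    have "frob_fun p w - ?G w = delta X (- ?G w)"
      unfolding frob_fun_scaleR Suc reversal_Suc[OF Pn_PC[OF w]]
      by (simp only: linear_neg[OF delta_linear] linear_scale[OF delta_linear] scaleR_diff_right) simp
    then show ?thesis using subspace_neg[OF Pn_subspace G[OF w]] by auto
  qed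
  ultimately show ?thesis unfolding Suc lower_def nat.case by blast
qed

text \<open>An element of \<open>Gr\<close> is the set of cosets of \<open>f + w\<close>, with
  \<open>w\<close> in \<open>lower\<close>. They go to the cosets of
  \<open>frob_fun p f + G w\<close>, and as \<open>G\<close> permutes \<open>lower\<close> the same
  family arises in another order.\<close>

lemma frob_Hdyn_gr_class:
  assumes f: "f \<in> Pn X (nat (- p)) p"
  shows "frob_Hdyn X p (gr_class X (nat (- p)) p f) = gr_class X (nat (- p)) p (frob_fun p f)"
proof -
  let ?n = "nat (- p)"
  obtain G where G: "G ` lower ?n p = lower ?n p"
    "\<And>w. w \<in> lower ?n p \<Longrightarrow> frob_fun p w - G w \<in> dP X ?n p"
    using frob_fun_lower[of p] by blast
  have Ff: "frob_fun p f \<in> Pn X ?n p" by (rule frob_fun_Pn[OF f])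
  have "frob_Hdyn X p (gr_class X ?n p f) = (\<lambda>w. frob_fun p ` fcls ?n p (f + w)) ` lower ?n p"
    unfolding frob_Hdyn_def gr_class_image[OF f] image_image frob_fun_def[symmetric] ..
  also have "\<dots> = (\<lambda>w. fcls ?n p (frob_fun p f + G w)) ` lower ?n p"
  proof (rule image_cong[OF refl])
    fix w assume w: "w \<in> lower ?n p"
    have Pn: "frob_fun p f + frob_fun p w \<in> Pn X ?n p" "frob_fun p f + G w \<in> Pn X ?n p"
      using w G(1) lower_Pn Ff by (auto intro!: subspace_add[OF Pn_subspace] frob_fun_Pn)
    have "fcls ?n p (frob_fun p f + frob_fun p w) = fcls ?n p (frob_fun p f + G w)"
      using G(2)[OF w] unfolding fcls_eq_iff[OF Pn] by (simp only: add_diff_cancel_left)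
    then show "frob_fun p ` fcls ?n p (f + w) = fcls ?n p (frob_fun p f + G w)"
      unfolding frob_fun_fcls linear_add[OF frob_fun_linear] .
  qed
  also have "\<dots> = (\<lambda>w. fcls ?n p (frob_fun p f + w)) ` G ` lower ?n p" by (simp only: image_image)
  also have "\<dots> = gr_class X ?n p (frob_fun p f)" unfolding G(1) gr_class_image[OF Ff] ..
  finally show ?thesis .
qed

lemma frob_fun_tchi: "k \<in> letters X \<Longrightarrow> frob_fun p (tchi p k) = ((- 1) powi p :: real) *\<^sub>R tchi p (linv X k)"
  unfolding frob_fun_scaleR tchi_def reversal_cscale by (simp only: reversal_chi)

end

section \<open>The comparison maps\<close>

locale schottky_cohomology = schottky_setting +
  assumes phi_basis: "rbasis (H1 X 1) (letters X) (\<lambda>k. H1_class X 1 (phi X k))"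
begin

text \<open>The eigenvalue of the Frobenius on the class of \<open>tphi X p k\<close> and on the
  corresponding half difference or half sum.\<close>

definition eps :: "int \<Rightarrow> nat \<Rightarrow> real" where
  "eps p k = (if k \<le> genus X then (- 1) powi (p - 1) else (- 1) powi p)"

lemma tphi_Zforms: "k \<in> letters X \<Longrightarrow> tphi X p k \<in> Zforms X p"
  by (rule tphi_Zforms_span(1)[OF phi_basis])

lemma H1_span: "carr (H1 X p) = H1_class X p ` span (tphi X p ` letters X)"
  by (rule tphi_Zforms_span(2)[OF phi_basis])

lemma H1_elem:
  assumes "x \<in> carr (H1 X p)"
  obtains c where "x = H1_class X p (\<Sum>k\<in>letters X. c k *\<^sub>R tphi X p k)"
proof -
  obtain y where y: "y \<in> span (tphi X p ` letters X)" "x = H1_class X p y"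
    using assms unfolding H1_span by blast
  obtain c where "y = (\<Sum>k\<in>letters X. c k *\<^sub>R tphi X p k)"
    using span_image_sum[OF finite_letters y(1)] by blast
  with y(2) that show thesis by blast
qed

lemma frob_H_sum:
  "frob_H X p (H1_class X p (\<Sum>k\<in>letters X. c k *\<^sub>R tphi X p k))
    = H1_class X p (\<Sum>k\<in>letters X. c k *\<^sub>R eps p k *\<^sub>R tphi X p k)"
proof (rule rlinear_sum[OF H1_presentation H1_presentation frob_H_rlinear])
  fix k assume k: "k \<in> letters X"
  show "tphi X p k \<in> Zforms X p" by (rule tphi_Zforms[OF k])
  then show "eps p k *\<^sub>R tphi X p k \<in> Zforms X p" by (rule subspace_scale[OF Zforms_subspace])
  show "frob_H X p (H1_class X p (tphi X p k)) = H1_class X p (eps p k *\<^sub>R tphi X p k)"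
    unfolding frob_H_class frob_form_tphi[OF fuchsian k] eps_def ..
qed simp

text \<open>The source side of both equivariance statements, evaluated on a general element; the
  target side is computed separately for V and for \<open>Gr\<close>.\<close>

lemma rlinear_eps:
  assumes B: "presentation B W \<sigma>" and f: "rlinear (H1 X p) B f"
    and w: "\<And>k. k \<in> letters X \<Longrightarrow> w k \<in> W"
      "\<And>k. k \<in> letters X \<Longrightarrow> f (H1_class X p (tphi X p k)) = \<sigma> (w k)"
  shows "f (frob_H X p (H1_class X p (\<Sum>k\<in>letters X. c k *\<^sub>R tphi X p k)))
    = \<sigma> (\<Sum>k\<in>letters X. c k *\<^sub>R eps p k *\<^sub>R w k)"
  unfolding frob_H_sum
proof (rule rlinear_sum[OF H1_presentation B f])
  fix k assume k: "k \<in> letters X"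
  note Z = tphi_Zforms[OF k, of p] and W = w(1)[OF k]
  show "eps p k *\<^sub>R tphi X p k \<in> Zforms X p" using Z by (rule subspace_scale[OF Zforms_subspace])
  show "eps p k *\<^sub>R w k \<in> W" using W by (rule subspace_scale[OF presentation.subspace[OF B]])
  have "H1_class X p (tphi X p k) \<in> carr (H1 X p)"
    unfolding presentation.carr[OF H1_presentation] using Z by (rule imageI)
  then have "f (rscl (H1 X p) (eps p k) (H1_class X p (tphi X p k)))
      = rscl B (eps p k) (f (H1_class X p (tphi X p k)))"
    using f by (simp add: rlinear_def)
  then show "f (H1_class X p (eps p k *\<^sub>R tphi X p k)) = \<sigma> (eps p k *\<^sub>R w k)"
    unfolding presentation.rscl[OF H1_presentation Z] w(2)[OF k] presentation.rscl[OF B W] .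
qed simp

subsection \<open>The map to V\<close>

lemma Pi_hat_diff:
  "f \<in> PCinf X \<Longrightarrow> h \<in> PCinf X \<Longrightarrow> Pi_hat X n (f - h) = Pi_hat X n f - Pi_hat X n h"
  using Pi_hat_add[of "f - h" h n] PCinf_diff by simp

lemma half_cscale: "half g (\<lambda>k. cscale c (e k)) k = cscale c (half g e k)"
  by (simp add: half_def scaleR_cscale cscale_cscale mult.commute cscale_diff cscale_add)

lemma v_gen_half: "half (genus X) (v_gen X p) k = cscale (twopii powi p) (half (genus X) (v_untw X p) k)"
  unfolding half_cscale[symmetric] v_gen_def[abs_def] ..

lemma v_untw_half:
  assumes "p \<le> 0" "k \<in> {1..genus X}"
  shows "Pi_hat X (nat \<bar>p\<bar>) (cscale (1/2)
      (chi X (wnk (nat (- p + 1)) k) - chi X (wnk (nat (- p + 1)) (k + genus X))))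
      = half (genus X) (v_untw X p) k"
    and "Pi_hat X (nat \<bar>p\<bar>) (cscale (1/2)
      (chi X (wnk (nat (- p + 1)) k) + chi X (wnk (nat (- p + 1)) (k + genus X))))
      = half (genus X) (v_untw X p) (k + genus X)"
proof -
  have p: "\<bar>p\<bar> = - p" using assms by simp
  have h: "cscale (1/2) f = (1/2) *\<^sub>R f" for f by (simp add: scaleR_cscale)
  show "Pi_hat X (nat \<bar>p\<bar>) (cscale (1/2)
      (chi X (wnk (nat (- p + 1)) k) - chi X (wnk (nat (- p + 1)) (k + genus X))))
      = half (genus X) (v_untw X p) k"
    unfolding half_simps[OF assms(2)] p v_untw_def h[symmetric]
      Pi_hat_cscale[OF PCinf_diff[OF chi_PCinf chi_PCinf]] Pi_hat_diff[OF chi_PCinf chi_PCinf] ..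
  show "Pi_hat X (nat \<bar>p\<bar>) (cscale (1/2)
      (chi X (wnk (nat (- p + 1)) k) + chi X (wnk (nat (- p + 1)) (k + genus X))))
      = half (genus X) (v_untw X p) (k + genus X)"
    unfolding half_simps[OF assms(2)] p v_untw_def h[symmetric]
      Pi_hat_cscale[OF PCinf_add[OF chi_PCinf chi_PCinf]] Pi_hat_add[OF chi_PCinf chi_PCinf] ..
qed

lemma grV_span_half: "carr (grV X p) = span (half (genus X) (v_gen X p) ` letters X)"
  unfolding letters_eq span_half by (simp add: grV_def rsub_def letters_eq)

lemma grV_untw_span_half: "carr (grV_untw X p) = span (half (genus X) (v_untw X p) ` letters X)"
  unfolding letters_eq span_half by (simp add: grV_untw_def rsub_def letters_eq)

lemma grV_untw_presentation: "presentation (grV_untw X p) (carr (grV_untw X p)) (\<lambda>x. x)"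
  unfolding grV_untw_def by (simp add: rsub_def) (rule presentation_rsub[unfolded rsub_def], simp)

lemma v_gen_half_indep:
  assumes "p \<le> 0" "(\<Sum>k\<in>letters X. c k *\<^sub>R half (genus X) (v_gen X p) k) = 0" "k \<in> letters X"
  shows "c k = 0"
proof (rule half_indep[where K = "{0}" and e = "v_gen X p" and g = "genus X"])
  show "c k = 0" if "(\<Sum>k\<in>{1..2 * genus X}. c k *\<^sub>R v_gen X p k) \<in> {0}" "k \<in> {1..2 * genus X}" for c k
    using v_gen_indep[OF assms(1), of c k] that by (simp add: letters_eq)
qed (use assms in \<open>simp_all add: letters_eq\<close>)

lemma v_untw_half_indep:
  assumes "p \<le> 0" "(\<Sum>k\<in>letters X. c k *\<^sub>R half (genus X) (v_untw X p) k) = 0" "k \<in> letters X"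
  shows "c k = 0"
proof (rule v_gen_half_indep[OF assms(1) _ assms(3)])
  have "(\<Sum>k\<in>letters X. c k *\<^sub>R half (genus X) (v_gen X p) k)
      = cscale (twopii powi p) (\<Sum>k\<in>letters X. c k *\<^sub>R half (genus X) (v_untw X p) k)"
    by (simp add: fun_eq_iff sum_fun_apply v_gen_half scaleR_fun_def cscale_apply sum_distrib_left)
  then show "(\<Sum>k\<in>letters X. c k *\<^sub>R half (genus X) (v_gen X p) k) = 0"
    unfolding assms(2) cscale_0 .
qed

lemma linv_genus:
  assumes "j \<in> {1..genus X}"
  shows "linv X j = j + genus X" "linv X (j + genus X) = j" "j \<in> letters X" "j + genus X \<in> letters X"
  using assms by (auto simp: linv_def letters_eq)

lemma eps_eq: "eps p k = (if k \<le> genus X then - ((- 1) powi p) else (- 1) powi p)"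
  by (simp add: eps_def power_int_minus_left)

lemma frob_V_half:
  assumes p: "p \<le> 0" and k: "k \<in> letters X"
  shows "frob_V X (half (genus X) (v_gen X p) k) = eps p k *\<^sub>R half (genus X) (v_gen X p) k"
  unfolding eps_eq
proof (rule half_swap[OF k[unfolded letters_eq]])
  fix j r s assume j: "j \<in> {1..genus X}"
  show "frob_V X (v_gen X p j) = (- 1) powi p *\<^sub>R v_gen X p (j + genus X)"
    "frob_V X (v_gen X p (j + genus X)) = (- 1) powi p *\<^sub>R v_gen X p j"
    using frob_V_gen[OF p linv_genus(3)[OF j]] frob_V_gen[OF p linv_genus(4)[OF j]]
    unfolding linv_genus(1,2)[OF j] .
  have V: "v_gen X p k \<in> carr (Vtot X)" if "k \<in> letters X" for k
    using that p by (auto simp: Vtot_def rsub_def intro!: span_base)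
  note V = V[OF linv_genus(3)[OF j]] V[OF linv_genus(4)[OF j]]
  then have "s *\<^sub>R v_gen X p (j + genus X) \<in> carr (Vtot X)"
    "v_gen X p j + s *\<^sub>R v_gen X p (j + genus X) \<in> carr (Vtot X)"
    by (auto simp: Vtot_def rsub_def intro!: span_add span_scale)
  then show "frob_V X (r *\<^sub>R (v_gen X p j + s *\<^sub>R v_gen X p (j + genus X)))
      = r *\<^sub>R (frob_V X (v_gen X p j) + s *\<^sub>R frob_V X (v_gen X p (j + genus X)))"
    using frob_V_rlinear V by (simp add: rlinear_def Vtot_def rsub_def)
qed

lemma riso_U:
  assumes p: "p \<le> 0" and U: "rlinear (H1 X p) (grV X p) f"
    and gen: "\<And>k. k \<in> letters X \<Longrightarrow> f (H1_class X p (tphi X p k)) = half (genus X) (v_gen X p) k"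
  shows "riso (H1 X p) (grV X p) f"
proof (rule riso_basis[OF H1_presentation grV_presentation U,
      where I = "letters X" and v = "tphi X p" and w = "half (genus X) (v_gen X p)"])
  show "half (genus X) (v_gen X p) k \<in> carr (grV X p)" if "k \<in> letters X" for k
    unfolding grV_span_half using that by (intro span_base imageI)
  show "carr (grV X p) = (\<lambda>x. x) ` span (half (genus X) (v_gen X p) ` letters X)"
    unfolding grV_span_half image_ident ..
  show "c k = 0" if "(\<Sum>k\<in>letters X. c k *\<^sub>R half (genus X) (v_gen X p) k) = 0" "k \<in> letters X" for c k
    using v_gen_half_indep[OF p that] .
qed (rule tphi_Zforms, assumption, rule gen, assumption, rule finite_letters, rule H1_span)

lemma U_frob:
  assumes p: "p \<le> 0" and U: "rlinear (H1 X p) (grV X p) f"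
    and gen: "\<And>k. k \<in> letters X \<Longrightarrow> f (H1_class X p (tphi X p k)) = half (genus X) (v_gen X p) k"
    and x: "x \<in> carr (H1 X p)"
  shows "f (frob_H X p x) = frob_V X (f x)"
proof -
  obtain c where c: "x = H1_class X p (\<Sum>k\<in>letters X. c k *\<^sub>R tphi X p k)" using H1_elem[OF x] .
  have half: "half (genus X) (v_gen X p) k \<in> carr (grV X p)" if "k \<in> letters X" for k
    unfolding grV_span_half using that by (intro span_base imageI)
  have halfV: "half (genus X) (v_gen X p) k \<in> carr (Vtot X)" if "k \<in> letters X" for k
    using half[OF that] grV_sub_Vtot[OF p] by blast
  have fx: "f x = (\<Sum>k\<in>letters X. c k *\<^sub>R half (genus X) (v_gen X p) k)"
    unfolding c
    by (rule rlinear_sum[OF H1_presentation grV_presentation U],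
        rule tphi_Zforms, assumption, rule half, assumption, rule gen, assumption, rule finite_letters)
  have "frob_V X (\<Sum>k\<in>letters X. c k *\<^sub>R half (genus X) (v_gen X p) k)
      = (\<Sum>k\<in>letters X. c k *\<^sub>R eps p k *\<^sub>R half (genus X) (v_gen X p) k)"
  proof (rule rlinear_sum[OF Vtot_presentation Vtot_presentation frob_V_rlinear])
    fix k assume k: "k \<in> letters X"
    show "half (genus X) (v_gen X p) k \<in> carr (Vtot X)" by (rule halfV[OF k])
    then show "eps p k *\<^sub>R half (genus X) (v_gen X p) k \<in> carr (Vtot X)"
      by (rule subspace_scale[OF presentation.subspace[OF Vtot_presentation]])
    show "frob_V X (half (genus X) (v_gen X p) k) = eps p k *\<^sub>R half (genus X) (v_gen X p) k"
      by (rule frob_V_half[OF p k])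
  qed simp
  then show ?thesis
    unfolding fx unfolding c
    by (elim ssubst) (rule rlinear_eps[OF grV_presentation U], rule half, assumption, rule gen, assumption)
qed

section \<open>The Tate twist and the real structure of V\<close>

lemma twist_D_homog:
  assumes "p \<le> 0" "f \<in> homog (nat (- p))"
  shows "twist_D X f = cscale (twopii powi p) f"
proof -
  \<comment> \<open>The exponent in \<open>twist_D\<close> is minus the degree, and the piece
    indexed by \<open>p \<le> 0\<close> has degree \<open>- p\<close>.\<close>
  have "- int (nat (- p)) = p" using assms(1) by simp
  then show ?thesis unfolding twist_D_def fun_of_D_homog[OF assms(2)] by (rule arg_cong)
qed

lemma twist_D_grV_untw: "p \<le> 0 \<Longrightarrow> f \<in> carr (grV_untw X p) \<Longrightarrow> twist_D X f = cscale (twopii powi p) f"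
  by (rule twist_D_homog) (simp_all add: grV_untw_def rsub_def span_v_untw_homog[THEN subsetD])

lemma Vtot_twist_D: "carr (Vtot X) = twist_D X ` carr (V_untw X)"
proof -
  let ?B = "\<Union>p\<in>{..0}. v_untw X p ` letters X" and ?C = "\<Union>p\<in>{..0}. v_gen X p ` letters X"
  have B: "span ?B \<subseteq> PCinf X"
    using homog_PCinf[OF v_untw_homog] by (intro span_minimal PCinf_subspace) auto
  have gen: "twist_D X (v_untw X p k) = v_gen X p k" if "p \<le> 0" for p k
    unfolding twist_D_homog[OF that v_untw_homog] v_gen_def ..
  \<comment> \<open>Linearity of \<open>twist_D X\<close> is available on \<open>PCinf X\<close>
    only, so membership there has to be established along both inductions.\<close>
  have lin: "twist_D X (r *\<^sub>R y + z) = r *\<^sub>R twist_D X y + twist_D X z"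
    if "y \<in> PCinf X" "z \<in> PCinf X" for r y z
    using that by (simp only: twist_D_def scaleR_cscale fun_of_D_add fun_of_D_cscale PCinf_cscale)
  have zero: "twist_D X 0 = 0"
    unfolding twist_D_def fun_of_D_homog[OF subspace_0[OF homog_subspace, of 0]] by (rule cscale_0)
  have "f \<in> PCinf X \<and> twist_D X f \<in> span ?C" if "f \<in> span ?B" for f
    using that
  proof (induction rule: span_induct_alt)
    case base
    show ?case unfolding zero by (rule conjI[OF PCinf_0 span_zero])
  next
    case (step r y z)
    then obtain p k where pk: "p \<le> 0" "k \<in> letters X" "y = v_untw X p k" by auto
    have yz: "y \<in> PCinf X" "z \<in> PCinf X"
      using homog_PCinf[OF v_untw_homog] pk(3) step by simp_all
    have "v_gen X p k \<in> span ?C" using pk by (intro span_base) auto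
    then have "twist_D X (r *\<^sub>R y + z) \<in> span ?C"
      unfolding lin[OF yz] unfolding pk(3) gen[OF pk(1)] using step by (intro span_add span_scale) simp_all
    moreover have "r *\<^sub>R y + z \<in> PCinf X"
      using yz by (intro subspace_add[OF PCinf_subspace] subspace_scale[OF PCinf_subspace])
    ultimately show ?case by blast
  qed
  moreover have "f \<in> twist_D X ` span ?B" if "f \<in> span ?C" for f
    using that
  proof (induction rule: span_induct_alt)
    case base
    show ?case by (rule image_eqI[where x = 0]) (simp_all only: zero span_zero)
  next
    case (step r y z)
    then obtain p k where pk: "p \<le> 0" "k \<in> letters X" "y = v_gen X p k" by auto
    obtain z' where z': "z' \<in> span ?B" "z = twist_D X z'" using step(2) by (rule imageE)
    have v: "v_untw X p k \<in> span ?B" using pk by (intro span_base) auto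
    have PC: "v_untw X p k \<in> PCinf X" "z' \<in> PCinf X" by (rule subsetD[OF B v], rule subsetD[OF B z'(1)])
    have "r *\<^sub>R y + z = twist_D X (r *\<^sub>R v_untw X p k + z')"
      unfolding lin[OF PC] gen[OF pk(1)] pk(3) z'(2) ..
    moreover have "r *\<^sub>R v_untw X p k + z' \<in> span ?B" using v z' by (intro span_add span_scale)
    ultimately show ?case by (rule image_eqI)
  qed
  ultimately show ?thesis unfolding Vtot_def V_untw_def rsub_def rspace.simps by blast
qed

text \<open>Characteristic functions are real-valued and means of real functions are real, so the
  untwisted generators take real values.\<close>

lemma V_untw_real: "carr (V_untw X) \<subseteq> (\<Union>n. Pn X n 0)"
proof -
  let ?R = "{f \<in> PCinf X. \<forall>a. f a \<in> \<real>}"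
  have "subspace ?R"
  proof (rule subspaceI)
    show "0 \<in> ?R" using PCinf_0 by simp
    show "f + h \<in> ?R" if "f \<in> ?R" "h \<in> ?R" for f h
      using that PCinf_add[of f X h] Reals_add[of "f _" "h _"] by (simp add: plus_fun_def)
    show "c *\<^sub>R f \<in> ?R" if "f \<in> ?R" for c f
      using that PCinf_cscale[of f X "of_real c"] by (simp add: scaleR_cscale cscale_apply)
  qed
  moreover have "v_untw X p k \<in> ?R" for p k
  proof -
    have "chi X w a \<in> \<real>" for w a by (simp add: chi_def indicator_def)
    from Pi_hat_real[OF chi_PCinf this] have "\<forall>a. v_untw X p k a \<in> \<real>" unfolding v_untw_def by blast
    with homog_PCinf[OF v_untw_homog] show ?thesis by blast
  qed
  ultimately have "carr (V_untw X) \<subseteq> ?R"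
    unfolding V_untw_def rsub_def rspace.simps by (intro span_minimal UN_least image_subsetI)
  also have "?R \<subseteq> (\<Union>n. Pn X n 0)"
  proof
    fix f assume "f \<in> ?R"
    then obtain n where n: "f \<in> PC X n" "\<forall>a. f a \<in> \<real>" by (auto simp: PCinf_def)
    have "f a \<in> tate 0" for a
    proof -
      obtain r where "f a = of_real r" using n(2) Reals_cases by metis
      then show ?thesis unfolding tate_def by (intro CollectI exI[of _ r]) simp
    qed
    with n(1) show "f \<in> (\<Union>n. Pn X n 0)" by (simp add: Pn_def) blast
  qed
  finally show ?thesis .
qed

subsection \<open>The map to dynamical cohomology\<close>

lemma frob_fun_half:
  assumes k: "k \<in> letters X"
  shows "frob_fun p (half (genus X) (tchi p) k) = eps p k *\<^sub>R half (genus X) (tchi p) k"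
  unfolding eps_eq
proof (rule half_swap[OF k[unfolded letters_eq]])
  fix j r s assume j: "j \<in> {1..genus X}"
  show "frob_fun p (tchi p j) = (- 1) powi p *\<^sub>R tchi p (j + genus X)"
    "frob_fun p (tchi p (j + genus X)) = (- 1) powi p *\<^sub>R tchi p j"
    using frob_fun_tchi[OF linv_genus(3)[OF j]] frob_fun_tchi[OF linv_genus(4)[OF j]]
    unfolding linv_genus(1,2)[OF j] .
  show "frob_fun p (r *\<^sub>R (tchi p j + s *\<^sub>R tchi p (j + genus X)))
      = r *\<^sub>R (frob_fun p (tchi p j) + s *\<^sub>R frob_fun p (tchi p (j + genus X)))"
    by (simp only: linear_scale[OF frob_fun_linear] linear_add[OF frob_fun_linear])
qed

lemma grVbar_span_half:
  assumes "p \<le> 0"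
  shows "carr (grVbar X p) = gr_class X (nat (- p)) p ` span (half (genus X) (tchi p) ` letters X)"
  using grVbar_presentation(2)[OF assms] unfolding letters_eq span_half .

lemma half_tchi_span: "k \<in> letters X \<Longrightarrow> half (genus X) (tchi p) k \<in> span (tchi p ` letters X)"
proof -
  assume "k \<in> letters X"
  then have "half (genus X) (tchi p) k \<in> span (half (genus X) (tchi p) ` letters X)"
    by (intro span_base imageI)
  then show ?thesis unfolding letters_eq span_half .
qed

lemma image_Ubar:
  assumes p: "p \<le> 0" and U: "rlinear (H1 X p) (grVbar X p) f"
    and gen: "\<And>k. k \<in> letters X \<Longrightarrow>
      f (H1_class X p (tphi X p k)) = gr_class X (nat (- p)) p (half (genus X) (tchi p) k)"
  shows "f ` carr (H1 X p) = carr (grVbar X p)"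
  by (rule rlinear_image[OF H1_presentation grVbar_presentation(1)[OF p] U,
        where I = "letters X" and v = "tphi X p" and w = "half (genus X) (tchi p)"],
      rule tphi_Zforms, assumption, rule half_tchi_span, assumption, rule gen, assumption,
      rule finite_letters, rule H1_span, rule grVbar_span_half[OF p])

lemma riso_Ubar:
  assumes p: "p \<le> 0" and gp: "genus X \<ge> 3 \<or> p \<noteq> - 1" and U: "rlinear (H1 X p) (grVbar X p) f"
    and gen: "\<And>k. k \<in> letters X \<Longrightarrow>
      f (H1_class X p (tphi X p k)) = gr_class X (nat (- p)) p (half (genus X) (tchi p) k)"
  shows "riso (H1 X p) (grVbar X p) f"
proof (rule riso_basis[OF H1_presentation grVbar_presentation(1)[OF p] U,
      where I = "letters X" and v = "tphi X p" and w = "half (genus X) (tchi p)"])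
  fix c k
  assume 0: "gr_class X (nat (- p)) p (\<Sum>k\<in>letters X. c k *\<^sub>R half (genus X) (tchi p) k)
      = gr_class X (nat (- p)) p 0" and k: "k \<in> letters X"
  let ?K = "{f. gr_class X (nat (- p)) p f = gr_class X (nat (- p)) p 0}"
  show "c k = 0"
  proof (rule half_indep[where K = ?K and e = "tchi p" and g = "genus X"])
    show "d j = 0" if "(\<Sum>k\<in>{1..2 * genus X}. d k *\<^sub>R tchi p k) \<in> ?K" "j \<in> {1..2 * genus X}" for d j
      by (rule tchi_indep[OF p gp]) (use that in \<open>simp_all only: letters_eq mem_Collect_eq\<close>)
    show "(\<Sum>k\<in>{1..2 * genus X}. c k *\<^sub>R half (genus X) (tchi p) k) \<in> ?K"
      using 0 by (simp only: letters_eq mem_Collect_eq)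
    show "k \<in> {1..2 * genus X}" using k unfolding letters_eq .
  qed
qed (rule tphi_Zforms, assumption, rule half_tchi_span, assumption, rule gen, assumption,
    rule finite_letters, rule H1_span, rule grVbar_span_half[OF p])

lemma Ubar_frob:
  assumes p: "p \<le> 0" and U: "rlinear (H1 X p) (grVbar X p) f"
    and gen: "\<And>k. k \<in> letters X \<Longrightarrow>
      f (H1_class X p (tphi X p k)) = gr_class X (nat (- p)) p (half (genus X) (tchi p) k)"
    and x: "x \<in> carr (H1 X p)"
  shows "f (frob_H X p x) = frob_Hdyn X p (f x)"
proof -
  obtain c where c: "x = H1_class X p (\<Sum>k\<in>letters X. c k *\<^sub>R tphi X p k)" using H1_elem[OF x] .
  let ?s = "\<Sum>k\<in>letters X. c k *\<^sub>R half (genus X) (tchi p) k"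
  have fx: "f x = gr_class X (nat (- p)) p ?s"
    unfolding c
    by (rule rlinear_sum[OF H1_presentation grVbar_presentation(1)[OF p] U],
        rule tphi_Zforms, assumption, rule half_tchi_span, assumption, rule gen, assumption,
        rule finite_letters)
  have sub: "span (tchi p ` letters X) \<subseteq> Pn X (nat (- p)) p"
    using tchi_Pn by (intro span_minimal Pn_subspace) auto
  have "?s \<in> Pn X (nat (- p)) p"
    by (intro subspace_sum[OF Pn_subspace] subspace_scale[OF Pn_subspace])
      (rule subsetD[OF sub half_tchi_span])
  then have "frob_Hdyn X p (f x) = gr_class X (nat (- p)) p (frob_fun p ?s)"
    unfolding fx by (rule frob_Hdyn_gr_class)
  also have "frob_fun p ?s = (\<Sum>k\<in>letters X. c k *\<^sub>R eps p k *\<^sub>R half (genus X) (tchi p) k)"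
    unfolding linear_sum[OF frob_fun_linear] linear_scale[OF frob_fun_linear]
    by (intro sum.cong refl) (simp only: frob_fun_half)
  finally show ?thesis
    unfolding c
    by (elim ssubst)
      (rule rlinear_eps[OF grVbar_presentation(1)[OF p] U], rule half_tchi_span, assumption, rule gen, assumption)
qed

end

theorem theorem5p7:
  fixes X :: schottky
    and U :: "int \<Rightarrow> form set \<Rightarrow> seqn \<Rightarrow> complex"
    and Ubar :: "int \<Rightarrow> form set \<Rightarrow> (seqn \<Rightarrow> complex) set set"
  assumes genus: "genus X \<ge> 2"
    and uniformization: "fuchsian_schottky X" "basept X \<in> Omega X"
    and coding: "coding_homeo X"
    and measure: "patterson_sullivan X (psm X)"
    and reps: "coset_reps X"
    and phi_basis: "rbasis (H1 X 1) (letters X) (\<lambda>k. H1_class X 1 (phi X k))"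
    and U_linear: "\<And>p. p \<le> 0 \<Longrightarrow> rlinear (H1 X p) (grV X p) (U p)"
    and U_minus: "\<And>p k. p \<le> 0 \<Longrightarrow> k \<in> {1..genus X} \<Longrightarrow>
      U p (H1_class X p (fscale (twopii powi (p - 1)) (phi X k))) =
      cscale (twopii powi p) (Pi_hat X (nat \<bar>p\<bar>) (cscale (1/2)
        (chi X (wnk (nat (- p + 1)) k) - chi X (wnk (nat (- p + 1)) (k + genus X)))))"
    and U_plus: "\<And>p k. p \<le> 0 \<Longrightarrow> k \<in> {1..genus X} \<Longrightarrow>
      U p (H1_class X p (fscale (twopii powi (p - 1)) (phi X (k + genus X)))) =
      cscale (twopii powi p) (Pi_hat X (nat \<bar>p\<bar>) (cscale (1/2)
        (chi X (wnk (nat (- p + 1)) k) + chi X (wnk (nat (- p + 1)) (k + genus X)))))"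
    and Ubar_linear: "\<And>p. p \<le> 0 \<Longrightarrow> rlinear (H1 X p) (grVbar X p) (Ubar p)"
    and Ubar_minus: "\<And>p k. p \<le> 0 \<Longrightarrow> k \<in> {1..genus X} \<Longrightarrow>
      Ubar p (H1_class X p (fscale (twopii powi (p - 1)) (phi X k))) =
      rscl (grHdyn X p) (1/2) (radd (grHdyn X p) (chi_class X p k)
        (rscl (grHdyn X p) (- 1) (chi_class X p (k + genus X))))"
    and Ubar_plus: "\<And>p k. p \<le> 0 \<Longrightarrow> k \<in> {1..genus X} \<Longrightarrow>
      Ubar p (H1_class X p (fscale (twopii powi (p - 1)) (phi X (k + genus X)))) =
      rscl (grHdyn X p) (1/2) (radd (grHdyn X p) (chi_class X p k) (chi_class X p (k + genus X)))"
  shows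
    \<comment> \<open>\<open>U\<close> is an isomorphism onto \<open>V\<close>, and \<open>V\<close> lies in \<open>P\<close> (up to the twist)\<close>
    "(\<forall>p\<le>0. riso (H1 X p) (grV X p) (U p)) \<and>
     riso (H_arch X) (Vtot X) (sum_map U) \<and>
     carr (V_untw X) \<subseteq> (\<Union>n. Pn X n 0) \<and>
     \<comment> \<open>it is equivariant\<close>
     (\<forall>x\<in>carr (H_arch X). graded_map (frob_H X) x \<in> carr (H_arch X) \<and>
        sum_map U (graded_map (frob_H X) x) = frob_V X (sum_map U x)) \<and>
     \<comment> \<open>the Tate twist corresponds to the action of \<open>(2\<pi>\<i>)^(-D)\<close>\<close>
     carr (Vtot X) = twist_D X ` carr (V_untw X) \<and>
     (\<forall>p\<le>0. \<forall>v\<in>carr (grV_untw X p). twist_D X v = cscale (twopii powi p) v) \<and>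
     (\<exists>U0. \<forall>p\<le>0. riso (H1 X 1) (grV_untw X p) (U0 p) \<and>
        (\<forall>k\<in>{1..genus X}.
           U0 p (H1_class X 1 (phi X k)) = Pi_hat X (nat \<bar>p\<bar>) (cscale (1/2)
             (chi X (wnk (nat (- p + 1)) k) - chi X (wnk (nat (- p + 1)) (k + genus X)))) \<and>
           U0 p (H1_class X 1 (phi X (k + genus X))) = Pi_hat X (nat \<bar>p\<bar>) (cscale (1/2)
             (chi X (wnk (nat (- p + 1)) k) + chi X (wnk (nat (- p + 1)) (k + genus X))))) \<and>
        (\<forall>x\<in>carr (H1 X 1). twist_H p x \<in> carr (H1 X p) \<and>
           U p (twist_H p x) = twist_D X (U0 p x))) \<and>
     \<comment> \<open>\<open>Ubar\<close> is an isomorphism of graded vector spaces (in genus 2 the piece \<open>p = -1\<close> is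
        exceptional, see \<open>genus_2_relation\<close>)\<close>
     (\<forall>p\<le>0. Ubar p ` carr (H1 X p) = carr (grVbar X p) \<and>
        (genus X \<ge> 3 \<or> p \<noteq> - 1 \<longrightarrow> riso (H1 X p) (grVbar X p) (Ubar p))) \<and>
     (genus X \<ge> 3 \<longrightarrow> riso (H_arch X) (Vbar X) (graded_map Ubar)) \<and>
     \<comment> \<open>it is equivariant\<close>
     (\<forall>x\<in>carr (H_arch X). graded_map (frob_Hdyn X) (graded_map Ubar x) \<in> carr (Vbar X) \<and>
        graded_map Ubar (graded_map (frob_H X) x) = graded_map (frob_Hdyn X) (graded_map Ubar x))"
proof -
  interpret schottky_cohomology X
    by unfold_locales (fact genus uniformization(1) coding measure phi_basis)+
  let ?g = "genus X"
  \<comment> \<open>The two prescribed formulas become one, indexed by all letters.\<close>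
  have U_gen: "U p (H1_class X p (tphi X p k)) = half ?g (v_gen X p) k" if p: "p \<le> 0" and k: "k \<in> letters X" for p k
    using k[unfolded letters_eq]
  proof (cases rule: double_cases)
    case 1
    show ?thesis unfolding tphi_def v_gen_half U_minus[OF p 1] v_untw_half(1)[OF p 1] ..
  next
    case (2 j)
    show ?thesis unfolding tphi_def v_gen_half 2(2) U_plus[OF p 2(1)] v_untw_half(2)[OF p 2(1)] ..
  qed
  have Ubar_gen: "Ubar p (H1_class X p (tphi X p k)) = gr_class X (nat (- p)) p (half ?g (tchi p) k)"
    if p: "p \<le> 0" and k: "k \<in> letters X" for p k
  proof -
    interpret Gr: presentation "grHdyn X p" "Pn X (nat (- p)) p" "gr_class X (nat (- p)) p"
      unfolding grHdyn_def by (rule Gr_presentation)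
    have m: "r *\<^sub>R tchi p i \<in> Pn X (nat (- p)) p" "tchi p j + r *\<^sub>R tchi p i \<in> Pn X (nat (- p)) p"
      "tchi p j + tchi p i \<in> Pn X (nat (- p)) p" for r i j
      by (intro subspace_add[OF Pn_subspace] subspace_scale[OF Pn_subspace] tchi_Pn)+
    from k[unfolded letters_eq] show ?thesis
    proof (cases rule: double_cases)
      case 1
      have "(1/2) *\<^sub>R (tchi p k + (- 1) *\<^sub>R tchi p (k + ?g)) = half ?g (tchi p) k"
        unfolding half_simps[OF 1] by simp
      then show ?thesis
        unfolding tphi_def Ubar_minus[OF p 1] chi_class_tchi[OF p] Gr.rscl[OF tchi_Pn]
          Gr.radd[OF tchi_Pn m(1)] Gr.rscl[OF m(2)] by (rule arg_cong)
    next
      case (2 j)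
      show ?thesis
        unfolding 2(2) tphi_def Ubar_plus[OF p 2(1)] chi_class_tchi[OF p] half_simps[OF 2(1)]
          Gr.radd[OF tchi_Pn tchi_Pn] Gr.rscl[OF m(3)] ..
    qed
  qed
  have U_riso: "riso (H1 X p) (grV X p) (U p)" if "p \<le> 0" for p
    by (rule riso_U[OF that U_linear[OF that] U_gen[OF that]])
  have U_zero: "U p (rzero (H1 X p)) = 0" if "p \<le> 0" for p
    using rlinear_zero[OF H1_presentation grV_presentation U_linear[OF that]] by (simp add: grV_def rsub_def)
  have Vtot: "Vtot X = rsub (span (\<Union>p\<in>{..0}. carr (grV X p)))"
    unfolding Vtot_span by (simp add: grV_def rsub_def)
  \<comment> \<open>The pieces lie in eigenspaces of D for different eigenvalues, hence the
    projections \<open>Pi_hat\<close> separate them.\<close>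
  have total: "riso (H_arch X) (Vtot X) (sum_map U)"
    unfolding H_arch_def Vtot
  proof (rule sum_map_riso[where T = "PCinf X" and Q = "\<lambda>p. Pi_hat X (nat (- p))"])
    show "presentation (H1 X p) (Zforms X p) (H1_class X p)" for p by (rule H1_presentation)
    show "subspace (carr (grV X p))" for p by (simp add: grV_def rsub_def)
    show "riso (H1 X p) (rsub (carr (grV X p))) (U p)" if "p \<le> 0" for p
      using U_riso[OF that] by (simp add: grV_def rsub_def)
    show "subspace (PCinf X)" by (rule PCinf_subspace)
    show "carr (grV X p) \<subseteq> PCinf X" for p
      using span_v_gen_homog[of p] homog_PCinf by (auto simp: grV_def rsub_def)
    show "Pi_hat X (nat (- p)) (y + z) = Pi_hat X (nat (- p)) y + Pi_hat X (nat (- p)) z"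
      if "y \<in> PCinf X" "z \<in> PCinf X" for p y z using Pi_hat_add[OF that] .
    show "Pi_hat X (nat (- p)) y = (if p = q then y else 0)"
      if "p \<le> 0" "q \<le> 0" "y \<in> carr (grV X q)" for p q y
    proof -
      have "y \<in> homog (nat (- q))" using that(3) span_v_gen_homog[of q] by (auto simp: grV_def rsub_def)
      from Pi_hat_homog[OF this, of "nat (- p)"] that(1,2) show ?thesis by (simp split: if_splits)
    qed
  qed
  have frob_lin: "rlinear (H_arch X) (H_arch X) (graded_map (frob_H X))"
    unfolding H_arch_def
    using rlinear_zero[OF H1_presentation H1_presentation frob_H_rlinear] frob_H_rlinear
    by (intro graded_map_rlinear) auto
  have frob_carr: "graded_map (frob_H X) x \<in> carr (H_arch X)" if "x \<in> carr (H_arch X)" for x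
    using frob_lin that by (auto simp: rlinear_def)
  have comp: "x p \<in> carr (H1 X p)" if "x \<in> carr (H_arch X)" "p \<le> 0" for x p
    using that by (auto simp: H_arch_def rdsum_def PiE_iff)
  have equiv: "sum_map U (graded_map (frob_H X) x) = frob_V X (sum_map U x)" if x: "x \<in> carr (H_arch X)" for x
  proof -
    \<comment> \<open>The Frobenius preserves zero, so the support of \<open>x\<close> contains that
      of its image, and one index set serves both sums.\<close>
    define P where "P = {p \<in> {..0}. x p \<noteq> rzero (H1 X p)}"
    have P: "finite P" "P \<subseteq> {..0}" using x by (auto simp: P_def H_arch_def rdsum_def)
    have zero: "frob_H X p (rzero (H1 X p)) = rzero (H1 X p)" for p
      by (rule rlinear_zero[OF H1_presentation H1_presentation frob_H_rlinear])
    have P': "{p \<in> {..0}. graded_map (frob_H X) x p \<noteq> rzero (H1 X p)} \<subseteq> P"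
      using zero by (auto simp: graded_map_def P_def)
    have UV: "U p (x p) \<in> carr (Vtot X)" "frob_V X (U p (x p)) \<in> carr (Vtot X)" if "p \<in> P" for p
    proof -
      have p: "p \<le> 0" using that by (simp add: P_def)
      have "U p (x p) \<in> carr (grV X p)" using U_linear[OF p] comp[OF x p] by (auto simp: rlinear_def)
      then show "U p (x p) \<in> carr (Vtot X)" using grV_sub_Vtot[OF p] by blast
      then show "frob_V X (U p (x p)) \<in> carr (Vtot X)" using frob_V_rlinear by (auto simp: rlinear_def)
    qed
    have "sum_map U x = (\<Sum>p\<in>P. U p (x p))"
      by (rule sum_map_eq[where A = "H1 X", OF x[unfolded H_arch_def]]) (use U_zero P in \<open>auto simp: P_def\<close>)
    \<comment> \<open>Coefficients 1 bring the sum into the form of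
      \<open>rlinear_sum\<close>.\<close>
    then have "frob_V X (sum_map U x) = frob_V X (\<Sum>p\<in>P. 1 *\<^sub>R U p (x p))"
      by simp
    also have "\<dots> = (\<Sum>p\<in>P. 1 *\<^sub>R frob_V X (U p (x p)))"
      by (rule rlinear_sum[OF Vtot_presentation Vtot_presentation frob_V_rlinear]) (use UV P(1) in auto)
    also have "\<dots> = (\<Sum>p\<in>P. U p (graded_map (frob_H X) x p))"
    proof (rule sum.cong[OF refl])
      fix p assume "p \<in> P"
      then have p: "p \<le> 0" by (simp add: P_def)
      show "1 *\<^sub>R frob_V X (U p (x p)) = U p (graded_map (frob_H X) x p)"
        using U_frob[OF p U_linear[OF p] U_gen[OF p] comp[OF x p]] p by (simp add: graded_map_def)
    qed
    also have "\<dots> = sum_map U (graded_map (frob_H X) x)"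
      by (rule sum_map_eq[where A = "H1 X", OF frob_carr[OF x, unfolded H_arch_def], symmetric])
        (use U_zero P P' in auto)
    finally show ?thesis ..
  qed
  \<comment> \<open>This is \<open>U p\<close> with the twists on both sides removed: one passes to
    degree \<open>p\<close> in cohomology and undoes the power of 2\<pi>i in V.\<close>
  define U0 where "U0 = (\<lambda>p x. cscale (twopii powi (- p)) (U p (twist_H p x)))"
  have twist_carr: "twist_H p x \<in> carr (H1 X p)" if "x \<in> carr (H1 X 1)" for p x
  proof -
    obtain \<eta> where \<eta>: "\<eta> \<in> Zforms X 1" "x = H1_class X 1 \<eta>"
      using \<open>x \<in> _\<close> unfolding presentation.carr[OF H1_presentation] by blast
    have "fscale (twopii powi (p - 1)) \<eta> \<in> Zforms X p"
      using fscale_twopii_Zforms[of "p - 1" X 1] \<eta>(1) by auto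
    then show ?thesis unfolding \<eta>(2) twist_H_class presentation.carr[OF H1_presentation] by (rule imageI)
  qed
  have inv: "cscale (twopii powi (- p)) (cscale (twopii powi p) f) = f"
    "cscale (twopii powi p) (cscale (twopii powi (- p)) f) = f" for p f
    by (simp_all add: cscale_cscale flip: power_int_add)
  have U0_gen: "U0 p (H1_class X 1 (tphi X 1 k)) = half ?g (v_untw X p) k"
    if p: "p \<le> 0" and k: "k \<in> letters X" for p k
  proof -
    have "twist_H p (H1_class X 1 (tphi X 1 k)) = H1_class X p (tphi X p k)"
      unfolding twist_H_class by (simp add: tphi_def)
    then show ?thesis unfolding U0_def by (simp only: U_gen[OF p k] v_gen_half inv)
  qed
  have U0_lin: "rlinear (H1 X 1) (grV_untw X p) (U0 p)" if p: "p \<le> 0" for p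
  proof -
    interpret H: presentation "H1 X 1" "Zforms X 1" "H1_class X 1" by (rule H1_presentation)
    interpret Hp: presentation "H1 X p" "Zforms X p" "H1_class X p" by (rule H1_presentation)
    have Z: "fscale (twopii powi (p - 1)) \<eta> \<in> Zforms X p" if "\<eta> \<in> Zforms X 1" for \<eta>
      using fscale_twopii_Zforms[of "p - 1" X 1] that by auto
    \<comment> \<open>Untwisting a real combination of twisted generators gives the combination of
      the untwisted ones with the same coefficients.\<close>
    have into: "cscale (twopii powi (- p)) f \<in> carr (grV_untw X p)" if "f \<in> carr (grV X p)" for f
    proof -
      have "f \<in> span (v_gen X p ` letters X)" using that by (simp add: grV_def rsub_def)
      then obtain c where c: "f = (\<Sum>k\<in>letters X. c k *\<^sub>R v_gen X p k)"
        using span_image_sum[OF finite_letters] by blast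
      have "cscale (twopii powi (- p)) f
          = (\<Sum>k\<in>letters X. c k *\<^sub>R cscale (twopii powi (- p)) (v_gen X p k))"
        unfolding c by (simp add: fun_eq_iff sum_fun_apply cscale_apply scaleR_fun_def sum_distrib_left)
      then have "cscale (twopii powi (- p)) f = (\<Sum>k\<in>letters X. c k *\<^sub>R v_untw X p k)"
        unfolding v_gen_def inv .
      then show ?thesis by (simp add: grV_untw_def rsub_def span_sum span_scale span_base)
    qed
    have cl: "H1_class X p \<eta> \<in> carr (H1 X p)" if "\<eta> \<in> Zforms X p" for \<eta>
      using that by (simp add: Hp.carr)
    have carr: "U p (H1_class X p \<eta>) \<in> carr (grV X p)" if "\<eta> \<in> Zforms X p" for \<eta>
      using U_linear[OF p] cl[OF that] by (auto simp: rlinear_def)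
    have grV: "radd (grV X p) = (+)" "rscl (grV X p) = (*\<^sub>R)" by (simp_all add: grV_def rsub_def)
    have add: "U p (H1_class X p (\<eta> + \<xi>)) = U p (H1_class X p \<eta>) + U p (H1_class X p \<xi>)"
      if "\<eta> \<in> Zforms X p" "\<xi> \<in> Zforms X p" for \<eta> \<xi>
      using U_linear[OF p] cl that unfolding rlinear_def Hp.radd[OF that, symmetric] by (simp add: grV)
    have scl: "U p (H1_class X p (r *\<^sub>R \<eta>)) = r *\<^sub>R U p (H1_class X p \<eta>)"
      if "\<eta> \<in> Zforms X p" for \<eta> r
      using U_linear[OF p] cl that unfolding rlinear_def Hp.rscl[OF that, symmetric] by (simp add: grV)
    have "radd (grV_untw X p) = (+)" "rscl (grV_untw X p) = (*\<^sub>R)" by (simp_all add: grV_untw_def rsub_def)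
    then show ?thesis
      unfolding rlinear_def H.carr
      by (auto simp: H.radd H.rscl U0_def twist_H_class fscale_add fscale_scaleR add scl Z cscale_add
          scaleR_cscale[where f = "U p _"] scaleR_cscale[where f = "cscale _ _"] cscale_cscale mult.commute
          intro!: into carr)
  qed
  have U0_riso: "riso (H1 X 1) (grV_untw X p) (U0 p)" if p: "p \<le> 0" for p
  proof (rule riso_basis[OF H1_presentation grV_untw_presentation U0_lin[OF p],
        where I = "letters X" and v = "tphi X 1" and w = "half ?g (v_untw X p)"])
    show "half ?g (v_untw X p) k \<in> carr (grV_untw X p)" if "k \<in> letters X" for k
      unfolding grV_untw_span_half using that by (intro span_base imageI)
    show "carr (grV_untw X p) = (\<lambda>x. x) ` span (half ?g (v_untw X p) ` letters X)"
      unfolding grV_untw_span_half image_ident ..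
    show "c k = 0" if "(\<Sum>k\<in>letters X. c k *\<^sub>R half ?g (v_untw X p) k) = 0" "k \<in> letters X" for c k
      using v_untw_half_indep[OF p that] .
  qed (rule tphi_Zforms, assumption, rule U0_gen[OF p], assumption, rule finite_letters, rule H1_span)
  have tphi_1: "tphi X 1 = phi X" by (simp add: tphi_def[abs_def])
  have letter: "k \<in> letters X" "k + ?g \<in> letters X" if "k \<in> {1..?g}" for k
    using that by (auto simp: letters_eq)
  have Ubar_zero: "Ubar p (rzero (H1 X p)) = rzero (grVbar X p)" if "p \<le> 0" for p
    by (rule rlinear_zero[OF H1_presentation grVbar_presentation(1)[OF that] Ubar_linear[OF that]])
  have Ubar_graded: "rlinear (H_arch X) (Vbar X) (graded_map Ubar)"
    unfolding H_arch_def Vbar_def by (rule graded_map_rlinear[OF Ubar_linear Ubar_zero])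
  have Ubar_riso: "riso (H1 X p) (grVbar X p) (Ubar p)" if "p \<le> 0" "genus X \<ge> 3 \<or> p \<noteq> - 1" for p
    by (rule riso_Ubar[OF that Ubar_linear[OF that(1)] Ubar_gen[OF that(1)]])
  have Ubar_iso: "riso (H_arch X) (Vbar X) (graded_map Ubar)" if "genus X \<ge> 3"
    unfolding H_arch_def Vbar_def
    by (rule graded_map_riso[OF Ubar_riso Ubar_zero presentation.rzero_closed[OF H1_presentation]])
      (use that in auto)
  have Ubar_equiv: "graded_map Ubar (graded_map (frob_H X) x) = graded_map (frob_Hdyn X) (graded_map Ubar x)"
    if x: "x \<in> carr (H_arch X)" for x
  proof
    fix p
    show "graded_map Ubar (graded_map (frob_H X) x) p = graded_map (frob_Hdyn X) (graded_map Ubar x) p"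
    proof (cases "p \<le> 0")
      case True
      then show ?thesis
        using Ubar_frob[OF True Ubar_linear[OF True] Ubar_gen[OF True] comp[OF x True]]
        by (simp add: graded_map_def)
    qed (simp add: graded_map_def)
  qed
  have Ubar_carr: "graded_map (frob_Hdyn X) (graded_map Ubar x) \<in> carr (Vbar X)" if x: "x \<in> carr (H_arch X)" for x
    \<comment> \<open>Membership is proved for the other side of the equivariance, where
      \<open>Ubar\<close> is a linear map into the total space.\<close>
    unfolding Ubar_equiv[OF x, symmetric] using Ubar_graded frob_carr[OF x] by (auto simp: rlinear_def)
  show ?thesis
  proof (intro conjI)
    show "\<forall>p\<le>0. riso (H1 X p) (grV X p) (U p)" using U_riso by blast
    show "riso (H_arch X) (Vtot X) (sum_map U)" by (rule total)
    show "carr (V_untw X) \<subseteq> (\<Union>n. Pn X n 0)" by (rule V_untw_real)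
    show "\<forall>x\<in>carr (H_arch X). graded_map (frob_H X) x \<in> carr (H_arch X) \<and>
        sum_map U (graded_map (frob_H X) x) = frob_V X (sum_map U x)"
      using frob_carr equiv by blast
    show "carr (Vtot X) = twist_D X ` carr (V_untw X)" by (rule Vtot_twist_D)
    show "\<forall>p\<le>0. \<forall>v\<in>carr (grV_untw X p). twist_D X v = cscale (twopii powi p) v"
      using twist_D_grV_untw by blast
    show "\<exists>U0. \<forall>p\<le>0. riso (H1 X 1) (grV_untw X p) (U0 p) \<and>
        (\<forall>k\<in>{1..genus X}.
           U0 p (H1_class X 1 (phi X k)) = Pi_hat X (nat \<bar>p\<bar>) (cscale (1/2)
             (chi X (wnk (nat (- p + 1)) k) - chi X (wnk (nat (- p + 1)) (k + genus X)))) \<and>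
           U0 p (H1_class X 1 (phi X (k + genus X))) = Pi_hat X (nat \<bar>p\<bar>) (cscale (1/2)
             (chi X (wnk (nat (- p + 1)) k) + chi X (wnk (nat (- p + 1)) (k + genus X))))) \<and>
        (\<forall>x\<in>carr (H1 X 1). twist_H p x \<in> carr (H1 X p) \<and>
           U p (twist_H p x) = twist_D X (U0 p x))"
    proof (rule exI[of _ U0], intro allI impI conjI ballI)
      fix p :: int assume p: "p \<le> 0"
      show "riso (H1 X 1) (grV_untw X p) (U0 p)" by (rule U0_riso[OF p])
      fix k assume k: "k \<in> {1..genus X}"
      show "U0 p (H1_class X 1 (phi X k)) = Pi_hat X (nat \<bar>p\<bar>) (cscale (1/2)
          (chi X (wnk (nat (- p + 1)) k) - chi X (wnk (nat (- p + 1)) (k + genus X))))"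
        unfolding v_untw_half(1)[OF p k] using U0_gen[OF p letter(1)[OF k]] unfolding tphi_1 .
      show "U0 p (H1_class X 1 (phi X (k + genus X))) = Pi_hat X (nat \<bar>p\<bar>) (cscale (1/2)
          (chi X (wnk (nat (- p + 1)) k) + chi X (wnk (nat (- p + 1)) (k + genus X))))"
        unfolding v_untw_half(2)[OF p k] using U0_gen[OF p letter(2)[OF k]] unfolding tphi_1 .
    next
      fix p :: int and x assume p: "p \<le> 0" and x: "x \<in> carr (H1 X 1)"
      show "twist_H p x \<in> carr (H1 X p)" by (rule twist_carr[OF x])
      have U0x: "U0 p x \<in> carr (grV_untw X p)" using U0_lin[OF p] x by (auto simp: rlinear_def)
      show "U p (twist_H p x) = twist_D X (U0 p x)"
        unfolding twist_D_grV_untw[OF p U0x] unfolding U0_def inv ..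
    qed
    show "\<forall>p\<le>0. Ubar p ` carr (H1 X p) = carr (grVbar X p) \<and>
        (genus X \<ge> 3 \<or> p \<noteq> - 1 \<longrightarrow> riso (H1 X p) (grVbar X p) (Ubar p))"
      using image_Ubar[OF _ Ubar_linear Ubar_gen] Ubar_riso by blast
    show "genus X \<ge> 3 \<longrightarrow> riso (H_arch X) (Vbar X) (graded_map Ubar)" using Ubar_iso by blast
    show "\<forall>x\<in>carr (H_arch X). graded_map (frob_Hdyn X) (graded_map Ubar x) \<in> carr (Vbar X) \<and>
        graded_map Ubar (graded_map (frob_H X) x) = graded_map (frob_Hdyn X) (graded_map Ubar x)"
      using Ubar_carr Ubar_equiv by blast
  qed
qed

end
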